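(* Let $0\le\alpha^-<\alpha^+<2\pi$ and suppose $\alpha^+-\alpha^-=\pi/m$ for some integer $m\ge1$. Let $\mathcal{V}=\langle\alpha^-,\alpha^+\rangle$, let $W$ be a standard two-dimensional Brownian motion starting at $x_0=(r_0\cos\theta_0,r_0\sin\theta_0)\in\mathcal{V}$ (with $\theta_0\in[\alpha^-,\alpha^+]$), and let $\tau=\inf\{t>0: W_t\in\partial\mathcal{V}\}$. For each choice of sign $\pm$, writing $y^\pm=(r\cos\alpha^\pm,r\sin\alpha^\pm)\in\partial\mathcal{V}^\pm$ with $r>0$, and for $t>0$, $$\mathbb{P}^{x_0}(\tau\in dt,\ W_\tau\in dy^\pm)=\frac{r_0}{2\pi t^2}e^{-\frac{r^2+r_0^2}{2t}}\sum_{k=0}^{m-1}\sin(\gamma_k^\pm)\,e^{\frac{rr_0}{t}\cos(\gamma_k^\pm)}\,dr\,dt,$$ where $$\gamma_k^{+}=\alpha^{+}+\frac{2k\pi}{m}-\theta_0,\qquad \gamma_k^{-}=-\alpha^{-}-\frac{2k\pi}{m}+\theta_0 .$$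
   Context: $\langle\alpha^-,\alpha^+\rangle=\{(r\cos\theta,r\sin\theta): r\ge0,\ \theta\in[\alpha^-,\alpha^+]\}$ is the wedge bounded by the rays $\partial\mathcal{V}^\pm=\{(r\cos\alpha^\pm,r\sin\alpha^\pm): r\ge0\}$, and $\partial\mathcal{V}=\partial\mathcal{V}^+\cup\partial\mathcal{V}^-$. The notation $W_\tau\in dy^\pm$ means that $W_\tau$ lies on the ray $\partial\mathcal{V}^\pm$ with $|W_\tau|\in dr$; the formula gives the joint density in $(t,r)$ on each of the two rays. *)

theory Defs
  imports "HOL-Probability.Probability"
begin

text \<open>
  Time is indexed by \<^typ>\<open>real\<close>, but only the values \<open>W t\<close> with \<open>t \<ge> 0\<close> matter.
  The density in \<open>gaussian_increments\<close> is that of the centred normal law with covariance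
  \<open>(t - s)\<close> times the identity.
\<close>

locale brownian_motion = prob_space M
  for M :: "'a measure" +
  fixes W :: "real \<Rightarrow> 'a \<Rightarrow> 'b::euclidean_space" and x\<^sub>0 :: 'b
  assumes random_variable_W: "\<And>t. 0 \<le> t \<Longrightarrow> random_variable borel (W t)"
    and start: "AE \<omega> in M. W 0 \<omega> = x\<^sub>0"
    and independent_increments:
      "\<And>(t :: nat \<Rightarrow> real) n. 0 \<le> t 0 \<Longrightarrow> (\<And>i. i < n \<Longrightarrow> t i < t (Suc i)) \<Longrightarrow>
         indep_vars (\<lambda>_. borel) (\<lambda>i \<omega>. W (t (Suc i)) \<omega> - W (t i) \<omega>) {..<n}"
    and gaussian_increments:
      "\<And>s t. 0 \<le> s \<Longrightarrow> s < t \<Longrightarrow>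
         distributed M lborel (\<lambda>\<omega>. W t \<omega> - W s \<omega>)
           (\<lambda>x. ennreal (\<Prod>b\<in>Basis. normal_density 0 (sqrt (t - s)) (x \<bullet> b)))"
    and continuous_paths: "\<And>\<omega>. \<omega> \<in> space M \<Longrightarrow> continuous_on {0..} (\<lambda>t. W t \<omega>)"

definition polar :: "real \<Rightarrow> real \<Rightarrow> real \<times> real" where
  "polar r \<theta> = (r * cos \<theta>, r * sin \<theta>)"

definition wedge :: "real \<Rightarrow> real \<Rightarrow> (real \<times> real) set" where
  "wedge a b = {polar r \<theta> | r \<theta>. 0 \<le> r \<and> \<theta> \<in> {a..b}}"

definition ray :: "real \<Rightarrow> (real \<times> real) set" where
  "ray a = {polar r a | r. 0 \<le> r}"

definition wedge_boundary :: "real \<Rightarrow> real \<Rightarrow> (real \<times> real) set" where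
  "wedge_boundary a b = ray b \<union> ray a"

text \<open>Extended reals make the hitting time infinite on paths that never hit the set.\<close>

definition hitting_time :: "(real \<Rightarrow> 'a \<Rightarrow> 'b) \<Rightarrow> 'b set \<Rightarrow> 'a \<Rightarrow> ereal" where
  "hitting_time W F \<omega> = (INF t\<in>{t. 0 < t \<and> W t \<omega> \<in> F}. ereal t)"

text \<open>
  The function \<open>f\<close> is the joint density, with respect to \<open>dr dt\<close> on \<open>t > 0\<close>, \<open>r > 0\<close>, of the time
  \<open>T\<close> and the radius \<open>r\<close> on the event that \<open>W\<close> at time \<open>T\<close> is the point of the ray with angle
  \<open>a\<close> and radius \<open>r\<close>. The Bochner integral does not truncate negative values of \<open>f\<close>.
\<close>

definition has_joint_density_on_ray ::
  "'a measure \<Rightarrow> (real \<Rightarrow> 'a \<Rightarrow> real \<times> real) \<Rightarrow> ('a \<Rightarrow> ereal) \<Rightarrow> real \<Rightarrow> (real \<Rightarrow> real \<Rightarrow> real) \<Rightarrow> bool"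
where
  "has_joint_density_on_ray M W T a f \<longleftrightarrow>
     set_integrable lborel ({0<..} \<times> {0<..}) (\<lambda>(t, r). f t r) \<and>
     (\<forall>B \<in> sets borel. B \<subseteq> {0<..} \<times> {0<..} \<longrightarrow>
        (let E = {\<omega> \<in> space M. \<exists>(t, r)\<in>B. T \<omega> = ereal t \<and> W t \<omega> = polar r a}
         in E \<in> sets M \<and> measure M E = (LINT p:B|lborel. (case p of (t, r) \<Rightarrow> f t r))))"

end

theory Submission
  imports Defs
begin

text \<open>
  The idea is optional stopping for a bounded solution of the heat equation in the wedge, built
  from images. For test data \<open>\<psi>\<close> on time and the first ray, the half-plane Poisson integral of
  \<open>\<psi>\<close> is odd in the distance to the line through the ray; summing it over the rotations by
  \<open>2 k \<pi> / m\<close> gives a function that has boundary values \<open>\<psi>\<close> on the first ray and \<open>0\<close> on the other,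
  because the remaining terms cancel in pairs. Its value at the starting point is the integral of
  \<open>\<psi>\<close> against the claimed density.

  The Poisson kernel is a derivative of the heat kernel, so it is reproduced by convolution with
  Gaussians. Hence along a time grid of mesh \<open>h\<close> the potential is a martingale up to an error
  \<open>O (h\<^sup>2)\<close> per step as long as the path keeps a distance \<open>\<epsilon>\<close> from the boundary. Letting first
  \<open>h\<close> and then \<open>\<epsilon>\<close> tend to \<open>0\<close> identifies the expectation of \<open>\<psi>\<close> at the exit, and
  \<open>\<psi>\<close> is then taken to approximate indicators.

  From a boundary point the path visits both the interior and the exterior of the wedge
  in arbitrarily small times, so the exit time is \<open>0\<close> almost surely; the density vanishes there by
  the same pairing of images.
\<close>

subsection \<open>Gaussian kernels in the plane\<close>

text \<open>The image potential jumps across every image of the axis: the half-plane term tends to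
  \<psi> from one side and to its negative from the other. It is therefore compared inside the wedge
  with a function continuous up to the boundary, in which the exit from the half-plane is expressed
  through two standard Gaussians, with the starting point as a parameter. The error of one time step
  is exactly the share of the kernel carried by exit times in (0, h]; at distance \<epsilon> from
  the line the exit density is O(t) for small t, which gives O(h^2), and T/h steps add up to O(h).
  The constant grows like \<epsilon>^-7, which forces the order of the two limits. Deterministic
  grids reduce the Markov property to the independence of finitely many increments. The data must
  vanish at nonpositive abscissas: for even m one image of the first ray, for odd m one image of the
  second ray, falls on the negative half-axis and has no partner to cancel with. Only the ray at
  angle 0 of the wedge with angles 0 and \<pi>/m is treated; an isometry brings either ray of the
  given wedge into that position.\<close>

definition heat :: "real \<Rightarrow> real \<times> real \<Rightarrow> real" where
  "heat h y = normal_density 0 (sqrt h) (fst y) * normal_density 0 (sqrt h) (snd y)"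

text \<open>For \<open>b > 0\<close> this is the density of the time at which a linear Brownian motion first covers the distance \<open>b\<close>; it is odd in \<open>b\<close>.\<close>

definition hit_density :: "real \<Rightarrow> real \<Rightarrow> real" where
  "hit_density t b = b / t * normal_density 0 (sqrt t) b"

lemma heat_nonneg [simp]: "0 \<le> heat h y"
  by (simp add: heat_def)

lemma heat_eq:
  assumes "0 < h"
  shows "heat h y = 1 / (2 * pi * h) * exp (- ((fst y)\<^sup>2 + (snd y)\<^sup>2) / (2 * h))"
proof -
  have "exp (- ((fst y)\<^sup>2 + (snd y)\<^sup>2) / (2 * h)) = exp (- ((fst y)\<^sup>2) / (2 * h)) * exp (- ((snd y)\<^sup>2) / (2 * h))"
    by (simp add: exp_add [symmetric] add_divide_distrib diff_divide_distrib)
  with assms show ?thesis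
    by (simp add: heat_def normal_density_def power2_eq_square [of "sqrt _"])
qed

lemma prod_Basis_heat: "(\<Prod>b\<in>Basis. normal_density 0 (sqrt h) (x \<bullet> b)) = heat h (x :: real \<times> real)"
proof -
  have B: "(Basis :: (real \<times> real) set) = {(1, 0), (0, 1)}"
    by (auto simp: Basis_prod_def)
  show ?thesis
    unfolding B by (simp add: heat_def inner_prod_def)
qed

lemma measurable_heat [measurable]: "heat h \<in> borel_measurable borel"
  unfolding heat_def borel_prod [symmetric] by measurable

lemma measurable_hit_density [measurable (raw)]:
  assumes [measurable]: "f \<in> borel_measurable N" "g \<in> borel_measurable N"
  shows "(\<lambda>x. hit_density (f x) (g x)) \<in> borel_measurable N"
  unfolding hit_density_def normal_density_def by measurable


lemma lborel_pair_product:
  fixes f g :: "real \<Rightarrow> real"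
  assumes f: "integrable lborel f" and g: "integrable lborel g"
  shows "integrable lborel (\<lambda>x. f (fst x) * g (snd x))"
    and "(LINT x|lborel. f (fst x) * g (snd x)) = (LINT x|lborel. f x) * (LINT x|lborel. g x)"
proof -
  have [measurable]: "f \<in> borel_measurable borel" "g \<in> borel_measurable borel"
    using f g by (auto dest: borel_measurable_integrable)
  have I: "integrable (lborel \<Otimes>\<^sub>M lborel) (\<lambda>(x, y). f x * g y)"
  proof (rule lborel_pair.Fubini_integrable)
    show "(\<lambda>(x, y). f x * g y) \<in> borel_measurable (lborel \<Otimes>\<^sub>M lborel)"
      by measurable
    show "integrable lborel (\<lambda>x. LINT y|lborel. norm (case (x, y) of (x, y) \<Rightarrow> f x * g y))"
      using f by (simp add: abs_mult)
    show "AE x in lborel. integrable lborel (\<lambda>y. case (x, y) of (x, y) \<Rightarrow> f x * g y)"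
      using g by simp
  qed
  then show "integrable lborel (\<lambda>x. f (fst x) * g (snd x))"
    by (simp add: lborel_prod case_prod_beta')
  have "(LINT x|lborel. f (fst x) * g (snd x)) = (LINT x|lborel. LINT y|lborel. f x * g y)"
    using lborel_pair.integral_fst [OF I] by (simp add: lborel_prod case_prod_beta')
  then show "(LINT x|lborel. f (fst x) * g (snd x)) = (LINT x|lborel. f x) * (LINT x|lborel. g x)"
    by simp
qed

lemma integrable_heat: "0 < h \<Longrightarrow> integrable lborel (heat h)"
  and integral_heat: "0 < h \<Longrightarrow> (LINT y|lborel. heat h y) = 1"
  unfolding heat_def [abs_def] by (simp_all add: lborel_pair_product)

lemma prob_space_heat: "0 < h \<Longrightarrow> prob_space (density lborel (heat h))"
  by (rule prob_spaceI)
     (simp add: emeasure_density nn_integral_eq_integral integrable_heat integral_heat)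

text \<open>Fubini reduces the substitution to two affine ones on the real line. For
  \<open>q = 0\<close> the map is triangular. Otherwise \<open>y\<close> is first replaced by
  \<open>a = p * x + q * y\<close>, and after swapping the integrals \<open>x\<close> is replaced by
  the second coordinate.\<close>

lemma nn_integral_lborel_linear_pair:
  fixes f :: "real \<times> real \<Rightarrow> ennreal" and p q u w :: real
  assumes f [measurable]: "f \<in> borel_measurable borel" and det: "\<bar>p * w - q * u\<bar> = 1"
  shows "(\<integral>\<^sup>+x. f (p * fst x + q * snd x, u * fst x + w * snd x) \<partial>lborel) = (\<integral>\<^sup>+x. f x \<partial>lborel)"
proof -
  have f' [measurable]: "f \<in> borel_measurable (borel \<Otimes>\<^sub>M borel)"
    using f by (simp add: borel_prod)
  have "(\<integral>\<^sup>+x. f (p * fst x + q * snd x, u * fst x + w * snd x) \<partial>lborel) =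
      (\<integral>\<^sup>+x. \<integral>\<^sup>+y. f (p * x + q * y, u * x + w * y) \<partial>lborel \<partial>lborel)"
    by (subst lborel_prod [symmetric], subst lborel.nn_integral_fst [symmetric]) simp_all
  also have "\<dots> = (\<integral>\<^sup>+x. \<integral>\<^sup>+y. f (x, y) \<partial>lborel \<partial>lborel)"
  proof (cases "q = 0")
    case True
    with det have pw: "p \<noteq> 0" "w \<noteq> 0" "ennreal \<bar>p\<bar> * ennreal \<bar>w\<bar> = 1"
      by (auto simp: abs_mult ennreal_mult [symmetric])
    have "(\<integral>\<^sup>+x. \<integral>\<^sup>+y. f (x, y) \<partial>lborel \<partial>lborel) =
        \<bar>p\<bar> * (\<integral>\<^sup>+x. \<integral>\<^sup>+y. f (p * x, y) \<partial>lborel \<partial>lborel)"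
      using pw by (subst nn_integral_real_affine [where c = p and t = 0]) simp_all
    also have "(\<lambda>x. \<integral>\<^sup>+y. f (p * x, y) \<partial>lborel) = (\<lambda>x. \<bar>w\<bar> * (\<integral>\<^sup>+y. f (p * x, u * x + w * y) \<partial>lborel))"
      using pw by (intro ext, subst nn_integral_real_affine [where c = w and t = "u * _"]) simp_all
    also have "\<bar>p\<bar> * (\<integral>\<^sup>+x. \<bar>w\<bar> * (\<integral>\<^sup>+y. f (p * x, u * x + w * y) \<partial>lborel) \<partial>lborel) =
        (\<integral>\<^sup>+x. \<integral>\<^sup>+y. f (p * x, u * x + w * y) \<partial>lborel \<partial>lborel)"
      using pw by (simp add: nn_integral_cmult mult.assoc [symmetric])
    finally show ?thesis
      using True by simp
  next
    case q: False
    \<comment> \<open>In terms of \<open>a = p * x + q * y\<close> the second coordinate is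
      \<open>w * a / q - d * x\<close>. Since the determinant has modulus 1, the product of the
      factors \<open>1 / q\<close> and \<open>1 / d\<close> has modulus 1.\<close>
    define d where "d = (p * w - q * u) / q"
    have d: "d \<noteq> 0" "ennreal \<bar>1 / q\<bar> * ennreal \<bar>1 / d\<bar> = 1"
      using det q by (auto simp: d_def abs_mult ennreal_mult [symmetric] field_simps)
    have "(\<integral>\<^sup>+x. \<integral>\<^sup>+y. f (p * x + q * y, u * x + w * y) \<partial>lborel \<partial>lborel) =
        (\<integral>\<^sup>+x. \<bar>1 / q\<bar> * (\<integral>\<^sup>+a. f (a, - d * x + w * a / q) \<partial>lborel) \<partial>lborel)"
    proof (rule nn_integral_cong)
      fix x
      show "(\<integral>\<^sup>+y. f (p * x + q * y, u * x + w * y) \<partial>lborel) =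
          \<bar>1 / q\<bar> * (\<integral>\<^sup>+a. f (a, - d * x + w * a / q) \<partial>lborel)"
        using q by (subst nn_integral_real_affine [where c = "1 / q" and t = "- p * x / q"])
          (simp_all add: d_def field_simps)
    qed
    also have "\<dots> = \<bar>1 / q\<bar> * (\<integral>\<^sup>+x. \<integral>\<^sup>+a. f (a, - d * x + w * a / q) \<partial>lborel \<partial>lborel)"
      by (simp add: nn_integral_cmult)
    also have "(\<integral>\<^sup>+x. \<integral>\<^sup>+a. f (a, - d * x + w * a / q) \<partial>lborel \<partial>lborel) =
        (\<integral>\<^sup>+a. \<integral>\<^sup>+x. f (a, - d * x + w * a / q) \<partial>lborel \<partial>lborel)"
      by (rule lborel_pair.Fubini') simp
    also have "\<dots> = (\<integral>\<^sup>+a. \<bar>1 / d\<bar> * (\<integral>\<^sup>+y. f (a, y) \<partial>lborel) \<partial>lborel)"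
    proof (rule nn_integral_cong)
      fix a
      show "(\<integral>\<^sup>+x. f (a, - d * x + w * a / q) \<partial>lborel) = \<bar>1 / d\<bar> * (\<integral>\<^sup>+y. f (a, y) \<partial>lborel)"
        using d(1) by (subst nn_integral_real_affine [where c = "- 1 / d" and t = "w * a / q / d"])
          (simp_all add: field_simps)
    qed
    also have "\<bar>1 / q\<bar> * \<dots> = (\<integral>\<^sup>+a. \<integral>\<^sup>+y. f (a, y) \<partial>lborel \<partial>lborel)"
      using d(2) by (simp add: nn_integral_cmult mult.assoc [symmetric])
    finally show ?thesis .
  qed
  also have "\<dots> = (\<integral>\<^sup>+x. f x \<partial>lborel)"
    using lborel.nn_integral_fst [of f lborel] by (simp add: lborel_prod)
  finally show ?thesis .
qed

text \<open>Completing the square splits the product of the two Gaussians into the Gaussian of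
  variance \<open>t + h\<close> at \<open>a\<close> and a normal density in \<open>y\<close>. The
  factor \<open>(a + y) / t\<close> of \<open>hit_density\<close> is affine in \<open>y\<close>, so
  its convolution needs only the mean of that density.\<close>

lemma normal_density_convolution:
  assumes "0 < t" "0 < h"
  shows "integrable lborel (\<lambda>y. normal_density 0 (sqrt t) (a + y) * normal_density 0 (sqrt h) y)"
    and "(LINT y|lborel. normal_density 0 (sqrt t) (a + y) * normal_density 0 (sqrt h) y) =
      normal_density 0 (sqrt (t + h)) a"
    and "integrable lborel (\<lambda>y. hit_density t (a + y) * normal_density 0 (sqrt h) y)"
    and "(LINT y|lborel. hit_density t (a + y) * normal_density 0 (sqrt h) y) = hit_density (t + h) a"
proof -
  \<comment> \<open>Mean and standard deviation of the normal law in \<open>y\<close> that is left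
    over by completing the square.\<close>
  define m where "m = - (a * h / (t + h))"
  define s where "s = sqrt (t * h / (t + h))"
  have s: "0 < s" using assms by (simp add: s_def)
  have eq: "normal_density 0 (sqrt t) (a + y) * normal_density 0 (sqrt h) y =
      normal_density 0 (sqrt (t + h)) a * normal_density m s y" for y
  proof -
    have s2: "s\<^sup>2 = t * h / (t + h)" using assms by (simp add: s_def)
    have e: "(a + y)\<^sup>2 / t + y\<^sup>2 / h = a\<^sup>2 / (t + h) + (y - m)\<^sup>2 / s\<^sup>2"
    proof -
      define c where "c = t + h"
      have c: "0 < c" using assms by (simp add: c_def)
      have ym: "(y - m)\<^sup>2 / s\<^sup>2 = (c * y + a * h)\<^sup>2 / (c * t * h)"
      proof -
        have "y - m = (c * y + a * h) / c"
          unfolding m_def c_def [symmetric] using c by (simp add: field_simps)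
        then show ?thesis
          unfolding s2 c_def [symmetric] using c by (simp add: power2_eq_square)
      qed
      have "(a + y)\<^sup>2 / t + y\<^sup>2 / h - a\<^sup>2 / c - (c * y + a * h)\<^sup>2 / (c * t * h) =
          (h * c * (a + y)\<^sup>2 + t * c * y\<^sup>2 - a\<^sup>2 * t * h - (c * y + a * h)\<^sup>2) / (c * t * h)"
        using assms c by (simp add: diff_divide_distrib add_divide_distrib)
      also have "h * c * (a + y)\<^sup>2 + t * c * y\<^sup>2 - a\<^sup>2 * t * h - (c * y + a * h)\<^sup>2 = 0"
        unfolding c_def by (simp add: power2_eq_square algebra_simps)
      finally show ?thesis
        unfolding ym c_def [symmetric] by simp
    qed
    have halves: "- A / 2 + - B / 2 = - C / 2 + - D / 2" if "A + B = C + D" for A B C D :: real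
      using that by (simp add: field_simps)
    have half: "- u / (2 * v) = - (u / v) / 2" for u v :: real
      by simp
    have "- (a + y)\<^sup>2 / (2 * t) + - y\<^sup>2 / (2 * h) = - a\<^sup>2 / (2 * (t + h)) + - (y - m)\<^sup>2 / (2 * s\<^sup>2)"
      unfolding half using halves [OF e] .
    then have "exp (- (a + y)\<^sup>2 / (2 * t)) * exp (- y\<^sup>2 / (2 * h)) =
        exp (- a\<^sup>2 / (2 * (t + h))) * exp (- (y - m)\<^sup>2 / (2 * s\<^sup>2))"
      by (metis exp_add)
    moreover have "sqrt (2 * pi * t) * sqrt (2 * pi * h) = sqrt (2 * pi * (t + h)) * sqrt (2 * pi * s\<^sup>2)"
      using assms add_pos_pos [OF assms] unfolding s2 real_sqrt_mult [symmetric]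
      by (simp add: field_simps)
    ultimately show ?thesis
      using assms by (simp add: normal_density_def field_simps)
  qed
  show "integrable lborel (\<lambda>y. normal_density 0 (sqrt t) (a + y) * normal_density 0 (sqrt h) y)"
    unfolding eq using s by simp
  show "(LINT y|lborel. normal_density 0 (sqrt t) (a + y) * normal_density 0 (sqrt h) y) =
      normal_density 0 (sqrt (t + h)) a"
    unfolding eq using s by simp
  have hit: "hit_density t (a + y) * normal_density 0 (sqrt h) y =
      normal_density 0 (sqrt (t + h)) a / t * (a * normal_density m s y + normal_density m s y * y)" for y
  proof -
    have "hit_density t (a + y) * normal_density 0 (sqrt h) y =
        (a + y) / t * (normal_density 0 (sqrt t) (a + y) * normal_density 0 (sqrt h) y)"
      by (simp add: hit_density_def)
    then show ?thesis
      unfolding eq by (simp add: algebra_simps add_divide_distrib)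
  qed
  show "integrable lborel (\<lambda>y. hit_density t (a + y) * normal_density 0 (sqrt h) y)"
    unfolding hit using s integrable_normal_moment_nz_1 [OF s, of m] by simp
  have "(LINT y|lborel. hit_density t (a + y) * normal_density 0 (sqrt h) y) =
      normal_density 0 (sqrt (t + h)) a / t * (a + m)"
    unfolding hit
    using s integrable_normal_moment_nz_1 [OF s, of m] integral_normal_moment_nz_1 [OF s, of m]
    by simp
  \<comment> \<open>The factor \<open>t\<close> cancels the \<open>1 / t\<close> in front and leaves
    \<open>a / (t + h)\<close>, the factor of \<open>hit_density (t + h)\<close>.\<close>
  also have "a + m = a * t / (t + h)"
    using add_pos_pos [OF assms] by (simp add: m_def field_simps)
  finally show "(LINT y|lborel. hit_density t (a + y) * normal_density 0 (sqrt h) y) = hit_density (t + h) a"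
    using assms by (simp add: hit_density_def)
qed

subsection \<open>Poisson kernel of the half-plane\<close>

lemma hit_density_uminus [simp]: "hit_density t (- b) = - hit_density t b"
  by (simp add: hit_density_def normal_density_def)

text \<open>The first passage time over the distance \<open>b\<close> has the law of
  \<open>b\<^sup>2 / Z\<^sup>2\<close> with \<open>Z\<close> standard Gaussian: the Jacobian
  \<open>2 * b\<^sup>2 / z ^ 3\<close> turns \<open>hit_density\<close> into twice the standard
  normal density on the positive half-line.\<close>

lemma hit_density_substitution:
  assumes b: "0 < b" and F [measurable]: "F \<in> borel_measurable borel" and C: "\<And>t. \<bar>F t\<bar> \<le> C"
  shows "set_integrable lborel {0<..} (\<lambda>t. F t * hit_density t b)"
    and "(LINT t:{0<..}|lborel. F t * hit_density t b) =
      (LINT z:{0<..}|lborel. 2 * std_normal_density z * F (b\<^sup>2 / z\<^sup>2))"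
proof -
  let ?g = "\<lambda>z::real. b\<^sup>2 / z\<^sup>2" and ?g' = "\<lambda>z::real. - 2 * b\<^sup>2 / z ^ 3"
  let ?f = "\<lambda>t. F t * hit_density t b" and ?h = "\<lambda>z. 2 * std_normal_density z * F (b\<^sup>2 / z\<^sup>2)"
  have h_int: "set_integrable lborel {0<..} ?h"
    unfolding set_integrable_def
  proof (rule Bochner_Integration.integrable_bound)
    show "integrable lborel (\<lambda>z. 2 * C * std_normal_density z)"
      by simp
    show "AE z in lborel. norm (indicator {0<..} z *\<^sub>R ?h z) \<le> norm (2 * C * std_normal_density z)"
    proof (rule AE_I2)
      fix z
      have "\<bar>F (b\<^sup>2 / z\<^sup>2)\<bar> \<le> \<bar>C\<bar>"
        using C [of "b\<^sup>2 / z\<^sup>2"] by linarith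
      then have "2 * std_normal_density z * \<bar>F (b\<^sup>2 / z\<^sup>2)\<bar> \<le> 2 * std_normal_density z * \<bar>C\<bar>"
        by (intro mult_left_mono) simp_all
      then show "norm (indicator {0<..} z *\<^sub>R ?h z) \<le> norm (2 * C * std_normal_density z)"
        by (simp add: abs_mult indicator_def mult_ac)
    qed
  qed measurable
  have img: "?g ` {0<..} = {0<..}"
  proof safe
    fix t :: real assume t: "0 < t"
    have "t = b\<^sup>2 / (b / sqrt t)\<^sup>2"
      using b t by (simp add: power_divide)
    then show "t \<in> ?g ` {0<..}"
      using b t by (intro image_eqI [of _ _ "b / sqrt t"]) auto
  qed (use b in auto)
  have eq: "\<bar>?g' z\<bar> * ?f (?g z) = ?h z" if "z \<in> {0<..}" for z
  proof -
    from that have z: "0 < z" by simp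
    have sq: "sqrt (b\<^sup>2 / z\<^sup>2) = b / z"
      using b z by (simp add: real_sqrt_divide)
    have nd: "normal_density 0 (b / z) b = z / b * std_normal_density z"
    proof -
      have "sqrt (2 * pi * (b / z)\<^sup>2) = sqrt (2 * pi) * (b / z)"
        using b z by (simp add: real_sqrt_mult)
      then show ?thesis
        using b z by (simp add: normal_density_def power_divide)
    qed
    have "?f (?g z) = F (?g z) * (b / (b\<^sup>2 / z\<^sup>2) * (z / b * std_normal_density z))"
      by (simp only: hit_density_def sq nd)
    moreover have "\<bar>?g' z\<bar> = 2 * b\<^sup>2 / z ^ 3"
      using z by (simp add: abs_mult)
    ultimately show ?thesis
      using b z by (simp add: power2_eq_square power3_eq_cube)
  qed
  \<comment> \<open>The change of variables theorem is stated for
    \<open>absolutely_integrable_on\<close>, that is for the completed measure; for Borel functions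
    the completion changes nothing.\<close>
  have leb: "set_integrable lborel {0<..} u \<longleftrightarrow> u absolutely_integrable_on {0<..}"
    if [measurable]: "u \<in> borel_measurable borel" for u :: "real \<Rightarrow> real"
    unfolding set_integrable_def by (subst integrable_completion) simp_all
  have CV: "(\<lambda>z. \<bar>?g' z\<bar> * ?f (?g z)) absolutely_integrable_on {0<..} \<and>
      integral {0<..} (\<lambda>z. \<bar>?g' z\<bar> * ?f (?g z)) = c \<longleftrightarrow>
      ?f absolutely_integrable_on (?g ` {0<..}) \<and> integral (?g ` {0<..}) ?f = c" for c
  proof (rule has_absolute_integral_change_of_variables_1')
    fix z :: real assume "z \<in> {0<..}"
    then show "(?g has_field_derivative ?g' z) (at z within {0<..})"
      by (auto intro!: derivative_eq_intros simp: power2_eq_square power3_eq_cube field_simps)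
  next
    show "inj_on ?g {0<..}"
      using b by (auto simp: inj_on_def)
  qed simp
  have "?h absolutely_integrable_on {0<..}"
    using h_int by (subst leb [symmetric]) simp_all
  then have "(\<lambda>z. \<bar>?g' z\<bar> * ?f (?g z)) absolutely_integrable_on {0<..}"
    by (subst set_integrable_cong [OF refl refl eq]) simp_all
  moreover have "integral {0<..} (\<lambda>z. \<bar>?g' z\<bar> * ?f (?g z)) = integral {0<..} ?h"
    by (rule Henstock_Kurzweil_Integration.integral_cong) (rule eq)
  ultimately have *: "?f absolutely_integrable_on {0<..}" "integral {0<..} ?f = integral {0<..} ?h"
    using CV [of "integral {0<..} ?h"] unfolding img by auto
  from *(1) show f_int: "set_integrable lborel {0<..} ?f"
    by (subst leb) simp_all
  show "(LINT t:{0<..}|lborel. ?f t) = (LINT z:{0<..}|lborel. ?h z)"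
    using set_borel_integral_eq_integral(2) [OF f_int] set_borel_integral_eq_integral(2) [OF h_int] *(2)
    by simp
qed

lemma integral_even_half_line:
  fixes G :: "real \<Rightarrow> real"
  assumes G: "integrable lborel G" and even: "\<And>z. G (- z) = G z"
  shows "(LINT z:{0<..}|lborel. 2 * G z) = (LINT z|lborel. G z)"
proof -
  have set: "set_integrable lborel A G" if "A \<in> sets borel" for A
    using that G unfolding set_integrable_def by (intro integrable_mult_indicator) simp_all
  have "(LINT z|lborel. G z) = (LINT z:UNIV|lborel. G z)"
    by (simp add: set_lebesgue_integral_def)
  also have "UNIV = {..<0} \<union> ({0} \<union> {0::real<..})"
    by auto
  also have "(LINT z:{..<0} \<union> ({0} \<union> {0<..})|lborel. G z) =
      (LINT z:{..<0}|lborel. G z) + ((LINT z:{0}|lborel. G z) + (LINT z:{0<..}|lborel. G z))"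
    by (subst set_integral_Un; (subst set_integral_Un)?) (auto intro!: set)
  also have "(LINT z:{0}|lborel. G z) = 0"
    unfolding set_lebesgue_integral_def
    by (rule integral_eq_zero_AE) (use AE_lborel_singleton [of 0] in \<open>auto elim!: eventually_mono\<close>)
  also have "(LINT z:{..<0}|lborel. G z) = (LINT z:{0<..}|lborel. G z)"
    unfolding set_lebesgue_integral_def
    by (subst lborel_integral_real_affine [where c = "- 1" and t = 0]) (auto simp: even indicator_def intro!: Bochner_Integration.integral_cong)
  finally show ?thesis
    by simp
qed

text \<open>The second argument is a pair (time, abscissa of the exit point on the line \<open>snd = 0\<close>). The sign of the ordinate of \<open>x\<close> is kept, so that the kernel is odd across the line.\<close>

definition poisson_kernel :: "real \<times> real \<Rightarrow> real \<times> real \<Rightarrow> real" where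
  "poisson_kernel x p = indicator {0<..} (fst p) *
     (normal_density 0 (sqrt (fst p)) (fst x - snd p) * hit_density (fst p) (snd x))"

definition layer_potential :: "(real \<times> real \<Rightarrow> real) \<Rightarrow> real \<Rightarrow> real \<times> real \<Rightarrow> real" where
  "layer_potential \<psi> s x = (LINT p|lborel. \<psi> (s + fst p, snd p) * poisson_kernel x p)"

text \<open>The substitution \<open>t = b\<^sup>2 / z\<^sup>2\<close> turns the hitting time into a function of a standard Gaussian \<open>z\<close>. In contrast to \<open>layer_potential\<close> this is continuous up to the line; at \<open>fst w = 0\<close> the integrand has a harmless junk value.\<close>

definition layer_mean :: "(real \<times> real \<Rightarrow> real) \<Rightarrow> real \<Rightarrow> real \<times> real \<Rightarrow> real" where
  "layer_mean \<psi> s x = (LINT w|lborel. \<psi> (s + (snd x)\<^sup>2 / (fst w)\<^sup>2, fst x + \<bar>snd x / fst w\<bar> * snd w) * heat 1 w)"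

lemma measurable_poisson_kernel [measurable (raw)]:
  assumes [measurable]: "f \<in> N \<rightarrow>\<^sub>M borel" "g \<in> N \<rightarrow>\<^sub>M borel"
  shows "(\<lambda>x. poisson_kernel (f x) (g x)) \<in> borel_measurable N"
proof -
  have [measurable]: "f \<in> N \<rightarrow>\<^sub>M borel \<Otimes>\<^sub>M borel" "g \<in> N \<rightarrow>\<^sub>M borel \<Otimes>\<^sub>M borel"
    using assms by (simp_all add: borel_prod)
  show ?thesis
    unfolding poisson_kernel_def normal_density_def by measurable
qed

lemma poisson_kernel_uminus: "poisson_kernel (a, - b) p = - poisson_kernel (a, b) p"
  by (simp add: poisson_kernel_def)

lemma normal_density_shift: "normal_density 0 \<sigma> (a - r) = normal_density a \<sigma> r"
  by (simp add: normal_density_def power2_commute)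

lemma hit_density_integral:
  assumes "b \<noteq> 0"
  shows "set_integrable lborel {0<..} (\<lambda>t. \<bar>hit_density t b\<bar>)" (is ?A)
    and "(LINT t:{0<..}|lborel. \<bar>hit_density t b\<bar>) = 1" (is ?B)
proof -
  have eq: "\<bar>hit_density t b\<bar> = 1 * hit_density t \<bar>b\<bar>" if "t \<in> {0<..}" for t
    using that by (simp add: hit_density_def abs_mult normal_density_def)
  have "(LINT z:{0<..}|lborel. 2 * std_normal_density z) = 1"
    by (subst integral_even_half_line) (simp_all add: normal_density_def)
  moreover note hit_density_substitution [of "\<bar>b\<bar>" "\<lambda>_. 1" 1]
  ultimately have "set_integrable lborel {0<..} (\<lambda>t. 1 * hit_density t \<bar>b\<bar>)"
    "(LINT t:{0<..}|lborel. 1 * hit_density t \<bar>b\<bar>) = 1"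
    using assms by simp_all
  then show ?A ?B
    by (subst set_integrable_cong [OF refl refl eq] set_lebesgue_integral_cong [OF _ allI [OF impI [OF eq]]]; simp)+
qed

text \<open>Integrating over the abscissa first removes the Gaussian factor, which has mass 1. The
  set \<open>A\<close> of times is left free: all positive times give the total mass,
  \<open>{0<..h}\<close> gives the error of one time step.\<close>

lemma poisson_kernel_integral_bound:
  assumes "A \<in> sets borel" "A \<subseteq> {0<..}" "set_integrable lborel A (\<lambda>t. \<bar>hit_density t b\<bar>)"
  shows "integrable lborel (\<lambda>p. indicator A (fst p) * poisson_kernel (a, b) p)"
    and "(LINT p|lborel. indicator A (fst p) * \<bar>poisson_kernel (a, b) p\<bar>) = (LINT t:A|lborel. \<bar>hit_density t b\<bar>)"
proof -
  have [measurable]: "A \<in> sets borel" by fact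
  let ?f = "\<lambda>(t, r). indicator A t * poisson_kernel (a, b) (t, r)"
  have ker: "(LINT r|lborel. \<bar>?f (t, r)\<bar>) = indicator A t * \<bar>hit_density t b\<bar>" for t
  proof (cases "t \<in> A")
    case True
    then have t: "0 < t" using assms(2) by auto
    have "(LINT r|lborel. \<bar>?f (t, r)\<bar>) = (LINT r|lborel. normal_density a (sqrt t) r * \<bar>hit_density t b\<bar>)"
      using True t by (intro Bochner_Integration.integral_cong)
        (simp_all add: poisson_kernel_def abs_mult normal_density_shift)
    then show ?thesis
      using True t by simp
  qed simp
  have I: "integrable (lborel \<Otimes>\<^sub>M lborel) ?f"
  proof (rule lborel_pair.Fubini_integrable)
    show "?f \<in> borel_measurable (lborel \<Otimes>\<^sub>M lborel)"
      by (simp add: borel_prod [symmetric])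
    show "integrable lborel (\<lambda>t. LINT r|lborel. norm (?f (t, r)))"
      using assms(3) unfolding real_norm_def ker set_integrable_def by simp
    show "AE t in lborel. integrable lborel (\<lambda>r. ?f (t, r))"
    proof (rule AE_I2)
      fix t
      show "integrable lborel (\<lambda>r. ?f (t, r))"
        using assms(2) by (cases "t \<in> A") (auto simp: poisson_kernel_def normal_density_shift)
    qed
  qed
  then show "integrable lborel (\<lambda>p. indicator A (fst p) * poisson_kernel (a, b) p)"
    by (simp add: lborel_prod case_prod_beta')
  have "integrable (lborel \<Otimes>\<^sub>M lborel) (\<lambda>p. \<bar>?f p\<bar>)"
    using I by simp
  from lborel_pair.integral_fst' [OF this] have "(LINT p|(lborel \<Otimes>\<^sub>M lborel). \<bar>?f p\<bar>) = (LINT t:A|lborel. \<bar>hit_density t b\<bar>)"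
    unfolding ker set_lebesgue_integral_def by simp
  then show "(LINT p|lborel. indicator A (fst p) * \<bar>poisson_kernel (a, b) p\<bar>) = (LINT t:A|lborel. \<bar>hit_density t b\<bar>)"
    by (simp add: lborel_prod case_prod_beta' abs_mult)
qed

lemma integrable_poisson_kernel: "integrable lborel (poisson_kernel x)"
  and poisson_kernel_mass: "(LINT p|lborel. \<bar>poisson_kernel x p\<bar>) \<le> 1"
proof -
  obtain a b where x: "x = (a, b)" by (cases x)
  have *: "indicator {0<..} (fst p) * poisson_kernel x p = poisson_kernel x p" for p
    by (simp add: poisson_kernel_def indicator_def)
  have **: "indicator {0<..} (fst p) * \<bar>poisson_kernel x p\<bar> = \<bar>poisson_kernel x p\<bar>" for p
    by (simp add: poisson_kernel_def indicator_def)
  have "integrable lborel (poisson_kernel x) \<and> (LINT p|lborel. \<bar>poisson_kernel x p\<bar>) \<le> 1"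
  proof (cases "b = 0")
    case True
    then have "poisson_kernel x = (\<lambda>_. 0)"
      by (auto simp: x poisson_kernel_def hit_density_def)
    then show ?thesis by simp
  next
    case False
    show ?thesis
      using poisson_kernel_integral_bound [OF _ _ hit_density_integral(1) [OF False], of a, folded x]
        hit_density_integral(2) [OF False] unfolding * ** by simp
  qed
  then show "integrable lborel (poisson_kernel x)" "(LINT p|lborel. \<bar>poisson_kernel x p\<bar>) \<le> 1"
    by auto
qed

section \<open>Half-plane potentials of bounded boundary data\<close>

locale bounded_data =
  fixes \<psi> :: "real \<times> real \<Rightarrow> real" and C :: real
  assumes measurable_data [measurable]: "\<psi> \<in> borel_measurable borel"
    and data_bound: "\<And>p. \<bar>\<psi> p\<bar> \<le> C"
begin

lemma C_nonneg: "0 \<le> C"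
  using data_bound [of "(0, 0)"] by linarith

lemma measurable_data' [measurable (raw)]:
  "f \<in> borel_measurable N \<Longrightarrow> g \<in> borel_measurable N \<Longrightarrow> (\<lambda>x. \<psi> (f x, g x)) \<in> borel_measurable N"
  by (rule measurable_compose [OF _ measurable_data]) (simp add: borel_prod [symmetric])

lemma integrable_data_mult:
  assumes "integrable lborel k" "F \<in> borel_measurable lborel" "\<And>w. \<bar>F w\<bar> \<le> C"
  shows "integrable lborel (\<lambda>w. F w * (k w :: real))"
proof (rule Bochner_Integration.integrable_bound)
  show "integrable lborel (\<lambda>w. C * k w)"
    using assms(1) by simp
  show "(\<lambda>w. F w * k w) \<in> borel_measurable lborel"
    using assms(1,2) by simp
  show "AE w in lborel. norm (F w * k w) \<le> norm (C * k w)"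
    using assms(3) C_nonneg by (intro AE_I2) (simp add: abs_mult mult_right_mono)
qed

lemma integrable_layer: "integrable lborel (\<lambda>p. \<psi> (s + fst p, snd p) * poisson_kernel x p)"
  by (rule integrable_data_mult [OF integrable_poisson_kernel])
     (simp_all add: data_bound borel_prod [symmetric])

lemma layer_potential_bound: "\<bar>layer_potential \<psi> s x\<bar> \<le> C"
proof -
  have "\<bar>layer_potential \<psi> s x\<bar> \<le> (LINT p|lborel. \<bar>\<psi> (s + fst p, snd p) * poisson_kernel x p\<bar>)"
    unfolding layer_potential_def by (rule integral_abs_bound)
  also have "\<dots> \<le> (LINT p|lborel. C * \<bar>poisson_kernel x p\<bar>)"
    using data_bound
    by (intro integral_mono integrable_abs integrable_layer integrable_mult_right integrable_poisson_kernel)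
       (auto simp: abs_mult intro: mult_right_mono)
  also have "\<dots> \<le> C * 1"
    unfolding integral_mult_right_zero by (intro mult_left_mono poisson_kernel_mass C_nonneg)
  finally show ?thesis by simp
qed

lemma layer_potential_uminus: "layer_potential \<psi> s (a, - b) = - layer_potential \<psi> s (a, b)"
  by (simp add: layer_potential_def poisson_kernel_uminus)

text \<open>Given the exit time \<open>t\<close>, the abscissa is \<open>a + sqrt t * w\<close> with
  \<open>w\<close> Gaussian; under \<open>t = b\<^sup>2 / z\<^sup>2\<close> the factor
  \<open>sqrt t\<close> becomes \<open>b / z\<close>. The integrand is then even in
  \<open>z\<close>, so the half-line with weight 2 can be replaced by the whole line.\<close>

lemma layer_mean_pos:
  assumes b: "0 < b"
  shows "layer_potential \<psi> s (a, b) = layer_mean \<psi> s (a, b)"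
proof -
  define F where "F t = (LINT w|lborel. \<psi> (s + t, a + sqrt t * w) * std_normal_density w)" for t
  have F_m [measurable]: "F \<in> borel_measurable borel"
    unfolding F_def by measurable
  have F_b: "\<bar>F t\<bar> \<le> C" for t
  proof -
    have "\<bar>F t\<bar> \<le> (LINT w|lborel. \<bar>\<psi> (s + t, a + sqrt t * w) * std_normal_density w\<bar>)"
      unfolding F_def by (rule integral_abs_bound)
    also have "\<dots> \<le> (LINT w|lborel. C * std_normal_density w)"
      using data_bound C_nonneg by (intro integral_mono integrable_abs integrable_data_mult)
        (auto simp: abs_mult intro: mult_right_mono)
    finally show ?thesis by simp
  qed
  have "integrable (lborel \<Otimes>\<^sub>M lborel) (\<lambda>p. \<psi> (s + fst p, snd p) * poisson_kernel (a, b) p)"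
    using integrable_layer by (simp add: lborel_prod)
  from lborel_pair.integral_fst' [OF this]
  have "layer_potential \<psi> s (a, b) = (LINT t|lborel. LINT r|lborel. \<psi> (s + t, r) * poisson_kernel (a, b) (t, r))"
    by (simp add: layer_potential_def lborel_prod)
  also have "\<dots> = (LINT t:{0<..}|lborel. F t * hit_density t b)"
    unfolding set_lebesgue_integral_def
  proof (intro Bochner_Integration.integral_cong refl)
    fix t :: real
    show "(LINT r|lborel. \<psi> (s + t, r) * poisson_kernel (a, b) (t, r)) = indicator {0<..} t *\<^sub>R (F t * hit_density t b)"
    proof (cases "0 < t")
      case t: True
      have nd: "sqrt t * normal_density 0 (sqrt t) (sqrt t * w) = std_normal_density w" for w
        using t by (simp add: normal_density_def real_sqrt_mult power_mult_distrib)
      have "(LINT r|lborel. \<psi> (s + t, r) * poisson_kernel (a, b) (t, r)) =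
          (LINT r|lborel. \<psi> (s + t, r) * normal_density a (sqrt t) r * hit_density t b)"
        using t by (simp add: poisson_kernel_def normal_density_shift mult.assoc)
      also have "\<dots> = (LINT r|lborel. \<psi> (s + t, r) * normal_density a (sqrt t) r) * hit_density t b"
        by simp
      also have "(LINT r|lborel. \<psi> (s + t, r) * normal_density a (sqrt t) r) =
          (LINT w|lborel. sqrt t * (\<psi> (s + t, a + sqrt t * w) * normal_density a (sqrt t) (a + sqrt t * w)))"
        using t by (subst lborel_integral_real_affine [where c = "sqrt t" and t = a]) simp_all
      also have "\<dots> = F t"
        unfolding F_def nd [symmetric] using t
        by (intro Bochner_Integration.integral_cong) (auto simp: normal_density_def)
      finally show ?thesis
        using t by simp
    qed (simp add: poisson_kernel_def)
  qed
  also have "\<dots> = (LINT z:{0<..}|lborel. 2 * std_normal_density z * F (b\<^sup>2 / z\<^sup>2))"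
    by (rule hit_density_substitution(2) [OF b F_m F_b])
  also have "\<dots> = (LINT z:{0<..}|lborel. 2 * (std_normal_density z * F (b\<^sup>2 / z\<^sup>2)))"
    by (simp add: mult.assoc)
  also have "\<dots> = (LINT z|lborel. std_normal_density z * F (b\<^sup>2 / z\<^sup>2))"
  proof (rule integral_even_half_line)
    have "integrable lborel (\<lambda>z. F (b\<^sup>2 / z\<^sup>2) * std_normal_density z)"
      by (rule integrable_data_mult) (simp_all add: F_b)
    then show "integrable lborel (\<lambda>z. std_normal_density z * F (b\<^sup>2 / z\<^sup>2))"
      by (simp add: mult.commute)
  qed (simp add: normal_density_def)
  also have "\<dots> = (LINT z|lborel. LINT w|lborel. \<psi> (s + b\<^sup>2 / z\<^sup>2, a + \<bar>b / z\<bar> * w) * heat 1 (z, w))"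
    using b by (intro Bochner_Integration.integral_cong refl)
      (simp add: F_def heat_def real_sqrt_divide mult_ac flip: integral_mult_right_zero)
  also have "\<dots> = layer_mean \<psi> s (a, b)"
  proof -
    have "integrable (lborel \<Otimes>\<^sub>M lborel)
        (\<lambda>w. \<psi> (s + b\<^sup>2 / (fst w)\<^sup>2, a + \<bar>b / fst w\<bar> * snd w) * heat 1 w)"
      unfolding lborel_prod
      by (rule integrable_data_mult [OF integrable_heat]) (simp_all add: data_bound borel_prod [symmetric])
    from lborel_pair.integral_fst' [OF this] show ?thesis
      by (simp add: layer_mean_def lborel_prod)
  qed
  finally show ?thesis .
qed

text \<open>\<open>layer_mean\<close> is even in the ordinate and \<open>layer_potential\<close> is
  odd, so the jump across the line sits in the sign factor alone. On the line the kernel vanishes,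
  in agreement with \<open>sgn 0 = 0\<close>.\<close>

lemma layer_potential_eq_mean: "layer_potential \<psi> s x = sgn (snd x) * layer_mean \<psi> s x"
proof -
  obtain a b where x: "x = (a, b)" by (cases x)
  consider "b = 0" | "0 < b" | "0 < - b" by linarith
  then show ?thesis
  proof cases
    case 1
    then show ?thesis
      by (simp add: x layer_potential_def poisson_kernel_def hit_density_def)
  next
    case 2
    then show ?thesis by (simp add: x layer_mean_pos)
  next
    case 3
    have "layer_mean \<psi> s (a, - b) = layer_mean \<psi> s (a, b)"
      by (simp add: layer_mean_def)
    with 3 layer_mean_pos [OF 3, of s a] show ?thesis
      by (simp add: x layer_potential_uminus)
  qed
qed

end

lemma measurable_fst_borel [measurable (raw)]:
  fixes f :: "'c \<Rightarrow> 'a::second_countable_topology \<times> 'b::second_countable_topology"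
  assumes "f \<in> borel_measurable N"
  shows "(\<lambda>x. fst (f x)) \<in> borel_measurable N"
  using measurable_compose [OF assms, of fst borel] by (simp add: borel_prod [symmetric])

lemma measurable_snd_borel [measurable (raw)]:
  fixes f :: "'c \<Rightarrow> 'a::second_countable_topology \<times> 'b::second_countable_topology"
  assumes "f \<in> borel_measurable N"
  shows "(\<lambda>x. snd (f x)) \<in> borel_measurable N"
  using measurable_compose [OF assms, of snd borel] by (simp add: borel_prod [symmetric])

section \<open>Rotation invariance and averaging with the heat kernel\<close>

lemma lborel_distr_linear_pair:
  fixes p q u w :: real
  assumes det: "\<bar>p * w - q * u\<bar> = 1"
  shows "distr lborel borel (\<lambda>x. (p * fst x + q * snd x, u * fst x + w * snd x)) = lborel"
proof (rule measure_eqI)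
  have m [measurable]: "(\<lambda>x :: real \<times> real. (p * fst x + q * snd x, u * fst x + w * snd x)) \<in> borel \<rightarrow>\<^sub>M borel"
    by (simp add: borel_prod [symmetric])
  fix A :: "(real \<times> real) set" assume "A \<in> sets (distr lborel borel (\<lambda>x. (p * fst x + q * snd x, u * fst x + w * snd x)))"
  then have [measurable]: "A \<in> sets borel" by simp
  have "emeasure (distr lborel borel (\<lambda>x. (p * fst x + q * snd x, u * fst x + w * snd x))) A =
      (\<integral>\<^sup>+x. indicator A x \<partial>distr lborel borel (\<lambda>x. (p * fst x + q * snd x, u * fst x + w * snd x)))"
    by simp
  also have "\<dots> = (\<integral>\<^sup>+x. indicator A (p * fst x + q * snd x, u * fst x + w * snd x) \<partial>lborel)"
    by (rule nn_integral_distr) simp_all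
  also have "\<dots> = (\<integral>\<^sup>+x. indicator A x \<partial>lborel)"
    by (rule nn_integral_lborel_linear_pair [OF _ det]) simp
  finally show "emeasure (distr lborel borel (\<lambda>x. (p * fst x + q * snd x, u * fst x + w * snd x))) A = emeasure lborel A"
    by simp
qed simp

definition rotate :: "real \<Rightarrow> real \<times> real \<Rightarrow> real \<times> real" where
  "rotate \<theta> x = (cos \<theta> * fst x - sin \<theta> * snd x, sin \<theta> * fst x + cos \<theta> * snd x)"

lemma rotate_polar: "rotate \<theta> (polar r \<delta>) = polar r (\<delta> + \<theta>)"
  by (simp add: rotate_def polar_def cos_add sin_add algebra_simps)

lemma rotate_add: "rotate \<theta> (x + y) = rotate \<theta> x + rotate \<theta> y"
  by (simp add: rotate_def algebra_simps)

lemma measurable_rotate [measurable]: "rotate \<theta> \<in> borel \<rightarrow>\<^sub>M borel"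
  unfolding rotate_def [abs_def] by (simp add: borel_prod [symmetric])

lemma tendsto_rotate [tendsto_intros]:
  "(f \<longlongrightarrow> l) F \<Longrightarrow> ((\<lambda>x. rotate \<theta> (f x)) \<longlongrightarrow> rotate \<theta> l) F"
  unfolding rotate_def by (intro tendsto_intros)

lemma lborel_distr_rotate: "distr lborel borel (rotate \<theta>) = lborel"
  using lborel_distr_linear_pair [of "cos \<theta>" "cos \<theta>" "- sin \<theta>" "sin \<theta>"]
  by (simp add: rotate_def [abs_def] power2_eq_square [symmetric])

lemma heat_rotate: "0 < h \<Longrightarrow> heat h (rotate \<theta> y) = heat h y"
proof -
  assume h: "0 < h"
  have "(cos \<theta> * a - sin \<theta> * b)\<^sup>2 + (sin \<theta> * a + cos \<theta> * b)\<^sup>2 = ((cos \<theta>)\<^sup>2 + (sin \<theta>)\<^sup>2) * (a\<^sup>2 + b\<^sup>2)" for a b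
    by algebra
  then show ?thesis
    using h by (simp add: heat_eq rotate_def)
qed

lemma integral_heat_rotate:
  fixes g :: "real \<times> real \<Rightarrow> real"
  assumes [measurable]: "g \<in> borel_measurable borel" and h: "0 < h"
  shows "(LINT y|lborel. g (rotate \<theta> y) * heat h y) = (LINT y|lborel. g y * heat h y)"
proof -
  have "(LINT y|lborel. g (rotate \<theta> y) * heat h y) = (LINT y|lborel. g (rotate \<theta> y) * heat h (rotate \<theta> y))"
    using h by (simp add: heat_rotate)
  also have "\<dots> = (LINT y|distr lborel borel (rotate \<theta>). g y * heat h y)"
    by (subst integral_distr) simp_all
  finally show ?thesis
    by (simp add: lborel_distr_rotate)
qed

text \<open>For a fixed exit point the kernel, continued oddly, solves the heat equation in the
  whole plane, so averaging with a Gaussian of variance \<open>h\<close> moves the exit time by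
  \<open>h\<close>. The coordinates separate into the two convolutions of
  \<open>normal_density_convolution\<close>.\<close>

lemma poisson_kernel_heat:
  assumes h: "0 < h" and t: "0 < fst p"
  shows "(LINT y|lborel. poisson_kernel (x + y) p * heat h y) = poisson_kernel x (p + (h, 0))"
proof -
  let ?f = "\<lambda>y. normal_density 0 (sqrt (fst p)) ((fst x - snd p) + y) * normal_density 0 (sqrt h) y"
  let ?g = "\<lambda>y. hit_density (fst p) (snd x + y) * normal_density 0 (sqrt h) y"
  have "(LINT y|lborel. poisson_kernel (x + y) p * heat h y) = (LINT y|lborel. ?f (fst y) * ?g (snd y))"
    using t by (intro Bochner_Integration.integral_cong)
      (simp_all add: poisson_kernel_def heat_def algebra_simps)
  also have "\<dots> = (LINT y|lborel. ?f y) * (LINT y|lborel. ?g y)"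
    using t h by (intro lborel_pair_product normal_density_convolution)
  also have "\<dots> = poisson_kernel x (p + (h, 0))"
    using t h by (simp add: normal_density_convolution poisson_kernel_def)
  finally show ?thesis .
qed

text \<open>The factor \<open>exp (- b\<^sup>2 / (2 * t))\<close> beats every power of
  \<open>1 / t\<close>. A bound linear in \<open>t\<close> is the aim: integrated over times up to
  \<open>h\<close> it yields order \<open>h\<^sup>2\<close>.\<close>

lemma abs_hit_density_le:
  assumes b: "0 < \<epsilon>" "\<epsilon> \<le> \<bar>b\<bar>" and t: "0 < t" "t \<le> 1"
  shows "\<bar>hit_density t b\<bar> \<le> 1024 / \<epsilon> ^ 7 * t"
proof -
  have b0: "0 < \<bar>b\<bar>" using b by linarith
  define u where "u = b\<^sup>2 / (2 * t)"
  have u: "0 < u" using b0 t by (simp add: u_def)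
  \<comment> \<open>Squaring this gives \<open>exp u \<ge> u ^ 4 / 64\<close>; with
    \<open>u = b\<^sup>2 / (2 * t)\<close> the constant becomes \<open>64 * 16 = 1024\<close>. The
    fourth power leaves \<open>t\<^sup>2 / \<bar>b\<bar> ^ 7\<close> once the factors
    \<open>\<bar>b\<bar> / t\<close> and \<open>1 / t\<close> are taken in.\<close>
  have "(u / 2)\<^sup>2 / 2 \<le> exp (u / 2)"
    using exp_lower_Taylor_quadratic [of "u / 2"] u by simp
  then have "((u / 2)\<^sup>2 / 2)\<^sup>2 \<le> (exp (u / 2))\<^sup>2"
    by (intro power_mono) simp_all
  also have "(exp (u / 2))\<^sup>2 = exp u"
    by (simp add: exp_double [symmetric])
  finally have "exp (- u) \<le> 64 / u ^ 4"
    using u by (simp add: exp_minus field_simps power2_eq_square power4_eq_xxxx)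
  also have "64 / u ^ 4 = 1024 * t ^ 4 / b ^ 8"
    using b0 t by (simp add: u_def field_simps power_mult [symmetric])
  finally have e: "exp (- u) \<le> 1024 * t ^ 4 / \<bar>b\<bar> ^ 8"
    by simp
  have "t * 1 \<le> sqrt t"
    using t by (intro real_le_rsqrt) (simp add: power2_eq_square mult_left_le)
  also have "\<dots> \<le> sqrt (2 * pi * t)"
    using t pi_gt3 by simp
  finally have s: "t \<le> sqrt (2 * pi * t)" by simp
  have "\<bar>hit_density t b\<bar> = \<bar>b\<bar> / t * (exp (- u) / sqrt (2 * pi * t))"
    using t by (simp add: hit_density_def normal_density_def abs_mult u_def)
  also have "\<dots> \<le> \<bar>b\<bar> / t * ((1024 * t ^ 4 / \<bar>b\<bar> ^ 8) / t)"
    using t b0 s e by (intro mult_left_mono frac_le) simp_all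
  also have "\<dots> = 1024 / \<bar>b\<bar> ^ 7 * (t * t)"
    using t b0 by (simp add: field_simps eval_nat_numeral)
  also have "\<dots> \<le> 1024 / \<epsilon> ^ 7 * (t * 1)"
    using t b by (intro mult_mono divide_left_mono power_mono) simp_all
  finally show ?thesis by simp
qed

context bounded_data begin

lemma measurable_layer_potential [measurable (raw)]:
  assumes [measurable]: "f \<in> borel_measurable N" "g \<in> N \<rightarrow>\<^sub>M borel"
  shows "(\<lambda>x. layer_potential \<psi> (f x) (g x)) \<in> borel_measurable N"
  unfolding layer_potential_def by measurable

text \<open>By Fubini the average falls on the kernel, where it only increases the exit time by
  \<open>h\<close>. A shift of time then restores the integrand of \<open>layer_potential\<close> at
  \<open>s\<close>, with the exit times up to \<open>h\<close> cut off.\<close>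

lemma layer_potential_heat:
  assumes h: "0 < h"
  shows "(LINT y|lborel. layer_potential \<psi> (s + h) (x + y) * heat h y) =
    (LINT p|lborel. indicator {h<..} (fst p) * (\<psi> (s + fst p, snd p) * poisson_kernel x p))"
proof -
  let ?F = "\<lambda>y p. \<psi> (s + h + fst p, snd p) * poisson_kernel (x + y) p * heat h y"
  have I: "integrable (lborel \<Otimes>\<^sub>M lborel) (\<lambda>(y, p). ?F y p)"
  proof (rule lborel_pair.Fubini_integrable)
    show m: "(\<lambda>(y, p). ?F y p) \<in> borel_measurable (lborel \<Otimes>\<^sub>M lborel)"
      by measurable
    show "integrable lborel (\<lambda>y. LINT p|lborel. norm (case (y, p) of (y, p) \<Rightarrow> ?F y p))"
    proof (rule Bochner_Integration.integrable_bound)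
      show "integrable lborel (\<lambda>y. C * heat h y)"
        using h by (simp add: integrable_heat)
      show "AE y in lborel. norm (LINT p|lborel. norm (case (y, p) of (y, p) \<Rightarrow> ?F y p)) \<le> norm (C * heat h y)"
      proof (rule AE_I2)
        fix y
        have "(LINT p|lborel. norm (?F y p)) \<le> (LINT p|lborel. C * \<bar>poisson_kernel (x + y) p\<bar> * heat h y)"
          using data_bound integrable_layer [of "s + h"]
          by (intro integral_mono integrable_norm integrable_mult_left integrable_mult_right integrable_abs integrable_poisson_kernel)
             (auto simp: abs_mult intro!: mult_right_mono)
        also have "\<dots> = C * (LINT p|lborel. \<bar>poisson_kernel (x + y) p\<bar>) * heat h y"
          by simp
        also have "\<dots> \<le> C * 1 * heat h y"
          by (intro mult_right_mono mult_left_mono poisson_kernel_mass) (simp_all add: C_nonneg)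
        finally show "norm (LINT p|lborel. norm (case (y, p) of (y, p) \<Rightarrow> ?F y p)) \<le> norm (C * heat h y)"
          using C_nonneg by (simp add: abs_mult)
      qed
    qed measurable
    show "AE y in lborel. integrable lborel (\<lambda>p. case (y, p) of (y, p) \<Rightarrow> ?F y p)"
      using integrable_layer [of "s + h"] by simp
  qed
  have "(LINT y|lborel. layer_potential \<psi> (s + h) (x + y) * heat h y) = (LINT y|lborel. LINT p|lborel. ?F y p)"
    by (simp add: layer_potential_def)
  also have "\<dots> = (LINT p|lborel. LINT y|lborel. ?F y p)"
    using lborel_pair.Fubini_integral [OF I] by simp
  also have "\<dots> = (LINT p|lborel. indicator {h<..} (fst ((h, 0) + p)) *
      (\<psi> (s + fst ((h, 0) + p), snd ((h, 0) + p)) * poisson_kernel x ((h, 0) + p)))"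
  proof (intro Bochner_Integration.integral_cong refl)
    fix p :: "real \<times> real"
    show "(LINT y|lborel. ?F y p) = indicator {h<..} (fst ((h, 0) + p)) *
      (\<psi> (s + fst ((h, 0) + p), snd ((h, 0) + p)) * poisson_kernel x ((h, 0) + p))"
    proof (cases "0 < fst p")
      case True
      have "(LINT y|lborel. ?F y p) = \<psi> (s + h + fst p, snd p) * (LINT y|lborel. poisson_kernel (x + y) p * heat h y)"
        by (simp add: mult.assoc)
      then show ?thesis
        using True poisson_kernel_heat [OF h True, of x] by (simp add: add_ac)
    qed (simp add: poisson_kernel_def)
  qed
  also have "\<dots> = (LINT p|distr lborel borel ((+) (h, 0)). indicator {h<..} (fst p) * (\<psi> (s + fst p, snd p) * poisson_kernel x p))"
    by (subst integral_distr) simp_all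
  finally show ?thesis
    by (simp add: lborel_distr_plus)
qed

text \<open>The two terms differ by the integral over exit times in \<open>{0<..h}\<close>, the
  share of paths that leave the half-plane during the step. There \<open>hit_density\<close> is at
  most \<open>1024 / \<epsilon> ^ 7 * h\<close>, on an interval of length \<open>h\<close>.\<close>

lemma layer_potential_defect:
  assumes h: "0 < h" "h \<le> 1" and x: "0 < \<epsilon>" "\<epsilon> \<le> \<bar>snd x\<bar>"
  shows "\<bar>(LINT y|lborel. layer_potential \<psi> (s + h) (x + y) * heat h y) - layer_potential \<psi> s x\<bar>
    \<le> C * 1024 / \<epsilon> ^ 7 * h\<^sup>2"
proof -
  obtain a b where ab: "x = (a, b)" by (cases x)
  have b: "b \<noteq> 0" "\<epsilon> \<le> \<bar>b\<bar>" using x ab by auto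
  let ?K = "\<lambda>p. \<psi> (s + fst p, snd p) * poisson_kernel x p"
  have ind: "integrable lborel (\<lambda>p. indicator A (fst p) * ?K p)" if A: "A \<in> sets borel" for A
  proof (rule Bochner_Integration.integrable_bound [OF integrable_layer [of s x]])
    show "(\<lambda>p. indicator A (fst p) * ?K p) \<in> borel_measurable lborel"
      using A by measurable
  qed (simp add: indicator_def)
  have set: "set_integrable lborel {0<..h} (\<lambda>t. \<bar>hit_density t b\<bar>)"
    by (rule set_integrable_subset [OF hit_density_integral(1) [OF b(1)]]) auto
  have "layer_potential \<psi> s x - (LINT y|lborel. layer_potential \<psi> (s + h) (x + y) * heat h y) =
      (LINT p|lborel. ?K p - indicator {h<..} (fst p) * ?K p)"
    unfolding layer_potential_heat [OF h(1)] unfolding layer_potential_def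
    using integrable_layer ind by (subst Bochner_Integration.integral_diff) auto
  also have "\<dots> = (LINT p|lborel. indicator {0<..h} (fst p) * ?K p)"
    by (intro Bochner_Integration.integral_cong) (auto simp: indicator_def poisson_kernel_def)
  finally have "\<bar>(LINT y|lborel. layer_potential \<psi> (s + h) (x + y) * heat h y) - layer_potential \<psi> s x\<bar> =
      \<bar>LINT p|lborel. indicator {0<..h} (fst p) * ?K p\<bar>"
    by linarith
  also have "\<dots> \<le> (LINT p|lborel. \<bar>indicator {0<..h} (fst p) * ?K p\<bar>)"
    by (rule integral_abs_bound)
  also have "\<dots> \<le> (LINT p|lborel. C * (indicator {0<..h} (fst p) * \<bar>poisson_kernel x p\<bar>))"
  proof (intro integral_mono integrable_abs ind integrable_mult_right)
    have "integrable lborel (\<lambda>p. \<bar>indicator {0<..h} (fst p) * poisson_kernel x p\<bar>)"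
      unfolding ab by (intro integrable_abs poisson_kernel_integral_bound(1)) (use set in auto)
    then show "integrable lborel (\<lambda>p. indicator {0<..h} (fst p) * \<bar>poisson_kernel x p\<bar>)"
      by (simp add: abs_mult)
  next
    fix p
    show "\<bar>indicator {0<..h} (fst p) * ?K p\<bar> \<le> C * (indicator {0<..h} (fst p) * \<bar>poisson_kernel x p\<bar>)"
      using data_bound by (auto simp: abs_mult indicator_def intro: mult_right_mono)
  qed simp
  also have "\<dots> = C * (LINT t:{0<..h}|lborel. \<bar>hit_density t b\<bar>)"
    unfolding ab integral_mult_right_zero by (subst poisson_kernel_integral_bound(2)) (use set in auto)
  also have "(LINT t:{0<..h}|lborel. \<bar>hit_density t b\<bar>) \<le> (LINT t:{0<..h}|lborel. 1024 / \<epsilon> ^ 7 * h)"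
  proof (rule set_integral_mono [OF set])
    show "set_integrable lborel {0<..h} (\<lambda>t. 1024 / \<epsilon> ^ 7 * h)"
      using h by (simp add: set_integrable_def)
    fix t assume t: "t \<in> {0<..h}"
    then have "\<bar>hit_density t b\<bar> \<le> 1024 / \<epsilon> ^ 7 * t"
      using x b h by (intro abs_hit_density_le) auto
    also have "\<dots> \<le> 1024 / \<epsilon> ^ 7 * h"
      using t x by (intro mult_left_mono) auto
    finally show "\<bar>hit_density t b\<bar> \<le> 1024 / \<epsilon> ^ 7 * h" .
  qed
  also have "(LINT t:{0<..h}|lborel. 1024 / \<epsilon> ^ 7 * h) = 1024 / \<epsilon> ^ 7 * h\<^sup>2"
    using h by (simp add: set_lebesgue_integral_def power2_eq_square)
  finally show ?thesis
    using C_nonneg by (simp add: mult_left_mono)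
qed

end

locale continuous_data = bounded_data +
  assumes continuous_data: "continuous_on UNIV \<psi>"
begin

lemma layer_mean_tendsto:
  assumes s: "s \<longlonglongrightarrow> s'" and x: "x \<longlonglongrightarrow> x'"
  shows "(\<lambda>n. layer_mean \<psi> (s n) (x n)) \<longlonglongrightarrow> layer_mean \<psi> s' x'"
  unfolding layer_mean_def
proof (rule integral_dominated_convergence)
  show "integrable lborel (\<lambda>w. C * heat 1 w)"
    by (simp add: integrable_heat)
  show "AE w in lborel. (\<lambda>n. \<psi> (s n + (snd (x n))\<^sup>2 / (fst w)\<^sup>2, fst (x n) + \<bar>snd (x n) / fst w\<bar> * snd w) * heat 1 w)
      \<longlonglongrightarrow> \<psi> (s' + (snd x')\<^sup>2 / (fst w)\<^sup>2, fst x' + \<bar>snd x' / fst w\<bar> * snd w) * heat 1 w"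
  proof (intro AE_I2 tendsto_mult tendsto_const)
    fix w :: "real \<times> real"
    have "isCont \<psi> p" for p
      using continuous_data continuous_on_eq_continuous_at [OF open_UNIV] by blast
    moreover have "(\<lambda>n. (s n + (snd (x n))\<^sup>2 / (fst w)\<^sup>2, fst (x n) + \<bar>snd (x n) / fst w\<bar> * snd w))
        \<longlonglongrightarrow> (s' + (snd x')\<^sup>2 / (fst w)\<^sup>2, fst x' + \<bar>snd x' / fst w\<bar> * snd w)"
      \<comment> \<open>Division by \<open>fst w\<close> becomes multiplication by a constant, so
        the limit holds at \<open>fst w = 0\<close> as well.\<close>
      unfolding divide_inverse by (intro tendsto_intros s x)
    ultimately show "(\<lambda>n. \<psi> (s n + (snd (x n))\<^sup>2 / (fst w)\<^sup>2, fst (x n) + \<bar>snd (x n) / fst w\<bar> * snd w))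
      \<longlonglongrightarrow> \<psi> (s' + (snd x')\<^sup>2 / (fst w)\<^sup>2, fst x' + \<bar>snd x' / fst w\<bar> * snd w)"
      by (rule isCont_tendsto_compose)
  qed
  show "AE w in lborel. norm (\<psi> (s n + (snd (x n))\<^sup>2 / (fst w)\<^sup>2, fst (x n) + \<bar>snd (x n) / fst w\<bar> * snd w) * heat 1 w)
      \<le> C * heat 1 w" for n
    using data_bound by (intro AE_I2) (simp add: abs_mult mult_right_mono)
qed simp_all

lemma layer_mean_boundary: "layer_mean \<psi> s (a, 0) = \<psi> (s, a)"
  by (simp add: layer_mean_def integral_heat)

end

subsection \<open>Images in the wedge\<close>

text \<open>The smaller of the signed distances to the lines bounding the wedge with angles \<open>0\<close> and \<open>\<pi> / m\<close>.\<close>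

definition wedge_margin :: "nat \<Rightarrow> real \<times> real \<Rightarrow> real" where
  "wedge_margin m x = min (snd x) (fst x * sin (pi / real m) - snd x * cos (pi / real m))"

lemma wedge_margin_polar: "wedge_margin m (polar r \<delta>) = min (r * sin \<delta>) (r * sin (pi / real m - \<delta>))"
  by (simp add: wedge_margin_def polar_def sin_diff algebra_simps)

lemma continuous_wedge_margin [continuous_intros]:
  "continuous_on A f \<Longrightarrow> continuous_on A (\<lambda>x. wedge_margin m (f x))"
  unfolding wedge_margin_def by (intro continuous_intros)

lemma measurable_wedge_margin [measurable]: "wedge_margin m \<in> borel_measurable borel"
  unfolding wedge_margin_def [abs_def] by measurable

lemma polar_representation: "\<exists>r \<delta>. x = polar r \<delta> \<and> 0 \<le> r \<and> 0 \<le> \<delta> \<and> \<delta> < 2 * pi"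
proof -
  obtain r t where rt: "Complex (fst x) (snd x) = rcis r t" "0 \<le> r" "0 \<le> t" "t < 2 * pi"
  proof -
    let ?z = "Complex (fst x) (snd x)"
    have "?z = rcis (norm ?z) (Arg2pi ?z)"
      using Arg2pi_eq [of ?z] by (simp add: rcis_def cis_conv_exp)
    then show ?thesis
      using that Arg2pi [of ?z] by auto
  qed
  then have "x = polar r t"
    by (metis Re_rcis Im_rcis complex.sel polar_def prod.collapse)
  with rt show ?thesis by blast
qed

lemma pi_div_nat: "1 \<le> m \<Longrightarrow> 0 < pi / real m" "1 \<le> m \<Longrightarrow> pi / real m \<le> pi"
  by (simp_all add: field_simps)

lemma wedge_margin_pos_polar:
  assumes m: "1 \<le> m" and x: "0 < wedge_margin m x"
  obtains r \<delta> where "x = polar r \<delta>" "0 < r" "0 < \<delta>" "\<delta> < pi / real m"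
proof -
  obtain r \<delta> where p: "x = polar r \<delta>" "0 \<le> r" "0 \<le> \<delta>" "\<delta> < 2 * pi"
    using polar_representation by blast
  have pos: "0 < r * sin \<delta>" "0 < r * sin (pi / real m - \<delta>)"
    using x unfolding p(1) wedge_margin_polar by auto
  then have r: "0 < r" using p(2) by (cases "r = 0") auto
  then have s: "0 < sin \<delta>" "0 < sin (pi / real m - \<delta>)"
    using pos by (simp_all add: zero_less_mult_iff)
  have "\<delta> < pi"
    using s(1) p sin_le_zero [of \<delta>] by (cases "pi \<le> \<delta>") auto
  moreover have "0 < \<delta>"
    using s(1) p(3) by (cases "\<delta> = 0") auto
  moreover have "\<delta> < pi / real m"
  proof (rule ccontr)
    assume "\<not> \<delta> < pi / real m"
    then have "0 \<le> sin (\<delta> - pi / real m)"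
      using \<open>\<delta> < pi\<close> pi_div_nat [OF m] by (intro sin_ge_zero) auto
    then show False
      using s(2) sin_minus [of "\<delta> - pi / real m"] by simp
  qed
  ultimately show ?thesis
    using that p(1) r by blast
qed

lemma wedge_margin_pos:
  assumes "0 < r" "0 < \<delta>" "\<delta> < pi / real m" "1 \<le> m"
  shows "0 < wedge_margin m (polar r \<delta>)"
  unfolding wedge_margin_polar using assms pi_div_nat(2) [OF assms(4)]
  by (auto intro!: sin_gt_zero mult_pos_pos)

lemma wedge_margin_polar_nonneg:
  assumes "1 \<le> m" "0 \<le> r" "0 \<le> \<delta>" "\<delta> \<le> pi / real m"
  shows "0 \<le> wedge_margin m (polar r \<delta>)"
  unfolding wedge_margin_polar using assms pi_div_nat(2) [OF assms(1)]
  by (auto intro!: mult_nonneg_nonneg sin_ge_zero)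

lemma wedge_margin_ray: "1 \<le> m \<Longrightarrow> 0 \<le> r \<Longrightarrow> wedge_margin m (polar r 0) = 0"
  "1 \<le> m \<Longrightarrow> 0 \<le> r \<Longrightarrow> wedge_margin m (polar r (pi / real m)) = 0"
  unfolding wedge_margin_polar using pi_div_nat [of m] sin_ge_zero [of "pi / real m"] by auto

text \<open>For \<open>m = 1\<close> the two linear forms coincide and the sign of the abscissa
  selects the ray. For larger \<open>m\<close> the sine of the opening is positive, and the
  nonnegativity of one form selects the half of the line on which the other vanishes.\<close>

lemma wedge_margin_zeroE:
  assumes m: "1 \<le> m" and x: "wedge_margin m x = 0"
  obtains r where "0 \<le> r" "x = polar r 0" | r where "0 \<le> r" "x = polar r (pi / real m)"
proof (cases "m = 1")
  case True
  then have "snd x = 0"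
    using x by (auto simp: wedge_margin_def min_def split: if_splits)
  then show ?thesis
    using that(1) [of "fst x"] that(2) [of "- fst x"] True
    by (cases "0 \<le> fst x") (auto simp: polar_def prod_eq_iff)
next
  case False
  then have m2: "2 \<le> m" using m by simp
  have s: "0 < sin (pi / real m)"
    using m2 pi_gt_zero by (intro sin_gt_zero) (auto simp: field_simps)
  show ?thesis
  proof (cases "snd x = 0")
    case True
    then have "0 \<le> fst x * sin (pi / real m)"
      using x by (auto simp: wedge_margin_def min_def split: if_splits)
    then have "0 \<le> fst x"
      using s by (simp add: zero_le_mult_iff)
    with True show ?thesis
      using that(1) [of "fst x"] by (simp add: polar_def prod_eq_iff)
  next
    case False
    then have e: "fst x * sin (pi / real m) = snd x * cos (pi / real m)" "0 \<le> snd x"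
      using x by (auto simp: wedge_margin_def min_def split: if_splits)
    then have "x = polar (snd x / sin (pi / real m)) (pi / real m)"
      using s by (simp add: polar_def prod_eq_iff field_simps)
    then show ?thesis
      using that(2) [of "snd x / sin (pi / real m)"] e s by simp
  qed
qed

text \<open>A minimum of two linear forms is superadditive. This keeps a boundary point plus an
  interior direction inside the wedge.\<close>

lemma wedge_margin_add: "wedge_margin m x + wedge_margin m y \<le> wedge_margin m (x + y)"
  by (simp add: wedge_margin_def min_def algebra_simps)

definition image_angle :: "nat \<Rightarrow> nat \<Rightarrow> real" where
  "image_angle m k = 2 * real k * pi / real m"

text \<open>Up to a half-turn the image angle is \<open>\<delta> + j * pi / m\<close> with
  \<open>0 \<le> j < m\<close>: \<open>j = 2 * k\<close> for images above the axis, and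
  \<open>j = 2 * k - m\<close> for those below. It lies between \<open>\<delta>\<close> and
  \<open>pi - (pi / m - \<delta>)\<close>, and on a subinterval of \<open>[0, pi]\<close> the sine
  is smallest at an end point.\<close>

lemma sin_image_angle:
  assumes m: "1 \<le> m" and k: "k < m" and \<delta>: "0 < \<delta>" "\<delta> < pi / real m"
  shows "min (sin \<delta>) (sin (pi / real m - \<delta>)) \<le>
    (if 2 * k < m then 1 else - 1) * sin (\<delta> + image_angle m k)"
proof -
  have key: "min (sin \<delta>) (sin (pi / real m - \<delta>)) \<le> sin (\<delta> + real j * pi / real m)" if j: "j < m" for j
  proof -
    have jm: "real j + 1 \<le> real m" using j by linarith
    have m0: "0 < real m" using m by simp
    have ub: "real j * pi / real m + pi / real m \<le> pi"
    proof -
      have "(real j + 1) * pi \<le> real m * pi"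
        using jm by (intro mult_right_mono) simp_all
      then show ?thesis
        using m0 by (simp add: field_simps)
    qed
    have lb: "0 \<le> real j * pi / real m" by simp
    have conc: "min (sin a) (sin b) \<le> sin t" if "0 \<le> a" "a \<le> t" "t \<le> b" "b \<le> pi" for a b t :: real
    proof (cases "t \<le> pi / 2")
      case True
      then have "sin a \<le> sin t"
        using that by (intro sin_monotone_2pi_le) auto
      then show ?thesis by simp
    next
      case False
      then have "sin (pi - b) \<le> sin (pi - t)"
        using that by (intro sin_monotone_2pi_le) auto
      then show ?thesis by simp
    qed
    have "min (sin \<delta>) (sin (pi - (pi / real m - \<delta>))) \<le> sin (\<delta> + real j * pi / real m)"
      using \<delta> ub lb by (intro conc) linarith+
    then show ?thesis by simp
  qed
  show ?thesis
  proof (cases "2 * k < m")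
    case True
    then show ?thesis
      using key [of "2 * k"] by (simp add: image_angle_def)
  next
    case False
    have "\<delta> + image_angle m k = (\<delta> + real (2 * k - m) * pi / real m) + pi"
      using False m by (simp add: image_angle_def of_nat_diff field_simps)
    then have "sin (\<delta> + image_angle m k) = - sin (\<delta> + real (2 * k - m) * pi / real m)"
      by (simp only: sin_periodic_pi)
    then show ?thesis
      using False k key [of "2 * k - m"] by simp
  qed
qed

text \<open>No image comes closer to the axis than the margin of the point, and none changes sides.
  The first fact gives the half-plane estimate for all images at once, the second fixes the signs in
  \<open>wedge_extension\<close>.\<close>

lemma wedge_margin_image:
  assumes m: "1 \<le> m" and k: "k < m" and x: "0 < wedge_margin m x"
  shows "wedge_margin m x \<le> (if 2 * k < m then 1 else - 1) * snd (rotate (image_angle m k) x)"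
proof -
  obtain r \<delta> where p: "x = polar r \<delta>" "0 < r" "0 < \<delta>" "\<delta> < pi / real m"
    using wedge_margin_pos_polar [OF m x] .
  have "r * min (sin \<delta>) (sin (pi / real m - \<delta>)) \<le> r * ((if 2 * k < m then 1 else - 1) * sin (\<delta> + image_angle m k))"
    using p by (intro mult_left_mono sin_image_angle m k) auto
  moreover have "r * min (sin \<delta>) (sin (pi / real m - \<delta>)) = min (r * sin \<delta>) (r * sin (pi / real m - \<delta>))"
    using p(2) by (simp add: min_mult_distrib_left)
  ultimately show ?thesis
    unfolding p(1) rotate_polar wedge_margin_polar by (simp add: polar_def split: if_splits)
qed

text \<open>The index \<open>k\<close> is paired with \<open>m - k\<close>, and only
  \<open>0\<close> has no partner below \<open>m\<close>. A self-paired index contributes nothing,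
  since its term equals its own negative.\<close>

lemma sum_reflect_zero:
  fixes T :: "nat \<Rightarrow> real"
  assumes "\<And>k. 0 < k \<Longrightarrow> k < m \<Longrightarrow> T (m - k) = - T k" and "1 \<le> m"
  shows "(\<Sum>k<m. T k) = T 0"
proof -
  obtain n where n: "m = Suc n" using assms(2) by (cases m) auto
  have "(\<Sum>i<n. T (Suc i)) = (\<Sum>i<n. T (Suc (n - Suc i)))"
    by (rule sum.nat_diff_reindex [symmetric])
  also have "\<dots> = (\<Sum>i<n. - T (Suc i))"
  proof (rule sum.cong [OF refl])
    fix i assume "i \<in> {..<n}"
    then show "T (Suc (n - Suc i)) = - T (Suc i)"
      using assms(1) [of "Suc i"] by (simp add: n Suc_diff_Suc)
  qed
  finally have "(\<Sum>i<n. T (Suc i)) = 0"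
    by (simp add: sum_negf)
  then show ?thesis
    by (simp add: n sum.lessThan_Suc_shift del: sum.lessThan_Suc)
qed

text \<open>The pairing of \<open>k\<close> with \<open>m - 1 - k\<close> suits the second ray; here
  every index has a partner.\<close>

lemma sum_reflect_zero':
  fixes T :: "nat \<Rightarrow> real"
  assumes "\<And>k. k < m \<Longrightarrow> T (m - Suc k) = - T k"
  shows "(\<Sum>k<m. T k) = 0"
proof -
  have "(\<Sum>k<m. T k) = (\<Sum>k<m. T (m - Suc k))"
    by (rule sum.nat_diff_reindex [symmetric])
  also have "\<dots> = (\<Sum>k<m. - T k)"
    by (rule sum.cong) (simp_all add: assms)
  finally show ?thesis
    by (simp add: sum_negf)
qed

lemma image_angle_reflect:
  assumes "0 < m" "k \<le> m"
  shows "image_angle m (m - k) = 2 * pi - image_angle m k"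
  using assms by (simp add: image_angle_def of_nat_diff field_simps)

lemma image_angle_reflect':
  assumes "k < m"
  shows "pi / real m + image_angle m (m - Suc k) = 2 * pi - (pi / real m + image_angle m k)"
  using assms by (simp add: image_angle_def of_nat_diff field_simps)

lemma cos_reflect_2pi: "cos (2 * pi - x) = cos (x :: real)"
  and sin_reflect_2pi: "sin (2 * pi - x) = - sin (x :: real)"
  by (simp_all add: cos_diff sin_diff)

definition wedge_potential :: "nat \<Rightarrow> (real \<times> real \<Rightarrow> real) \<Rightarrow> real \<Rightarrow> real \<times> real \<Rightarrow> real" where
  "wedge_potential m \<psi> s x = (\<Sum>k<m. layer_potential \<psi> s (rotate (image_angle m k) x))"

text \<open>In the interior of the wedge every image has a fixed sign, so that this continuous function agrees there with \<open>wedge_potential\<close>.\<close>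

definition wedge_extension :: "nat \<Rightarrow> (real \<times> real \<Rightarrow> real) \<Rightarrow> real \<Rightarrow> real \<times> real \<Rightarrow> real" where
  "wedge_extension m \<psi> s x =
     (\<Sum>k<m. (if 2 * k < m then 1 else - 1) * layer_mean \<psi> s (rotate (image_angle m k) x))"

context bounded_data begin

lemma measurable_wedge_potential [measurable (raw)]:
  assumes [measurable]: "f \<in> borel_measurable N" "g \<in> N \<rightarrow>\<^sub>M borel"
  shows "(\<lambda>x. wedge_potential m \<psi> (f x) (g x)) \<in> borel_measurable N"
  unfolding wedge_potential_def by measurable

lemma wedge_potential_bound: "\<bar>wedge_potential m \<psi> s x\<bar> \<le> real m * C"
proof -
  have "\<bar>wedge_potential m \<psi> s x\<bar> \<le> (\<Sum>k<m. \<bar>layer_potential \<psi> s (rotate (image_angle m k) x)\<bar>)"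
    unfolding wedge_potential_def by (rule sum_abs)
  also have "\<dots> \<le> of_nat (card {..<m}) * C"
    by (rule sum_bounded_above) (rule layer_potential_bound)
  finally show ?thesis by simp
qed

lemma wedge_potential_eq_extension:
  assumes m: "1 \<le> m" and x: "0 < wedge_margin m x"
  shows "wedge_potential m \<psi> s x = wedge_extension m \<psi> s x"
  unfolding wedge_potential_def wedge_extension_def
proof (rule sum.cong [OF refl])
  fix k assume "k \<in> {..<m}"
  then have "0 < (if 2 * k < m then 1 else - 1) * snd (rotate (image_angle m k) x)"
    using wedge_margin_image [OF m _ x, of k] x by simp
  then have "sgn (snd (rotate (image_angle m k) x)) = (if 2 * k < m then 1 else - 1)"
    by (auto split: if_splits)
  then show "layer_potential \<psi> s (rotate (image_angle m k) x) =
      (if 2 * k < m then 1 else - 1) * layer_mean \<psi> s (rotate (image_angle m k) x)"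
    unfolding layer_potential_eq_mean by (simp only:)
qed

text \<open>The heat kernel is invariant under rotations, so averaging commutes with passing to an
  image, and each image poses a half-plane problem at distance at least \<open>\<epsilon>\<close>
  from the line.\<close>

lemma wedge_potential_defect:
  assumes m: "1 \<le> m" and h: "0 < h" "h \<le> 1" and x: "0 < \<epsilon>" "\<epsilon> \<le> wedge_margin m x"
  shows "\<bar>(LINT y|lborel. wedge_potential m \<psi> (s + h) (x + y) * heat h y) - wedge_potential m \<psi> s x\<bar>
    \<le> real m * (C * 1024 / \<epsilon> ^ 7 * h\<^sup>2)"
proof -
  let ?R = "\<lambda>k. rotate (image_angle m k)"
  have int: "integrable lborel (\<lambda>y. layer_potential \<psi> s' (x' + ?R k y) * heat h y)" for s' x' k
    using h by (intro integrable_data_mult integrable_heat) (auto intro: layer_potential_bound)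
  have "(LINT y|lborel. wedge_potential m \<psi> (s + h) (x + y) * heat h y) =
      (LINT y|lborel. (\<Sum>k<m. layer_potential \<psi> (s + h) (?R k x + ?R k y) * heat h y))"
    by (simp add: wedge_potential_def rotate_add sum_distrib_right)
  also have "\<dots> = (\<Sum>k<m. LINT y|lborel. layer_potential \<psi> (s + h) (?R k x + ?R k y) * heat h y)"
    by (rule Bochner_Integration.integral_sum) (rule int)
  also have "\<dots> = (\<Sum>k<m. LINT y|lborel. layer_potential \<psi> (s + h) (?R k x + y) * heat h y)"
    using h by (intro sum.cong refl integral_heat_rotate [where g = "\<lambda>y. layer_potential \<psi> (s + h) (?R _ x + y)"]) simp_all
  finally have "\<bar>(LINT y|lborel. wedge_potential m \<psi> (s + h) (x + y) * heat h y) - wedge_potential m \<psi> s x\<bar> =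
      \<bar>\<Sum>k<m. (LINT y|lborel. layer_potential \<psi> (s + h) (?R k x + y) * heat h y) - layer_potential \<psi> s (?R k x)\<bar>"
    by (simp add: wedge_potential_def sum_subtractf)
  also have "\<dots> \<le> (\<Sum>k<m. \<bar>(LINT y|lborel. layer_potential \<psi> (s + h) (?R k x + y) * heat h y) - layer_potential \<psi> s (?R k x)\<bar>)"
    by (rule sum_abs)
  also have "\<dots> \<le> of_nat (card {..<m}) * (C * 1024 / \<epsilon> ^ 7 * h\<^sup>2)"
  proof (intro sum_bounded_above layer_potential_defect h x(1))
    fix k assume "k \<in> {..<m}"
    then have "wedge_margin m x \<le> (if 2 * k < m then 1 else - 1) * snd (?R k x)"
      using x by (intro wedge_margin_image m) auto
    then show "\<epsilon> \<le> \<bar>snd (?R k x)\<bar>"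
      using x by (auto split: if_splits)
  qed
  finally show ?thesis by simp
qed

end

context continuous_data begin

lemma wedge_extension_tendsto:
  assumes "s \<longlonglongrightarrow> s'" and "x \<longlonglongrightarrow> x'"
  shows "(\<lambda>n. wedge_extension m \<psi> (s n) (x n)) \<longlonglongrightarrow> wedge_extension m \<psi> s' x'"
  unfolding wedge_extension_def
  by (intro tendsto_sum tendsto_mult tendsto_const layer_mean_tendsto assms tendsto_rotate)

text \<open>Reflection in the axis pairs the images of a boundary point; \<open>layer_mean\<close>
  is even while the two coefficients are opposite. An image at angle \<open>pi\<close> is its own
  partner and does not cancel, but its value is the datum at abscissa \<open>- r\<close>, which is
  0. On the first ray the image with \<open>k = 0\<close> remains, on the second ray none
  does.\<close>

lemma wedge_extension_ray:
  assumes m: "1 \<le> m" and vanish: "\<And>t r. r \<le> 0 \<Longrightarrow> \<psi> (t, r) = 0" and r: "0 \<le> r"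
  shows "wedge_extension m \<psi> s (polar r 0) = \<psi> (s, r)"
    and "wedge_extension m \<psi> s (polar r (pi / real m)) = 0"
proof -
  let ?c = "\<lambda>k. if 2 * k < m then 1 else - 1 :: real"
  have pi_term: "layer_mean \<psi> s (polar r pi) = 0"
    using vanish [of "- r"] r by (simp add: polar_def layer_mean_boundary)
  have refl_term: "layer_mean \<psi> s (polar r (2 * pi - \<theta>)) = layer_mean \<psi> s (polar r \<theta>)" for \<theta>
    by (simp add: polar_def cos_reflect_2pi sin_reflect_2pi layer_mean_def)
  have "wedge_extension m \<psi> s (polar r 0) = (\<Sum>k<m. ?c k * layer_mean \<psi> s (polar r (image_angle m k)))"
    by (simp add: wedge_extension_def rotate_polar)
  also have "\<dots> = ?c 0 * layer_mean \<psi> s (polar r (image_angle m 0))"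
  proof (rule sum_reflect_zero [OF _ m])
    fix k assume k: "0 < k" "k < m"
    show "?c (m - k) * layer_mean \<psi> s (polar r (image_angle m (m - k))) =
        - (?c k * layer_mean \<psi> s (polar r (image_angle m k)))"
    proof (cases "2 * k = m")
      case True
      then have "image_angle m k = pi" "m - k = k"
        using k by (auto simp: image_angle_def)
      then show ?thesis by (simp add: pi_term)
    next
      case False
      then have "?c (m - k) = - ?c k"
        using k by auto
      then show ?thesis
        using k by (simp add: image_angle_reflect refl_term)
    qed
  qed
  also have "\<dots> = \<psi> (s, r)"
    using m by (simp add: image_angle_def polar_def layer_mean_boundary)
  finally show "wedge_extension m \<psi> s (polar r 0) = \<psi> (s, r)" .
  have "wedge_extension m \<psi> s (polar r (pi / real m)) =
      (\<Sum>k<m. ?c k * layer_mean \<psi> s (polar r (pi / real m + image_angle m k)))"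
    by (simp add: wedge_extension_def rotate_polar)
  also have "\<dots> = 0"
  proof (rule sum_reflect_zero')
    fix k assume k: "k < m"
    show "?c (m - Suc k) * layer_mean \<psi> s (polar r (pi / real m + image_angle m (m - Suc k))) =
        - (?c k * layer_mean \<psi> s (polar r (pi / real m + image_angle m k)))"
    proof (cases "2 * k + 1 = m")
      case True
      then have "real m = 2 * real k + 1" by linarith
      then have "pi + 2 * real k * pi = real m * pi"
        by (simp add: algebra_simps)
      then have "pi / real m + image_angle m k = pi"
        using k by (simp add: image_angle_def add_divide_distrib [symmetric])
      moreover have "m - Suc k = k" using True by linarith
      ultimately show ?thesis by (simp add: pi_term)
    next
      case False
      then have "?c (m - Suc k) = - ?c k"
        using k by auto
      then show ?thesis
        by (simp only: image_angle_reflect' [OF k] refl_term)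
    qed
  qed
  finally show "wedge_extension m \<psi> s (polar r (pi / real m)) = 0" .
qed

end

subsection \<open>Optional stopping along dyadic grids\<close>

text \<open>Fubini for the product of the two laws, as a replacement for conditioning on
  \<open>X\<close>.\<close>

lemma (in prob_space) expectation_indep_var:
  fixes H :: "'b \<times> 'b \<Rightarrow> real"
  assumes ind: "indep_var S X T Y" and H [measurable]: "H \<in> borel_measurable (S \<Otimes>\<^sub>M T)"
    and bound: "\<And>z. \<bar>H z\<bar> \<le> B"
  shows "expectation (\<lambda>\<omega>. H (X \<omega>, Y \<omega>)) = expectation (\<lambda>\<omega>. LINT y|distr M T Y. H (X \<omega>, y))"
proof -
  have [measurable]: "X \<in> M \<rightarrow>\<^sub>M S" "Y \<in> M \<rightarrow>\<^sub>M T"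
    using ind by (auto dest: indep_var_rv1 indep_var_rv2)
  interpret X: prob_space "distr M S X" by (rule prob_space_distr) simp
  interpret Y: prob_space "distr M T Y" by (rule prob_space_distr) simp
  interpret XY: pair_prob_space "distr M S X" "distr M T Y" ..
  have eq: "distr M S X \<Otimes>\<^sub>M distr M T Y = distr M (S \<Otimes>\<^sub>M T) (\<lambda>\<omega>. (X \<omega>, Y \<omega>))"
    using ind by (simp add: indep_var_distribution_eq)
  have I: "integrable (distr M S X \<Otimes>\<^sub>M distr M T Y) H"
    using bound by (intro XY.P.integrable_const_bound [of _ B]) (auto simp: cong: measurable_cong_sets)
  have "expectation (\<lambda>\<omega>. H (X \<omega>, Y \<omega>)) = (LINT z|(distr M S X \<Otimes>\<^sub>M distr M T Y). H z)"
    unfolding eq by (subst integral_distr) simp_all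
  also have "\<dots> = (LINT x|distr M S X. LINT y|distr M T Y. H (x, y))"
    using XY.integral_fst' [OF I] by simp
  also have "\<dots> = expectation (\<lambda>\<omega>. LINT y|distr M T Y. H (X \<omega>, y))"
    by (subst integral_distr) simp_all
  finally show ?thesis .
qed

locale planar_brownian_motion = brownian_motion M W x\<^sub>0
  for M :: "'a measure" and W :: "real \<Rightarrow> 'a \<Rightarrow> real \<times> real" and x\<^sub>0
begin

lemma increment_distributed:
  assumes "0 \<le> s" "s < t"
  shows "distributed M lborel (\<lambda>\<omega>. W t \<omega> - W s \<omega>) (\<lambda>y. ennreal (heat (t - s) y))"
  using gaussian_increments [OF assms] by (simp add: prod_Basis_heat)

lemma increment_distr:
  assumes "0 \<le> s" "s < t"
  shows "distr M borel (\<lambda>\<omega>. W t \<omega> - W s \<omega>) = density lborel (\<lambda>y. ennreal (heat (t - s) y))"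
  using distributed_distr_eq_density [OF increment_distributed [OF assms]]
  by (simp cong: distr_cong)

text \<open>This is the Markov property at a grid time: the positions up to index \<open>i\<close>
  are almost surely functions of the start and the increments before \<open>i\<close>, and the next
  increment is independent of these, with Gaussian law.\<close>

lemma expectation_increment_step:
  fixes t :: "nat \<Rightarrow> real" and v :: "real \<times> real \<Rightarrow> real"
  assumes t0: "t 0 = 0" and t: "\<And>i. i < N \<Longrightarrow> t i < t (Suc i)" and i: "i < N"
    and G [measurable]: "G \<in> sets borel" and v [measurable]: "v \<in> borel_measurable borel"
    and v_bound: "\<And>x. \<bar>v x\<bar> \<le> B"
  shows "expectation (\<lambda>\<omega>. of_bool (\<forall>j\<le>i. W (t j) \<omega> \<in> G) * v (W (t (Suc i)) \<omega>)) =
    expectation (\<lambda>\<omega>. of_bool (\<forall>j\<le>i. W (t j) \<omega> \<in> G) *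
      (LINT y|lborel. v (W (t i) \<omega> + y) * heat (t (Suc i) - t i) y))"
proof -
  define \<xi> where "\<xi> i \<omega> = W (t (Suc i)) \<omega> - W (t i) \<omega>" for i \<omega>
  \<comment> \<open>Positions rebuilt from the increments with the constant \<open>x\<^sub>0\<close>
    as start. They agree with \<open>W\<close> only almost surely, because the start is prescribed
    only almost surely.\<close>
  define pos where "pos j \<zeta> = x\<^sub>0 + (\<Sum>l<j. \<zeta> l)" for j :: nat and \<zeta> :: "nat \<Rightarrow> real \<times> real"
  define S where "S = Pi\<^sub>M {..<i} (\<lambda>_. borel :: (real \<times> real) measure)"
  define P where "P \<omega> = restrict (\<lambda>l. \<xi> l \<omega>) {..<i}" for \<omega>
  define Q where "Q \<omega> = restrict (\<lambda>l. \<xi> l \<omega>) {i}" for \<omega>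
  define S' where "S' = Pi\<^sub>M {i} (\<lambda>_. borel :: (real \<times> real) measure)"
  define H where "H z = of_bool (\<forall>j\<le>i. pos j (fst z) \<in> G) * v (pos i (fst z) + snd z i)"
    for z :: "(nat \<Rightarrow> real \<times> real) \<times> (nat \<Rightarrow> real \<times> real)"
  have t_pos: "0 \<le> t j" if "j \<le> N" for j
    using that
  proof (induction j)
    case (Suc j)
    then show ?case
      using t [of j] by simp
  qed (simp add: t0)
  have ind: "indep_vars (\<lambda>_. borel) \<xi> {..<N}"
    unfolding \<xi>_def by (rule independent_increments) (use t t0 in auto)
  have pair: "indep_var S P S' Q"
    unfolding S_def S'_def P_def Q_def by (rule indep_var_restrict [OF ind]) (use i in auto)
  have pos_m': "pos j \<in> S \<rightarrow>\<^sub>M borel" if "j \<le> i" for j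
  proof -
    have "(\<lambda>\<zeta>. \<zeta> l) \<in> S \<rightarrow>\<^sub>M borel" if "l < j" for l
      unfolding S_def by (rule measurable_component_singleton) (use that \<open>j \<le> i\<close> in auto)
    then show ?thesis
      unfolding pos_def by (intro borel_measurable_add borel_measurable_sum) auto
  qed
  have pos_m: "(\<lambda>z. pos j (fst z)) \<in> S \<Otimes>\<^sub>M S' \<rightarrow>\<^sub>M borel" if "j \<le> i" for j
    by (rule measurable_compose [OF measurable_fst pos_m' [OF that]])
  have H_m: "H \<in> borel_measurable (S \<Otimes>\<^sub>M S')"
  proof -
    have "Measurable.pred (S \<Otimes>\<^sub>M S') (\<lambda>z. pos j (fst z) \<in> G)" if "j \<le> i" for j
      using pos_m [OF that] by (intro pred_sets2 [OF G])
    then have [measurable]: "Measurable.pred (S \<Otimes>\<^sub>M S') (\<lambda>z. \<forall>j\<in>{..i}. pos j (fst z) \<in> G)"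
      by (intro pred_intros_finite) auto
    have [measurable]: "(\<lambda>z. pos i (fst z)) \<in> S \<Otimes>\<^sub>M S' \<rightarrow>\<^sub>M borel"
      by (rule pos_m) simp
    have [measurable]: "(\<lambda>\<zeta>. \<zeta> i) \<in> S' \<rightarrow>\<^sub>M borel"
      unfolding S'_def by (rule measurable_component_singleton) simp
    have "H = (\<lambda>z. (if \<forall>j\<in>{..i}. pos j (fst z) \<in> G then 1 else 0) * v (pos i (fst z) + snd z i))"
      by (auto simp: H_def fun_eq_iff)
    then show ?thesis by simp
  qed
  have H_b: "\<bar>H z\<bar> \<le> B" for z
    using v_bound order.trans [OF abs_ge_zero v_bound [of 0]] by (auto simp: H_def abs_mult)
  have W_pos: "AE \<omega> in M. \<forall>j\<le>i. W (t j) \<omega> = pos j (P \<omega>)"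
    using start
  proof eventually_elim
    case (elim \<omega>)
    show ?case
    proof (intro allI impI)
      fix j assume "j \<le> i"
      then have "(\<Sum>l<j. P \<omega> l) = (\<Sum>l<j. W (t (Suc l)) \<omega> - W (t l) \<omega>)"
        by (intro sum.cong) (auto simp: P_def \<xi>_def)
      also have "\<dots> = W (t j) \<omega> - W (t 0) \<omega>"
        by (rule sum_lessThan_telescope)
      finally show "W (t j) \<omega> = pos j (P \<omega>)"
        using elim by (simp add: pos_def t0)
    qed
  qed
  have [measurable]: "P \<in> M \<rightarrow>\<^sub>M S" "Q \<in> M \<rightarrow>\<^sub>M S'"
    using pair by (auto dest: indep_var_rv1 indep_var_rv2)
  have [measurable]: "\<xi> i \<in> M \<rightarrow>\<^sub>M borel"
    using ind i by (auto simp: indep_vars_def)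
  have Q_i: "Q \<omega> i = \<xi> i \<omega>" for \<omega>
    by (simp add: Q_def)
  note H_m [measurable]
  have Wm: "W (t j) \<in> M \<rightarrow>\<^sub>M borel" if "j \<le> N" for j
    by (rule random_variable_W) (rule t_pos [OF that])
  have pred [measurable]: "Measurable.pred M (\<lambda>\<omega>. \<forall>j\<in>{..i}. W (t j) \<omega> \<in> G)"
    using Wm i by (intro pred_intros_finite pred_sets2 [OF G]) auto
  have ii: "i \<le> N" "Suc i \<le> N" using i by auto
  note [measurable] = Wm [OF ii(1)] Wm [OF ii(2)]
  have distr_\<xi>: "distr M borel (\<xi> i) = density lborel (\<lambda>y. ennreal (heat (t (Suc i) - t i) y))"
    unfolding \<xi>_def by (rule increment_distr) (use t_pos [of i] t [OF i] i in auto)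
  have "expectation (\<lambda>\<omega>. of_bool (\<forall>j\<le>i. W (t j) \<omega> \<in> G) * v (W (t (Suc i)) \<omega>)) =
      expectation (\<lambda>\<omega>. (if \<forall>j\<in>{..i}. W (t j) \<omega> \<in> G then 1 else 0) * v (W (t (Suc i)) \<omega>))"
    by (intro Bochner_Integration.integral_cong) auto
  also have "\<dots> = expectation (\<lambda>\<omega>. H (P \<omega>, Q \<omega>))"
  proof (rule integral_cong_AE)
    show "AE \<omega> in M. (if \<forall>j\<in>{..i}. W (t j) \<omega> \<in> G then 1 else 0) * v (W (t (Suc i)) \<omega>) = H (P \<omega>, Q \<omega>)"
      using W_pos
    proof eventually_elim
      case (elim \<omega>)
      then have "W (t (Suc i)) \<omega> = pos i (P \<omega>) + \<xi> i \<omega>"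
        using elim by (auto simp: \<xi>_def algebra_simps)
      with elim show ?case
        by (auto simp: H_def Q_i)
    qed
  qed measurable
  also have "\<dots> = expectation (\<lambda>\<omega>. LINT y|distr M S' Q. H (P \<omega>, y))"
    by (rule expectation_indep_var [OF pair H_m H_b])
  also have "\<dots> = expectation (\<lambda>\<omega>. of_bool (\<forall>j\<le>i. pos j (P \<omega>) \<in> G) *
      (LINT y|lborel. v (pos i (P \<omega>) + y) * heat (t (Suc i) - t i) y))"
  proof (intro Bochner_Integration.integral_cong refl)
    fix \<omega> assume "\<omega> \<in> space M"
    then have P_space: "P \<omega> \<in> space S"
      by (rule measurable_space [of P, rotated]) measurable
    have "(LINT y|distr M S' Q. H (P \<omega>, y)) = expectation (\<lambda>\<omega>'. H (P \<omega>, Q \<omega>'))"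
      using P_space by (subst integral_distr) simp_all
    also have "\<dots> = expectation (\<lambda>\<omega>'. of_bool (\<forall>j\<le>i. pos j (P \<omega>) \<in> G) * v (pos i (P \<omega>) + \<xi> i \<omega>'))"
      by (simp add: H_def Q_i)
    also have "\<dots> = of_bool (\<forall>j\<le>i. pos j (P \<omega>) \<in> G) * (LINT y|distr M borel (\<xi> i). v (pos i (P \<omega>) + y))"
      by (subst integral_distr) simp_all
    also have "(LINT y|distr M borel (\<xi> i). v (pos i (P \<omega>) + y)) =
        (LINT y|lborel. v (pos i (P \<omega>) + y) * heat (t (Suc i) - t i) y)"
      unfolding distr_\<xi> by (subst integral_density) (simp_all add: mult.commute)
    finally show "(LINT y|distr M S' Q. H (P \<omega>, y)) = of_bool (\<forall>j\<le>i. pos j (P \<omega>) \<in> G) *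
        (LINT y|lborel. v (pos i (P \<omega>) + y) * heat (t (Suc i) - t i) y)" .
  qed
  also have "\<dots> = expectation (\<lambda>\<omega>. (if \<forall>j\<in>{..i}. W (t j) \<omega> \<in> G then 1 else 0) *
      (LINT y|lborel. v (W (t i) \<omega> + y) * heat (t (Suc i) - t i) y))"
  proof (rule integral_cong_AE)
    show "AE \<omega> in M. of_bool (\<forall>j\<le>i. pos j (P \<omega>) \<in> G) *
          (LINT y|lborel. v (pos i (P \<omega>) + y) * heat (t (Suc i) - t i) y) =
        (if \<forall>j\<in>{..i}. W (t j) \<omega> \<in> G then 1 else 0) *
        (LINT y|lborel. v (W (t i) \<omega> + y) * heat (t (Suc i) - t i) y)"
      using W_pos by eventually_elim auto
    have "Measurable.pred S (\<lambda>\<zeta>. pos j \<zeta> \<in> G)" if "j \<le> i" for j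
      using pos_m' [OF that] by (intro pred_sets2 [OF G])
    then have [measurable]: "Measurable.pred S (\<lambda>\<zeta>. \<forall>j\<in>{..i}. pos j \<zeta> \<in> G)"
      by (intro pred_intros_finite) auto
    have [measurable]: "pos i \<in> S \<rightarrow>\<^sub>M borel"
      by (rule pos_m') simp
    have "(\<lambda>\<omega>. (if \<forall>j\<in>{..i}. pos j (P \<omega>) \<in> G then 1 else 0) *
        (LINT y|lborel. v (pos i (P \<omega>) + y) * heat (t (Suc i) - t i) y)) \<in> borel_measurable M"
      by measurable
    then show "(\<lambda>\<omega>. of_bool (\<forall>j\<le>i. pos j (P \<omega>) \<in> G) *
        (LINT y|lborel. v (pos i (P \<omega>) + y) * heat (t (Suc i) - t i) y)) \<in> borel_measurable M"
      by (rule measurable_cong [THEN iffD1, rotated]) auto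
  qed measurable
  also have "\<dots> = expectation (\<lambda>\<omega>. of_bool (\<forall>j\<le>i. W (t j) \<omega> \<in> G) *
      (LINT y|lborel. v (W (t i) \<omega> + y) * heat (t (Suc i) - t i) y))"
    by (intro Bochner_Integration.integral_cong) auto
  finally show ?thesis .
qed

end

text \<open>The index \<open>2 ^ n\<close>, which belongs to the time \<open>T\<close>, is a forced
  stop and guarantees that the least index exists. The mesh is dyadic so that the grids are nested
  as \<open>n\<close> grows.\<close>

definition exit_index :: "(real \<Rightarrow> real) \<Rightarrow> real \<Rightarrow> real \<Rightarrow> nat \<Rightarrow> nat" where
  "exit_index d T \<epsilon> n = (LEAST i. i = 2 ^ n \<or> d (T * real i / 2 ^ n) < \<epsilon>)"

definition exit_time :: "(real \<Rightarrow> real) \<Rightarrow> real \<Rightarrow> real \<Rightarrow> nat \<Rightarrow> real" where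
  "exit_time d T \<epsilon> n = T * real (exit_index d T \<epsilon> n) / 2 ^ n"

lemma exit_index_cases: "exit_index d T \<epsilon> n = 2 ^ n \<or> d (exit_time d T \<epsilon> n) < \<epsilon>"
  unfolding exit_time_def exit_index_def
  by (rule LeastI [of "\<lambda>i. i = 2 ^ n \<or> d (T * real i / 2 ^ n) < \<epsilon>" "2 ^ n"]) simp

lemma exit_index_le: "exit_index d T \<epsilon> n \<le> 2 ^ n"
  unfolding exit_index_def by (rule Least_le) simp

text \<open>Not having stopped up to index \<open>i\<close> depends only on the positions up to
  \<open>i\<close>, which is the kind of event that \<open>expectation_increment_step\<close>
  admits.\<close>

lemma less_exit_index_iff:
  "i < exit_index d T \<epsilon> n \<longleftrightarrow> i < 2 ^ n \<and> (\<forall>j\<le>i. \<epsilon> \<le> d (T * real j / 2 ^ n))"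
proof
  assume i: "i < exit_index d T \<epsilon> n"
  have "\<not> (j = 2 ^ n \<or> d (T * real j / 2 ^ n) < \<epsilon>)" if "j \<le> i" for j
    using not_less_Least [of j "\<lambda>i. i = 2 ^ n \<or> d (T * real i / 2 ^ n) < \<epsilon>"] i that
    unfolding exit_index_def by simp
  then show "i < 2 ^ n \<and> (\<forall>j\<le>i. \<epsilon> \<le> d (T * real j / 2 ^ n))"
    using i exit_index_le [of d T \<epsilon> n] by (auto simp: not_less)
next
  assume i: "i < 2 ^ n \<and> (\<forall>j\<le>i. \<epsilon> \<le> d (T * real j / 2 ^ n))"
  show "i < exit_index d T \<epsilon> n"
  proof (rule ccontr)
    assume "\<not> i < exit_index d T \<epsilon> n"
    with i exit_index_cases [of d T \<epsilon> n] show False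
      by (auto simp: exit_time_def not_less)
  qed
qed

lemma exit_time_bounds:
  assumes "0 \<le> T"
  shows "0 \<le> exit_time d T \<epsilon> n" "exit_time d T \<epsilon> n \<le> T"
proof -
  have "T * real (exit_index d T \<epsilon> n) \<le> T * 2 ^ n"
    using assms of_nat_mono [OF exit_index_le [of d T \<epsilon> n], where 'a = real]
    by (intro mult_left_mono) simp_all
  then show "exit_time d T \<epsilon> n \<le> T"
    by (simp add: exit_time_def field_simps)
qed (use assms in \<open>simp add: exit_time_def\<close>)

text \<open>Index \<open>i\<close> of one grid is index \<open>2 * i\<close> of the next, so a grid
  time that stops the path is still available after refinement.\<close>

lemma exit_time_decseq:
  assumes "0 < T"
  shows "decseq (exit_time d T \<epsilon>)"
proof (rule decseq_SucI)
  fix n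
  let ?i = "exit_index d T \<epsilon> n"
  have e: "T * real (2 * ?i) / 2 ^ Suc n = exit_time d T \<epsilon> n"
    by (simp add: exit_time_def)
  have "exit_index d T \<epsilon> (Suc n) \<le> 2 * ?i"
    unfolding exit_index_def [of d T \<epsilon> "Suc n"]
    by (rule Least_le) (use e exit_index_cases [of d T \<epsilon> n] in auto)
  then have "T * real (exit_index d T \<epsilon> (Suc n)) / 2 ^ Suc n \<le> T * real (2 * ?i) / 2 ^ Suc n"
    using assms by (intro divide_right_mono mult_left_mono) (simp_all only: of_nat_le_iff, simp_all)
  then show "exit_time d T \<epsilon> (Suc n) \<le> exit_time d T \<epsilon> n"
    unfolding e by (simp add: exit_time_def)
qed

lemma exit_time_antimono:
  assumes "0 < T" "\<epsilon>' \<le> \<epsilon>"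
  shows "exit_time d T \<epsilon> n \<le> exit_time d T \<epsilon>' n"
proof -
  have "exit_index d T \<epsilon> n \<le> exit_index d T \<epsilon>' n"
    unfolding exit_index_def [of d T \<epsilon>]
    by (rule Least_le) (use exit_index_cases [of d T \<epsilon>' n] assms in \<open>auto simp: exit_time_def\<close>)
  then show ?thesis
    using assms unfolding exit_time_def by (intro divide_right_mono mult_left_mono) simp_all
qed

text \<open>No grid stops before the limit, and the grid points are dense, so continuity gives
  \<open>\<epsilon> \<le> d t\<close> up to the limit. If the limit is less than \<open>T\<close>,
  the stops are eventually not forced and hence occur where \<open>d < \<epsilon>\<close>.\<close>

lemma exit_time_limit:
  assumes T: "0 < T" and d: "continuous_on {0..T} d" and \<epsilon>: "\<epsilon> \<le> d 0"
  obtains \<sigma> where "exit_time d T \<epsilon> \<longlonglongrightarrow> \<sigma>" "0 \<le> \<sigma>" "\<sigma> \<le> T" "\<And>t. 0 \<le> t \<Longrightarrow> t \<le> \<sigma> \<Longrightarrow> \<epsilon> \<le> d t"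
    "\<sigma> < T \<Longrightarrow> d \<sigma> \<le> \<epsilon>"
proof -
  note bounds = exit_time_bounds [OF less_imp_le [OF T], of d \<epsilon>]
  obtain \<sigma> where lim: "exit_time d T \<epsilon> \<longlonglongrightarrow> \<sigma>" and le: "\<And>n. \<sigma> \<le> exit_time d T \<epsilon> n"
    using decseq_convergent [OF exit_time_decseq [OF T], of 0 d \<epsilon>] bounds by auto
  have \<sigma>: "0 \<le> \<sigma>" "\<sigma> \<le> T"
    using le [of 0] bounds(2) [of 0] LIMSEQ_le_const [OF lim, of 0] bounds(1) by auto
  have cont: "(\<lambda>n. d (u n)) \<longlonglongrightarrow> d l" if "u \<longlonglongrightarrow> l" "\<And>n. 0 \<le> u n" "\<And>n. u n \<le> T" "0 \<le> l" "l \<le> T" for u l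
    using d that by (auto simp: continuous_on_sequentially o_def)
  have ge: "\<epsilon> \<le> d t" if t: "0 \<le> t" "t \<le> \<sigma>" for t
  proof (cases "t = 0")
    case False
    then have t0: "0 < t" using t by simp
    \<comment> \<open>The last index whose grid time is strictly before \<open>t\<close>, hence the
      ceiling minus 1. Strictness places it before the stop even for
      \<open>t = \<sigma>\<close>.\<close>
    define j where "j n = nat (\<lceil>t * 2 ^ n / T\<rceil> - 1)" for n
    define u where "u n = T * real (j n) / 2 ^ n" for n
    have pos: "0 < t * 2 ^ n / T" for n
      using t0 T by simp
    have rj: "real (j n) = real_of_int \<lceil>t * 2 ^ n / T\<rceil> - 1" for n
      using pos [of n] by (simp add: j_def)
    have jl: "real (j n) < t * 2 ^ n / T" "t * 2 ^ n / T - 1 \<le> real (j n)" for n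
      unfolding rj by linarith+
    have ul: "u n < t" "t - T / 2 ^ n \<le> u n" for n
    proof -
      show "u n < t"
        using jl(1) [of n] T by (simp add: u_def field_simps)
      have "t * 2 ^ n - T \<le> T * real (j n)"
        using jl(2) [of n] T by (simp add: field_simps)
      then have "(t * 2 ^ n - T) / 2 ^ n \<le> T * real (j n) / 2 ^ n"
        by (rule divide_right_mono) simp
      then show "t - T / 2 ^ n \<le> u n"
        by (simp add: u_def diff_divide_distrib)
    qed
    have u0: "0 \<le> u n" for n using T by (simp add: u_def)
    have "(\<lambda>n. t - T / 2 ^ n) \<longlonglongrightarrow> t - 0"
      by (intro tendsto_intros LIMSEQ_divide_realpow_zero) simp
    then have "u \<longlonglongrightarrow> t"
      by (intro tendsto_sandwich [of "\<lambda>n. t - T / 2 ^ n" u _ "\<lambda>_. t"]) (use ul in \<open>auto intro: always_eventually less_imp_le\<close>)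
    then have "(\<lambda>n. d (u n)) \<longlonglongrightarrow> d t"
    proof (rule cont)
      show "u n \<le> T" for n
        using ul(1) [of n] t \<sigma> by linarith
    qed (use u0 t \<sigma> in auto)
    moreover have "\<epsilon> \<le> d (u n)" for n
    proof -
      have "u n < exit_time d T \<epsilon> n"
        using ul(1) [of n] t le [of n] by linarith
      then have "j n < exit_index d T \<epsilon> n"
        using T by (simp add: u_def exit_time_def field_simps)
      then show ?thesis
        by (auto simp: less_exit_index_iff u_def)
    qed
    ultimately show ?thesis
      by (intro LIMSEQ_le_const) auto
  qed (use \<epsilon> in simp)
  have d_le: "d \<sigma> \<le> \<epsilon>" if "\<sigma> < T"
  proof -
    have "eventually (\<lambda>n. exit_time d T \<epsilon> n < T) sequentially"
      using order_tendstoD(2) [OF lim that] .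
    then have "eventually (\<lambda>n. d (exit_time d T \<epsilon> n) \<le> \<epsilon>) sequentially"
    proof eventually_elim
      case (elim n)
      then have "exit_index d T \<epsilon> n \<noteq> 2 ^ n"
        by (auto simp: exit_time_def)
      with exit_index_cases [of d T \<epsilon> n] show ?case by simp
    qed
    with cont [OF lim bounds \<sigma>] show ?thesis
      by (rule tendsto_upperbound) simp
  qed
  show thesis
    by (rule that [OF lim \<sigma> ge d_le])
qed

text \<open>Each \<open>\<sigma> j\<close> belongs to a positive level, so \<open>d\<close> is still
  positive there; as the level decreases to 0 these times increase to the first zero of
  \<open>d\<close>, or to \<open>T\<close> if there is none before. The levels start at
  \<open>d 0\<close>, so the path starts at or above each of them.\<close>

lemma exit_time_double_limit:
  assumes T: "0 < T" and d: "continuous_on {0..T} d" and pos: "0 < d 0"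
  obtains \<sigma> \<rho> where "\<And>j. exit_time d T (d 0 / real (Suc j)) \<longlonglongrightarrow> \<sigma> j" "\<And>j. 0 \<le> \<sigma> j \<and> \<sigma> j \<le> T"
    "\<And>j. 0 < d (\<sigma> j)" "\<sigma> \<longlonglongrightarrow> \<rho>" "0 \<le> \<rho>" "\<rho> \<le> T" "\<And>t. 0 \<le> t \<Longrightarrow> t < \<rho> \<Longrightarrow> 0 < d t"
    "\<rho> < T \<Longrightarrow> d \<rho> = 0"
proof -
  let ?\<epsilon> = "\<lambda>j. d 0 / real (Suc j)"
  have \<epsilon>: "0 < ?\<epsilon> j" "?\<epsilon> j \<le> d 0" for j
    using pos by (simp_all add: field_simps)
  have "\<exists>\<sigma>. exit_time d T (?\<epsilon> j) \<longlonglongrightarrow> \<sigma> \<and> 0 \<le> \<sigma> \<and> \<sigma> \<le> T \<and> (\<forall>t. 0 \<le> t \<and> t \<le> \<sigma> \<longrightarrow> ?\<epsilon> j \<le> d t) \<and> (\<sigma> < T \<longrightarrow> d \<sigma> \<le> ?\<epsilon> j)" for j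
    using exit_time_limit [OF T d \<epsilon>(2) [of j]] by metis
  then obtain \<sigma> where \<sigma>: "\<And>j. exit_time d T (?\<epsilon> j) \<longlonglongrightarrow> \<sigma> j" "\<And>j. 0 \<le> \<sigma> j" "\<And>j. \<sigma> j \<le> T"
    "\<And>j t. 0 \<le> t \<Longrightarrow> t \<le> \<sigma> j \<Longrightarrow> ?\<epsilon> j \<le> d t" "\<And>j. \<sigma> j < T \<Longrightarrow> d (\<sigma> j) \<le> ?\<epsilon> j"
    by metis
  have "incseq \<sigma>"
  proof (rule incseq_SucI)
    fix j
    have "exit_time d T (?\<epsilon> j) n \<le> exit_time d T (?\<epsilon> (Suc j)) n" for n
      using pos by (intro exit_time_antimono T) (simp add: field_simps)
    then show "\<sigma> j \<le> \<sigma> (Suc j)"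
      by (intro LIMSEQ_le [OF \<sigma>(1) \<sigma>(1)]) auto
  qed
  then obtain \<rho> where \<rho>: "\<sigma> \<longlonglongrightarrow> \<rho>" "\<And>j. \<sigma> j \<le> \<rho>"
    using incseq_convergent [of \<sigma> T] \<sigma>(3) by auto
  have \<rho>_b: "0 \<le> \<rho>" "\<rho> \<le> T"
    using \<sigma>(2) [of 0] \<rho>(2) [of 0] LIMSEQ_le_const2 [OF \<rho>(1), of T] \<sigma>(3) by auto
  have d_pos: "0 < d (\<sigma> j)" for j
    using \<sigma>(4) [of "\<sigma> j" j] \<sigma>(2) [of j] \<epsilon>(1) [of j] by simp
  have before: "0 < d t" if "0 \<le> t" "t < \<rho>" for t
  proof -
    from order_tendstoD(1) [OF \<rho>(1) that(2)] obtain j where "t < \<sigma> j"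
      by (auto dest: eventually_happens)
    then show ?thesis
      using \<sigma>(4) [of t j] that \<epsilon>(1) [of j] by simp
  qed
  have at: "d \<rho> = 0" if "\<rho> < T"
  proof -
    have lim: "(\<lambda>j. d (\<sigma> j)) \<longlonglongrightarrow> d \<rho>"
      using d \<rho>(1) \<sigma>(2,3) \<rho>_b by (auto simp: continuous_on_sequentially o_def)
    have "\<sigma> j < T" for j
      using \<rho>(2) [of j] that by simp
    then have "d (\<sigma> j) \<le> ?\<epsilon> j" for j
      using \<sigma>(5) by blast
    moreover have "?\<epsilon> \<longlonglongrightarrow> 0"
      using LIMSEQ_inverse_real_of_nat tendsto_mult_right_zero [of "\<lambda>j. inverse (real (Suc j))" sequentially "d 0"]
      by (simp add: divide_inverse)
    ultimately have "d \<rho> \<le> 0"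
      by (intro LIMSEQ_le [OF lim]) auto
    moreover have "0 \<le> d \<rho>"
      using d_pos by (intro LIMSEQ_le_const [OF lim]) (auto intro: less_imp_le)
    ultimately show ?thesis by simp
  qed
  show thesis
  proof (rule that [of \<sigma> \<rho>])
    show "exit_time d T (?\<epsilon> j) \<longlonglongrightarrow> \<sigma> j" for j by (rule \<sigma>(1))
    show "0 \<le> \<sigma> j \<and> \<sigma> j \<le> T" for j using \<sigma>(2,3) by simp
    show "0 < d (\<sigma> j)" for j by (rule d_pos)
    show "\<sigma> \<longlonglongrightarrow> \<rho>" "0 \<le> \<rho>" "\<rho> \<le> T" by (rule \<rho>(1) \<rho>_b)+
    show "0 < d t" if "0 \<le> t" "t < \<rho>" for t using that by (rule before)
    show "d \<rho> = 0" if "\<rho> < T" using that by (rule at)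
  qed
qed

section \<open>Exit of a Brownian path from the wedge\<close>

lemma mem_wedge_boundary_iff:
  assumes "1 \<le> m"
  shows "x \<in> wedge_boundary 0 (pi / real m) \<longleftrightarrow> wedge_margin m x = 0"
proof
  assume "x \<in> wedge_boundary 0 (pi / real m)"
  then show "wedge_margin m x = 0"
    using wedge_margin_ray [OF assms] by (auto simp: wedge_boundary_def ray_def)
next
  assume "wedge_margin m x = 0"
  then show "x \<in> wedge_boundary 0 (pi / real m)"
    by (rule wedge_margin_zeroE [OF assms]) (auto simp: wedge_boundary_def ray_def)
qed

lemma hitting_time_eqI:
  assumes "0 < \<rho>" "X \<rho> \<omega> \<in> F" "\<And>t. 0 < t \<Longrightarrow> t < \<rho> \<Longrightarrow> X t \<omega> \<notin> F"
  shows "hitting_time X F \<omega> = ereal \<rho>"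
  unfolding hitting_time_def
proof (rule antisym)
  show "(INF t\<in>{t. 0 < t \<and> X t \<omega> \<in> F}. ereal t) \<le> ereal \<rho>"
    using assms(1,2) by (intro INF_lower) auto
  show "ereal \<rho> \<le> (INF t\<in>{t. 0 < t \<and> X t \<omega> \<in> F}. ereal t)"
    using assms(3) by (intro INF_greatest) (auto simp: not_less [symmetric])
qed

lemma hitting_time_geI:
  assumes "\<And>t. 0 < t \<Longrightarrow> t < T \<Longrightarrow> X t \<omega> \<notin> F"
  shows "ereal T \<le> hitting_time X F \<omega>"
  unfolding hitting_time_def using assms by (intro INF_greatest) (auto simp: not_less [symmetric])

text \<open>On the boundary, \<open>snd = 0\<close> singles out the ray at angle 0, except for
  \<open>m = 1\<close>, where the opposite ray lies on the same line; the data to which this is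
  applied vanish there.\<close>

definition exit_value ::
  "(real \<Rightarrow> 'a \<Rightarrow> real \<times> real) \<Rightarrow> ('a \<Rightarrow> ereal) \<Rightarrow> (real \<times> real \<Rightarrow> real) \<Rightarrow> 'a \<Rightarrow> real" where
  "exit_value X \<tau> \<psi> \<omega> =
    (if \<tau> \<omega> \<noteq> \<infinity> \<and> snd (X (real_of_ereal (\<tau> \<omega>)) \<omega>) = 0
     then \<psi> (real_of_ereal (\<tau> \<omega>), fst (X (real_of_ereal (\<tau> \<omega>)) \<omega>)) else 0)"

context planar_brownian_motion begin

definition exit_margin :: "nat \<Rightarrow> 'a \<Rightarrow> real \<Rightarrow> real" where
  "exit_margin m \<omega> t = wedge_margin m (W t \<omega>)"

text \<open>The stopped value telescopes into steps weighted by the indicator of not having stopped.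
  Where this indicator is 1 the margin is at least \<open>\<epsilon>\<close>, so each step costs at
  most the defect of the potential, and there are \<open>2 ^ n\<close> steps.\<close>

lemma stopped_wedge_potential:
  assumes \<psi>: "bounded_data \<psi> C" and m: "1 \<le> m" and T: "0 < T" "T / 2 ^ n \<le> 1" and \<epsilon>: "0 < \<epsilon>"
  defines "s \<equiv> \<lambda>\<omega>. exit_time (exit_margin m \<omega>) T \<epsilon> n"
  shows "(\<lambda>\<omega>. wedge_potential m \<psi> (s \<omega>) (W (s \<omega>) \<omega>)) \<in> borel_measurable M" (is ?A)
    and "\<bar>expectation (\<lambda>\<omega>. wedge_potential m \<psi> (s \<omega>) (W (s \<omega>) \<omega>)) - wedge_potential m \<psi> 0 x\<^sub>0\<bar>
      \<le> 2 ^ n * (real m * (C * 1024 / \<epsilon> ^ 7 * (T / 2 ^ n)\<^sup>2))" (is ?B)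
proof -
  interpret \<psi>: bounded_data \<psi> C by (rule \<psi>)
  define t where "t i = T * real i / 2 ^ n" for i
  define h where "h = T / 2 ^ n"
  define G where "G = {x. \<epsilon> \<le> wedge_margin m x}"
  define z where "z i \<omega> = wedge_potential m \<psi> (t i) (W (t i) \<omega>)" for i \<omega>
  define I where "I \<omega> = exit_index (exit_margin m \<omega>) T \<epsilon> n" for \<omega>
  define a where "a i \<omega> = (of_bool (\<forall>j\<le>i. W (t j) \<omega> \<in> G) :: real)" for i \<omega>
  define N :: nat where "N = 2 ^ n"
  have h: "0 < h" "h \<le> 1" using T by (simp_all add: h_def)
  have t0: "t 0 = 0" and t_pos: "0 \<le> t i" and t_step: "t (Suc i) - t i = h" "t (Suc i) = t i + h" for i
    using T by (simp_all add: t_def h_def field_simps)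
  have t_mono: "t i < t (Suc i)" for i
    using t_step(2) [of i] h by simp
  have G_m [measurable]: "G \<in> sets borel"
    unfolding G_def by measurable
  have W_m [measurable]: "W (t i) \<in> M \<rightarrow>\<^sub>M borel" for i
    by (rule random_variable_W) (rule t_pos)
  have z_m [measurable]: "z i \<in> borel_measurable M" for i
    unfolding z_def by measurable
  have a_m [measurable]: "a i \<in> borel_measurable M" for i
  proof -
    have [measurable]: "Measurable.pred M (\<lambda>\<omega>. \<forall>j\<in>{..i}. W (t j) \<omega> \<in> G)"
      by (intro pred_intros_finite pred_sets2 [OF G_m]) auto
    have "a i = (\<lambda>\<omega>. if \<forall>j\<in>{..i}. W (t j) \<omega> \<in> G then 1 else 0)"
      by (auto simp: a_def fun_eq_iff)
    then show ?thesis by simp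
  qed
  have a_b: "\<bar>a i \<omega>\<bar> \<le> 1" for i \<omega>
    by (simp add: a_def)
  have z_b: "\<bar>z i \<omega>\<bar> \<le> real m * C" for i \<omega>
    unfolding z_def by (rule \<psi>.wedge_potential_bound)
  have int: "integrable M (\<lambda>\<omega>. a i \<omega> * z j \<omega>)" for i j
  proof (rule integrable_const_bound [of _ "1 * (real m * C)"])
    show "AE \<omega> in M. norm (a i \<omega> * z j \<omega>) \<le> 1 * (real m * C)"
      unfolding real_norm_def abs_mult
      by (intro AE_I2 mult_mono a_b z_b) simp_all
  qed measurable
  have z_int: "integrable M (z j)" for j
    by (rule integrable_const_bound [of _ "real m * C"]) (use z_b in simp_all)
  have a_I: "a i \<omega> = of_bool (i < I \<omega>)" if "i < N" for i \<omega>
    using that by (simp add: a_def I_def less_exit_index_iff N_def G_def exit_margin_def t_def)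
  have I_le: "I \<omega> \<le> N" for \<omega>
    unfolding I_def N_def by (rule exit_index_le)
  \<comment> \<open>The representation as a finite sum also shows that the value at the random time
    is measurable.\<close>
  have path: "wedge_potential m \<psi> (s \<omega>) (W (s \<omega>) \<omega>) = z 0 \<omega> + (\<Sum>i<N. a i \<omega> * (z (Suc i) \<omega> - z i \<omega>))" for \<omega>
  proof -
    have "(\<Sum>i<N. a i \<omega> * (z (Suc i) \<omega> - z i \<omega>)) = (\<Sum>i<N. if i < I \<omega> then z (Suc i) \<omega> - z i \<omega> else 0)"
      by (intro sum.cong) (simp_all add: a_I)
    also have "\<dots> = (\<Sum>i<I \<omega>. z (Suc i) \<omega> - z i \<omega>)"
      using I_le [of \<omega>] by (subst sum.inter_filter [symmetric]) (auto intro!: sum.cong)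
    also have "\<dots> = z (I \<omega>) \<omega> - z 0 \<omega>"
      by (rule sum_lessThan_telescope)
    finally show ?thesis
      by (simp add: z_def s_def I_def exit_time_def t_def)
  qed
  show ?A
    unfolding path by measurable
  have z0: "expectation (z 0) = wedge_potential m \<psi> 0 x\<^sub>0"
  proof -
    have "expectation (z 0) = expectation (\<lambda>_. wedge_potential m \<psi> 0 x\<^sub>0)"
    proof (rule integral_cong_AE)
      show "AE \<omega> in M. z 0 \<omega> = wedge_potential m \<psi> 0 x\<^sub>0"
        using start by eventually_elim (simp add: z_def t0)
    qed simp_all
    then show ?thesis by (simp add: prob_space)
  qed
  have step: "\<bar>expectation (\<lambda>\<omega>. a i \<omega> * (z (Suc i) \<omega> - z i \<omega>))\<bar> \<le> real m * (C * 1024 / \<epsilon> ^ 7 * h\<^sup>2)"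
    if "i < N" for i
  proof -
    let ?P = "\<lambda>\<omega>. LINT y|lborel. wedge_potential m \<psi> (t i + h) (W (t i) \<omega> + y) * heat h y"
    have "expectation (\<lambda>\<omega>. a i \<omega> * z (Suc i) \<omega>) = expectation (\<lambda>\<omega>. a i \<omega> * ?P \<omega>)"
      unfolding a_def z_def
      by (subst expectation_increment_step [where t = t and N = N and B = "real m * C" and v = "wedge_potential m \<psi> (t (Suc i))"])
         (simp_all add: t0 t_mono that \<psi>.wedge_potential_bound t_step(1) flip: t_step(2))
    moreover have int': "integrable M (\<lambda>\<omega>. a i \<omega> * ?P \<omega>)"
    proof (rule integrable_const_bound [of _ "1 * (real m * C)"])
      have "\<bar>?P \<omega>\<bar> \<le> real m * C" for \<omega>
      proof -
        have "\<bar>?P \<omega>\<bar> \<le> (LINT y|lborel. \<bar>wedge_potential m \<psi> (t i + h) (W (t i) \<omega> + y) * heat h y\<bar>)"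
          by (rule integral_abs_bound)
        also have "\<dots> \<le> (LINT y|lborel. real m * C * heat h y)"
        proof (rule integral_mono)
          show "integrable lborel (\<lambda>y. real m * C * heat h y)"
            using h by (simp add: integrable_heat)
          then show "integrable lborel (\<lambda>y. \<bar>wedge_potential m \<psi> (t i + h) (W (t i) \<omega> + y) * heat h y\<bar>)"
          proof (rule Bochner_Integration.integrable_bound)
            have "\<bar>wedge_potential m \<psi> (t i + h) (W (t i) \<omega> + y)\<bar> \<le> \<bar>real m * C\<bar>" for y
              using \<psi>.wedge_potential_bound [of m "t i + h" "W (t i) \<omega> + y"] by linarith
            from mult_right_mono [OF this heat_nonneg]
            show "AE y in lborel. norm \<bar>wedge_potential m \<psi> (t i + h) (W (t i) \<omega> + y) * heat h y\<bar>
                \<le> norm (real m * C * heat h y)"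
              by (intro AE_I2) (simp add: abs_mult)
          qed measurable
        qed (auto simp: abs_mult intro!: mult_right_mono \<psi>.wedge_potential_bound)
        finally show ?thesis
          using h by (simp add: integral_heat)
      qed
      then show "AE \<omega> in M. norm (a i \<omega> * ?P \<omega>) \<le> 1 * (real m * C)"
        unfolding real_norm_def abs_mult
        by (intro AE_I2 mult_mono a_b) simp_all
    qed measurable
    ultimately have "expectation (\<lambda>\<omega>. a i \<omega> * (z (Suc i) \<omega> - z i \<omega>)) = expectation (\<lambda>\<omega>. a i \<omega> * (?P \<omega> - z i \<omega>))"
      using int [of i] by (simp add: right_diff_distrib)
    also have "\<bar>\<dots>\<bar> \<le> expectation (\<lambda>\<omega>. \<bar>a i \<omega> * (?P \<omega> - z i \<omega>)\<bar>)"
      by (rule integral_abs_bound)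
    also have "\<dots> \<le> expectation (\<lambda>\<omega>. real m * (C * 1024 / \<epsilon> ^ 7 * h\<^sup>2))"
    proof (rule integral_mono)
      show "integrable M (\<lambda>\<omega>. \<bar>a i \<omega> * (?P \<omega> - z i \<omega>)\<bar>)"
        using int' int [of i i] by (simp add: right_diff_distrib)
      fix \<omega>
      show "\<bar>a i \<omega> * (?P \<omega> - z i \<omega>)\<bar> \<le> real m * (C * 1024 / \<epsilon> ^ 7 * h\<^sup>2)"
      proof (cases "\<forall>j\<le>i. W (t j) \<omega> \<in> G")
        case True
        then have "\<epsilon> \<le> wedge_margin m (W (t i) \<omega>)"
          by (auto simp: G_def)
        then show ?thesis
          using True \<psi>.wedge_potential_defect [OF m h \<epsilon>, of "W (t i) \<omega>" "t i"] by (simp add: a_def z_def)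
      next
        case False
        then have "a i \<omega> = 0"
          unfolding a_def by simp
        then show ?thesis
          using \<epsilon> \<psi>.C_nonneg by simp
      qed
    qed simp
    finally show ?thesis
      by (simp add: prob_space)
  qed
  have "expectation (\<lambda>\<omega>. wedge_potential m \<psi> (s \<omega>) (W (s \<omega>) \<omega>)) - wedge_potential m \<psi> 0 x\<^sub>0 =
      (\<Sum>i<N. expectation (\<lambda>\<omega>. a i \<omega> * (z (Suc i) \<omega> - z i \<omega>)))"
  proof -
    have int2: "integrable M (\<lambda>\<omega>. a i \<omega> * (z (Suc i) \<omega> - z i \<omega>))" for i
      using int [of i] by (simp add: right_diff_distrib)
    show ?thesis
      unfolding path
      by (subst Bochner_Integration.integral_add, rule z_int, rule Bochner_Integration.integrable_sum, rule int2,
          subst Bochner_Integration.integral_sum, rule int2, simp add: z0)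
  qed
  also have "\<bar>\<dots>\<bar> \<le> (\<Sum>i<N. \<bar>expectation (\<lambda>\<omega>. a i \<omega> * (z (Suc i) \<omega> - z i \<omega>))\<bar>)"
    by (rule sum_abs)
  also have "\<dots> \<le> of_nat (card {..<N}) * (real m * (C * 1024 / \<epsilon> ^ 7 * h\<^sup>2))"
    by (rule sum_bounded_above) (use step in auto)
  finally show ?B
    by (simp add: N_def h_def)
qed

text \<open>If the boundary is reached before \<open>T\<close>, then
  \<open>wedge_extension_ray\<close> gives the value. Otherwise the exit happens at \<open>T\<close>
  or later, where the data vanish; so does \<open>layer_mean\<close> at \<open>T\<close>, which sees
  the data only from \<open>T\<close> on.\<close>

lemma exit_value_eq_extension:
  assumes \<psi>: "continuous_data \<psi> C" and m: "1 \<le> m"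
    and late: "\<And>t r. T \<le> t \<Longrightarrow> \<psi> (t, r) = 0" and neg: "\<And>t r. r \<le> 0 \<Longrightarrow> \<psi> (t, r) = 0"
    and \<rho>: "0 < \<rho>" "\<rho> \<le> T" and before: "\<And>t. 0 < t \<Longrightarrow> t < \<rho> \<Longrightarrow> 0 < exit_margin m \<omega> t"
    and hit: "\<rho> < T \<Longrightarrow> exit_margin m \<omega> \<rho> = 0"
  shows "exit_value W (hitting_time W (wedge_boundary 0 (pi / real m))) \<psi> \<omega> = wedge_extension m \<psi> \<rho> (W \<rho> \<omega>)"
proof -
  interpret \<psi>: continuous_data \<psi> C by (rule \<psi>)
  let ?\<tau> = "hitting_time W (wedge_boundary 0 (pi / real m)) \<omega>"
  have notin: "W t \<omega> \<notin> wedge_boundary 0 (pi / real m)" if "0 < t" "t < \<rho>" for t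
    using before [OF that] by (simp add: mem_wedge_boundary_iff [OF m] exit_margin_def)
  show ?thesis
  proof (cases "\<rho> < T")
    case True
    then have zero: "wedge_margin m (W \<rho> \<omega>) = 0"
      using hit by (simp add: exit_margin_def)
    then have \<tau>: "?\<tau> = ereal \<rho>"
      by (intro hitting_time_eqI \<rho> notin) (simp_all add: mem_wedge_boundary_iff [OF m])
    have ev: "exit_value W (hitting_time W (wedge_boundary 0 (pi / real m))) \<psi> \<omega> =
        (if snd (W \<rho> \<omega>) = 0 then \<psi> (\<rho>, fst (W \<rho> \<omega>)) else 0)"
      by (simp add: exit_value_def \<tau>)
    from m zero show ?thesis
    proof (cases rule: wedge_margin_zeroE)
      case (1 r)
      then show ?thesis
        unfolding ev 1(2) by (simp add: \<psi>.wedge_extension_ray [OF m neg 1(1)]) (simp add: polar_def)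
    next
      case (2 r)
      \<comment> \<open>A point of the second ray that lies on the axis is the apex or belongs to
        the case \<open>m = 1\<close>. Its abscissa is nonpositive, so \<open>exit_value\<close>
        evaluates the data where they vanish.\<close>
      have "\<psi> (\<rho>, r * cos (pi / real m)) = 0" if s: "r * sin (pi / real m) = 0"
      proof (cases "m = 1 \<or> r = 0")
        case True
        then have "r * cos (pi / real m) \<le> 0"
          using 2(1) by auto
        then show ?thesis by (rule neg)
      next
        case False
        then have "0 < sin (pi / real m)"
          using m by (intro sin_gt_zero) (auto simp: field_simps)
        with s False show ?thesis by simp
      qed
      then show ?thesis
        unfolding ev 2(2) by (simp add: \<psi>.wedge_extension_ray [OF m neg 2(1)]) (simp add: polar_def)
    qed
  next
    case False
    then have \<rho>T: "\<rho> = T" using \<rho> by simp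
    have "ereal T \<le> ?\<tau>"
      using notin by (intro hitting_time_geI) (simp add: \<rho>T)
    then have "T \<le> real_of_ereal ?\<tau>" if "?\<tau> \<noteq> \<infinity>"
      using that by (cases ?\<tau>) auto
    then have "exit_value W (hitting_time W (wedge_boundary 0 (pi / real m))) \<psi> \<omega> = 0"
      by (simp add: exit_value_def late)
    moreover have "layer_mean \<psi> T x = 0" for x
      unfolding layer_mean_def by (intro integral_eq_zero_AE AE_I2) (simp add: late)
    then have "wedge_extension m \<psi> T (W \<rho> \<omega>) = 0"
      by (simp add: wedge_extension_def)
    ultimately show ?thesis
      by (simp add: \<rho>T)
  qed
qed

text \<open>The factor \<open>of_bool (W 0 \<omega> = x\<^sub>0)\<close> discards the null set of
  wrong starting points, so that both limits hold at every \<open>\<omega>\<close> and measurability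
  passes to the limit function. Both limits are dominated by the bound \<open>m * C\<close> of the
  potential.\<close>

theorem expectation_exit_value:
  assumes \<psi>: "continuous_data \<psi> C" and m: "1 \<le> m" and x\<^sub>0: "0 < wedge_margin m x\<^sub>0"
    and late: "\<And>t r. T \<le> t \<Longrightarrow> \<psi> (t, r) = 0" and neg: "\<And>t r. r \<le> 0 \<Longrightarrow> \<psi> (t, r) = 0" and T: "0 < T"
  defines "f \<equiv> \<lambda>\<omega>. of_bool (W 0 \<omega> = x\<^sub>0) * exit_value W (hitting_time W (wedge_boundary 0 (pi / real m))) \<psi> \<omega>"
  shows "f \<in> borel_measurable M" and "expectation f = wedge_potential m \<psi> 0 x\<^sub>0"
proof -
  interpret \<psi>: continuous_data \<psi> C by (rule \<psi>)
  define d where "d = wedge_margin m x\<^sub>0"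
  define \<epsilon> where "\<epsilon> j = d / real (Suc j)" for j
  have \<epsilon>: "0 < \<epsilon> j" for j using x\<^sub>0 by (simp add: \<epsilon>_def d_def)
  define s where "s j n \<omega> = exit_time (exit_margin m \<omega>) T (\<epsilon> j) n" for j n \<omega>
  define u where "u j n \<omega> = of_bool (W 0 \<omega> = x\<^sub>0) * wedge_potential m \<psi> (s j n \<omega>) (W (s j n \<omega>) \<omega>)" for j n \<omega>
  define \<sigma> where "\<sigma> j \<omega> = lim (\<lambda>n. s j n \<omega>)" for j \<omega>
  define g where "g j \<omega> = of_bool (W 0 \<omega> = x\<^sub>0) * wedge_extension m \<psi> (\<sigma> j \<omega>) (W (\<sigma> j \<omega>) \<omega>)" for j \<omega>
  have path: "(\<forall>j. (\<lambda>n. u j n \<omega>) \<longlonglongrightarrow> g j \<omega>) \<and> (\<lambda>j. g j \<omega>) \<longlonglongrightarrow> f \<omega>" if \<omega>: "\<omega> \<in> space M" for \<omega>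
  proof (cases "W 0 \<omega> = x\<^sub>0")
    case True
    have d0: "exit_margin m \<omega> 0 = d" by (simp add: exit_margin_def True d_def)
    have cW: "continuous_on {0..T} (\<lambda>t. W t \<omega>)"
      by (rule continuous_on_subset [OF continuous_paths [OF \<omega>]]) auto
    have cd: "continuous_on {0..T} (exit_margin m \<omega>)"
      unfolding exit_margin_def [abs_def] by (intro continuous_intros cW)
    have pos: "0 < exit_margin m \<omega> 0" using x\<^sub>0 by (simp add: d0 d_def)
    obtain \<sigma>' \<rho> where lim: "\<And>j. exit_time (exit_margin m \<omega>) T (exit_margin m \<omega> 0 / real (Suc j)) \<longlonglongrightarrow> \<sigma>' j"
      and \<sigma>'_b: "\<And>j. 0 \<le> \<sigma>' j \<and> \<sigma>' j \<le> T" and \<sigma>'_pos: "\<And>j. 0 < exit_margin m \<omega> (\<sigma>' j)"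
      and \<rho>_lim: "\<sigma>' \<longlonglongrightarrow> \<rho>" and \<rho>_b: "0 \<le> \<rho>" "\<rho> \<le> T"
      and before: "\<And>t. 0 \<le> t \<Longrightarrow> t < \<rho> \<Longrightarrow> 0 < exit_margin m \<omega> t" and hit: "\<rho> < T \<Longrightarrow> exit_margin m \<omega> \<rho> = 0"
      using exit_time_double_limit [OF T cd pos] by metis
    have s_lim: "(\<lambda>n. s j n \<omega>) \<longlonglongrightarrow> \<sigma>' j" for j
      using lim [of j] by (simp add: s_def \<epsilon>_def d0)
    have \<sigma>_eq: "\<sigma> j \<omega> = \<sigma>' j" for j
      unfolding \<sigma>_def by (rule limI [OF s_lim])
    have W_lim: "(\<lambda>n. W (r n) \<omega>) \<longlonglongrightarrow> W l \<omega>" if "r \<longlonglongrightarrow> l" "\<And>n. 0 \<le> r n \<and> r n \<le> T" "0 \<le> l" "l \<le> T" for r l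
      using cW that by (auto simp: continuous_on_sequentially o_def)
    have s_b: "0 \<le> s j n \<omega> \<and> s j n \<omega> \<le> T" for j n
      unfolding s_def using exit_time_bounds [of T] T by simp
    have "(\<lambda>n. u j n \<omega>) \<longlonglongrightarrow> g j \<omega>" for j
    proof -
      have Wl: "(\<lambda>n. W (s j n \<omega>) \<omega>) \<longlonglongrightarrow> W (\<sigma>' j) \<omega>"
        by (rule W_lim [OF s_lim s_b]) (use \<sigma>'_b in auto)
      have "isCont (wedge_margin m) x" for x
        using continuous_wedge_margin [OF continuous_on_id, of UNIV m] continuous_on_eq_continuous_at [OF open_UNIV]
        by (auto simp: id_def)
      from isCont_tendsto_compose [OF this Wl]
      have "eventually (\<lambda>n. 0 < wedge_margin m (W (s j n \<omega>) \<omega>)) sequentially"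
        using \<sigma>'_pos [of j] unfolding exit_margin_def by (rule order_tendstoD(1))
      then have ev: "eventually (\<lambda>n. wedge_extension m \<psi> (s j n \<omega>) (W (s j n \<omega>) \<omega>) = u j n \<omega>) sequentially"
        by eventually_elim (simp add: u_def True \<psi>.wedge_potential_eq_extension [OF m])
      have "(\<lambda>n. wedge_extension m \<psi> (s j n \<omega>) (W (s j n \<omega>) \<omega>)) \<longlonglongrightarrow> g j \<omega>"
        unfolding g_def by (simp add: True \<sigma>_eq \<psi>.wedge_extension_tendsto [OF s_lim Wl])
      from Lim_transform_eventually [OF this ev] show ?thesis .
    qed
    moreover have "(\<lambda>j. g j \<omega>) \<longlonglongrightarrow> f \<omega>"
    proof -
      \<comment> \<open>For \<open>\<rho> = 0 < T\<close> the margin would vanish at time 0, whereas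
        the start is interior.\<close>
      have "0 < \<rho>"
        using hit pos \<rho>_b T by (cases "\<rho> = 0") auto
      then have "f \<omega> = wedge_extension m \<psi> \<rho> (W \<rho> \<omega>)"
        unfolding f_def
        by (simp add: True exit_value_eq_extension [OF \<psi> m late neg _ \<rho>_b(2) before hit])
      then show ?thesis
        unfolding g_def using W_lim [OF \<rho>_lim \<sigma>'_b \<rho>_b]
        by (simp add: True \<sigma>_eq \<psi>.wedge_extension_tendsto [OF \<rho>_lim])
    qed
    ultimately show ?thesis by blast
  qed (simp add: u_def g_def f_def)
  have T_small: "eventually (\<lambda>n. T / 2 ^ n \<le> 1) sequentially"
  proof -
    have "(\<lambda>n. T / 2 ^ n) \<longlonglongrightarrow> 0"
      by (intro LIMSEQ_divide_realpow_zero) simp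
    from order_tendstoD(2) [OF this zero_less_one] show ?thesis
      by eventually_elim simp
  qed
  \<comment> \<open>From \<open>n0\<close> on the mesh is at most 1, the range in which the bound
    for \<open>hit_density\<close> holds.\<close>
  then obtain n0 where n0: "\<And>n. n0 \<le> n \<Longrightarrow> T / 2 ^ n \<le> 1"
    by (auto simp: eventually_sequentially)
  have [measurable]: "W 0 \<in> M \<rightarrow>\<^sub>M borel" by (rule random_variable_W) simp
  have ind_m: "(\<lambda>\<omega>. of_bool (W 0 \<omega> = x\<^sub>0) :: real) \<in> borel_measurable M"
  proof -
    have "(\<lambda>\<omega>. of_bool (W 0 \<omega> = x\<^sub>0) :: real) = (\<lambda>\<omega>. indicator {x\<^sub>0} (W 0 \<omega>))"
      by (auto simp: fun_eq_iff indicator_def)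
    then show ?thesis by simp
  qed
  have u_m: "u j (n + n0) \<in> borel_measurable M" for j n
    unfolding u_def s_def
    by (intro borel_measurable_times ind_m stopped_wedge_potential(1) [OF \<psi>.bounded_data_axioms m T n0 \<epsilon>]) simp
  have u_b: "\<bar>u j n \<omega>\<bar> \<le> real m * C" for j n \<omega>
    using \<psi>.wedge_potential_bound [of m] order.trans [OF abs_ge_zero \<psi>.wedge_potential_bound [of m 0 0]]
    by (simp add: u_def)
  have u_lim: "(\<lambda>n. u j (n + n0) \<omega>) \<longlonglongrightarrow> g j \<omega>" if "\<omega> \<in> space M" for j \<omega>
    using path [OF that] by (intro LIMSEQ_ignore_initial_segment) blast
  have g_m: "g j \<in> borel_measurable M" for j
    by (rule borel_measurable_LIMSEQ_real [OF u_lim u_m])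
  have g_lim: "(\<lambda>j. g j \<omega>) \<longlonglongrightarrow> f \<omega>" if "\<omega> \<in> space M" for \<omega>
    using path [OF that] by blast
  show f_m: "f \<in> borel_measurable M"
    by (rule borel_measurable_LIMSEQ_real [OF g_lim g_m])
  have g_b: "\<bar>g j \<omega>\<bar> \<le> real m * C" if "\<omega> \<in> space M" for j \<omega>
    by (rule LIMSEQ_le_const2 [OF tendsto_rabs [OF u_lim [OF that]]]) (use u_b in auto)
  have E_g: "expectation (g j) = wedge_potential m \<psi> 0 x\<^sub>0" for j
  proof (rule LIMSEQ_unique)
    show "(\<lambda>n. expectation (u j (n + n0))) \<longlonglongrightarrow> expectation (g j)"
      by (rule integral_dominated_convergence [where w = "\<lambda>_. real m * C"])
         (use g_m u_m u_b u_lim in auto)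
    have E_u: "expectation (u j n) = expectation (\<lambda>\<omega>. wedge_potential m \<psi> (s j n \<omega>) (W (s j n \<omega>) \<omega>))" if "n0 \<le> n" for n
    proof (rule integral_cong_AE)
      show "u j n \<in> borel_measurable M"
        using u_m [of j "n - n0"] that by simp
      show "(\<lambda>\<omega>. wedge_potential m \<psi> (s j n \<omega>) (W (s j n \<omega>) \<omega>)) \<in> borel_measurable M"
        unfolding s_def by (rule stopped_wedge_potential(1) [OF \<psi>.bounded_data_axioms m T n0 [OF that] \<epsilon>])
      show "AE \<omega> in M. u j n \<omega> = wedge_potential m \<psi> (s j n \<omega>) (W (s j n \<omega>) \<omega>)"
        using start by eventually_elim (simp add: u_def)
    qed
    let ?c = "real m * (C * 1024 / \<epsilon> j ^ 7 * T\<^sup>2)"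
    have bnd: "\<bar>expectation (u j (n + n0)) - wedge_potential m \<psi> 0 x\<^sub>0\<bar> \<le> ?c / 2 ^ (n + n0)" for n
    proof -
      have "\<bar>expectation (u j (n + n0)) - wedge_potential m \<psi> 0 x\<^sub>0\<bar> \<le>
          2 ^ (n + n0) * (real m * (C * 1024 / \<epsilon> j ^ 7 * (T / 2 ^ (n + n0))\<^sup>2))"
        unfolding E_u [OF le_add2] s_def
        by (rule stopped_wedge_potential(2) [OF \<psi>.bounded_data_axioms m T n0 [OF le_add2] \<epsilon>])
      also have "\<dots> = ?c / 2 ^ (n + n0)"
        by (simp add: power_divide power2_eq_square)
      finally show ?thesis .
    qed
    have c_lim: "(\<lambda>n. ?c / 2 ^ (n + n0)) \<longlonglongrightarrow> 0"
    proof -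
      have "(\<lambda>n. ?c / 2 ^ n) \<longlonglongrightarrow> 0"
        by (rule LIMSEQ_divide_realpow_zero) simp
      from LIMSEQ_ignore_initial_segment [OF this, of n0] show ?thesis .
    qed
    have "(\<lambda>n. expectation (u j (n + n0)) - wedge_potential m \<psi> 0 x\<^sub>0) \<longlonglongrightarrow> 0"
    proof (rule Lim_null_comparison [OF _ c_lim])
      show "eventually (\<lambda>n. norm (expectation (u j (n + n0)) - wedge_potential m \<psi> 0 x\<^sub>0) \<le> ?c / 2 ^ (n + n0)) sequentially"
        unfolding real_norm_def by (rule always_eventually) (rule allI, rule bnd)
    qed
    then show "(\<lambda>n. expectation (u j (n + n0))) \<longlonglongrightarrow> wedge_potential m \<psi> 0 x\<^sub>0"
      by (simp add: LIM_zero_iff)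
  qed
  have "(\<lambda>j. expectation (g j)) \<longlonglongrightarrow> expectation f"
    by (rule integral_dominated_convergence [where w = "\<lambda>_. real m * C"])
       (use g_m f_m g_b g_lim in auto)
  then show "expectation f = wedge_potential m \<psi> 0 x\<^sub>0"
    unfolding E_g by (simp add: LIMSEQ_const_iff)
qed

end

subsection \<open>From test functions to densities\<close>

context planar_brownian_motion begin

text \<open>The hitting time is below \<open>a\<close> exactly if some interval with positive
  rational ends below \<open>a\<close> contains a zero of \<open>g\<close> along the path. By
  compactness this means that the values at rational times in it come arbitrarily close to 0, a
  countable condition. The left end is positive because the hitting time ignores the time 0.\<close>

lemma measurable_hitting_time:
  fixes g :: "real \<times> real \<Rightarrow> real"
  assumes g: "continuous_on UNIV g" and F: "\<And>x. x \<in> F \<longleftrightarrow> g x = 0"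
  shows "hitting_time W F \<in> borel_measurable M"
proof (rule borel_measurableI_less)
  fix a :: ereal
  define near where "near p q \<omega> \<longleftrightarrow> (\<forall>n. \<exists>u\<in>\<rat> \<inter> {p..q}. \<bar>g (W u \<omega>)\<bar> < 1 / real (Suc n))" for p q \<omega>
  define Z where "Z = {(p, q). p \<in> \<rat> \<and> q \<in> \<rat> \<and> 0 < p \<and> p < q \<and> ereal q < a}"
  have near_iff: "near p q \<omega> \<longleftrightarrow> (\<exists>t\<in>{p..q}. W t \<omega> \<in> F)" if pq: "0 < p" "p < q" and \<omega>: "\<omega> \<in> space M" for p q \<omega>
  proof -
    have cont: "continuous_on {p..q} (\<lambda>t. \<bar>g (W t \<omega>)\<bar>)"
      by (intro continuous_intros continuous_on_compose2 [OF g] continuous_on_subset [OF continuous_paths [OF \<omega>]])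
         (use pq in auto)
    show ?thesis
    proof
      assume near: "near p q \<omega>"
      obtain t where t: "t \<in> {p..q}" "\<And>u. u \<in> {p..q} \<Longrightarrow> \<bar>g (W t \<omega>)\<bar> \<le> \<bar>g (W u \<omega>)\<bar>"
        using continuous_attains_inf [OF compact_Icc _ cont] pq by auto
      have "\<bar>g (W t \<omega>)\<bar> \<le> 0"
      proof (rule field_le_epsilon)
        fix e :: real assume "0 < e"
        then obtain n where n: "1 / real (Suc n) < e"
          using nat_approx_posE by blast
        from near obtain u where "u \<in> {p..q}" "\<bar>g (W u \<omega>)\<bar> < 1 / real (Suc n)"
          unfolding near_def by blast
        with t(2) [of u] n show "\<bar>g (W t \<omega>)\<bar> \<le> 0 + e" by simp
      qed
      with t(1) show "\<exists>t\<in>{p..q}. W t \<omega> \<in> F"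
        by (auto simp: F)
    next
      assume "\<exists>t\<in>{p..q}. W t \<omega> \<in> F"
      then obtain t where t: "t \<in> {p..q}" "g (W t \<omega>) = 0"
        by (auto simp: F)
      show "near p q \<omega>"
        unfolding near_def
      proof
        fix n
        have "0 < 1 / real (Suc n)" by simp
        then obtain d where d: "0 < d" "\<And>u. u \<in> {p..q} \<Longrightarrow> dist u t < d \<Longrightarrow> \<bar>g (W u \<omega>)\<bar> < 1 / real (Suc n)"
          using cont t unfolding continuous_on_iff dist_real_def by (metis abs_0 abs_abs diff_zero)
        have "max p (t - d) < min q (t + d)"
          using t d pq by auto
        from Rats_dense_in_real [OF this] obtain u where "u \<in> \<rat>" "max p (t - d) < u" "u < min q (t + d)"
          by blast
        then show "\<exists>u\<in>\<rat> \<inter> {p..q}. \<bar>g (W u \<omega>)\<bar> < 1 / real (Suc n)"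
          using d(2) [of u] by (intro bexI [of _ u]) (auto simp: dist_real_def)
      qed
    qed
  qed
  have "hitting_time W F \<omega> < a \<longleftrightarrow> (\<exists>z\<in>Z. near (fst z) (snd z) \<omega>)" if \<omega>: "\<omega> \<in> space M" for \<omega>
  proof
    assume "hitting_time W F \<omega> < a"
    then obtain t where t: "0 < t" "W t \<omega> \<in> F" "ereal t < a"
      by (auto simp: hitting_time_def INF_less_iff)
    from ereal_dense2 [OF t(3)] obtain b where b: "t < b" "ereal b < a"
      by auto
    obtain p where p: "p \<in> \<rat>" "0 < p" "p < t"
      using Rats_dense_in_real [OF t(1)] by blast
    obtain q where q: "q \<in> \<rat>" "t < q" "q < b"
      using Rats_dense_in_real [OF b(1)] by blast
    have "ereal q < a"
      using q(3) b(2) by (meson ereal_less_eq(3) less_imp_le order_le_less_trans)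
    with p q have "(p, q) \<in> Z" "near p q \<omega>"
      using t near_iff [of p q \<omega>] \<omega> by (auto simp: Z_def)
    then show "\<exists>z\<in>Z. near (fst z) (snd z) \<omega>"
      by (intro bexI [of _ "(p, q)"]) auto
  next
    assume "\<exists>z\<in>Z. near (fst z) (snd z) \<omega>"
    then obtain p q where pq: "(p, q) \<in> Z" "near p q \<omega>" by auto
    then obtain t where t: "t \<in> {p..q}" "W t \<omega> \<in> F"
      using near_iff [of p q \<omega>] \<omega> by (auto simp: Z_def)
    then have "ereal t < a"
      using pq(1) by (auto simp: Z_def intro: order_le_less_trans [of "ereal t" "ereal q"])
    then show "hitting_time W F \<omega> < a"
      using t pq(1) by (auto simp: hitting_time_def INF_less_iff Z_def intro!: exI [of _ t])
  qed
  then have "{\<omega> \<in> space M. hitting_time W F \<omega> < a} = {\<omega> \<in> space M. \<exists>z\<in>Z. near (fst z) (snd z) \<omega>}"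
    by blast
  also have "\<dots> \<in> sets M"
  proof -
    have ex: "Measurable.pred M (\<lambda>\<omega>. \<exists>i\<in>I. P i \<omega>)"
      if "countable I" "\<And>i. i \<in> I \<Longrightarrow> Measurable.pred M (P i)" for I :: "real set" and P
      using that unfolding pred_def by (intro sets.sets_Collect_countable_Ex') auto
    have "countable Z"
      by (rule countable_subset [of _ "\<rat> \<times> \<rat>"]) (auto simp: Z_def countable_rat)
    moreover have "Measurable.pred M (\<lambda>\<omega>. near (fst z) (snd z) \<omega>)" if "z \<in> Z" for z
      unfolding near_def
    proof (intro pred_intros_countable(1) ex)
      show "countable (\<rat> \<inter> {fst z..snd z})"
        by (simp add: countable_rat countable_Int1)
    next
      fix n u assume "u \<in> \<rat> \<inter> {fst z..snd z}"
      then have "0 \<le> u" using that by (auto simp: Z_def)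
      then have [measurable]: "W u \<in> M \<rightarrow>\<^sub>M borel"
        by (rule random_variable_W)
      have [measurable]: "g \<in> borel_measurable borel"
        using g by (rule borel_measurable_continuous_onI)
      show "Measurable.pred M (\<lambda>\<omega>. \<bar>g (W u \<omega>)\<bar> < 1 / real (Suc n))"
        by measurable
    qed
    ultimately have "Measurable.pred M (\<lambda>\<omega>. \<exists>z\<in>Z. near (fst z) (snd z) \<omega>)"
      unfolding pred_def by (intro sets.sets_Collect_countable_Ex') auto
    then show ?thesis
      by (simp add: pred_def)
  qed
  finally show "{\<omega> \<in> space M. hitting_time W F \<omega> < a} \<in> sets M" .
qed

text \<open>Rounding the time up to multiples of \<open>1 / Suc n\<close> leaves countably many
  values, and continuity of the path recovers the position at the original time in the
  limit.\<close>

lemma measurable_at_random_time: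
  assumes T [measurable]: "T \<in> borel_measurable M" and T_nonneg: "\<And>\<omega>. 0 \<le> T \<omega>"
  shows "(\<lambda>\<omega>. W (T \<omega>) \<omega>) \<in> M \<rightarrow>\<^sub>M borel"
proof (rule borel_measurable_LIMSEQ_metric)
  define q where "q n \<omega> = nat \<lceil>real (Suc n) * T \<omega>\<rceil>" for n \<omega>
  show "(\<lambda>\<omega>. W (real (q n \<omega>) / real (Suc n)) \<omega>) \<in> M \<rightarrow>\<^sub>M borel" for n
  proof (rule measurable_compose_countable [where g = "q n"])
    show "W (real i / real (Suc n)) \<in> M \<rightarrow>\<^sub>M borel" for i
      by (rule random_variable_W) simp
    show "q n \<in> M \<rightarrow>\<^sub>M count_space UNIV"
      unfolding q_def by measurable
  qed
  fix \<omega> assume \<omega>: "\<omega> \<in> space M"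
  have rq: "real (q n \<omega>) = of_int \<lceil>real (Suc n) * T \<omega>\<rceil>" for n
    using T_nonneg [of \<omega>] by (simp add: q_def)
  have q: "real (Suc n) * T \<omega> \<le> real (q n \<omega>)" "real (q n \<omega>) \<le> real (Suc n) * T \<omega> + 1" for n
    unfolding rq by linarith+
  have le: "T \<omega> \<le> real (q n \<omega>) / real (Suc n)" "real (q n \<omega>) / real (Suc n) \<le> T \<omega> + 1 / real (Suc n)" for n
    using divide_right_mono [OF q(1), of "real (Suc n)" n] divide_right_mono [OF q(2), of "real (Suc n)" n]
    by (simp_all add: add_divide_distrib)
  have "(\<lambda>n. T \<omega> + 1 / real (Suc n)) \<longlonglongrightarrow> T \<omega> + 0"
    by (intro tendsto_add tendsto_const LIMSEQ_Suc [OF lim_1_over_n])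
  then have lim: "(\<lambda>n. T \<omega> + 1 / real (Suc n)) \<longlonglongrightarrow> T \<omega>"
    by simp
  have "(\<lambda>n. real (q n \<omega>) / real (Suc n)) \<longlonglongrightarrow> T \<omega>"
    by (rule tendsto_sandwich [OF _ _ tendsto_const lim]; rule always_eventually; rule allI; rule le)
  then show "(\<lambda>n. W (real (q n \<omega>) / real (Suc n)) \<omega>) \<longlonglongrightarrow> W (T \<omega>) \<omega>"
    by (rule continuous_on_tendsto_compose [OF continuous_paths [OF \<omega>]]) (simp_all add: T_nonneg)
qed

end

lemma hitting_time_nonneg: "0 \<le> hitting_time X F \<omega>"
  unfolding hitting_time_def by (intro INF_greatest) auto

text \<open>The value \<open>(0, 0)\<close> encodes that the ray with angle \<open>0\<close> is not hit; it lies outside \<open>{0<..} \<times> {0<..}\<close>.\<close>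

definition exit_pair :: "(real \<Rightarrow> 'a \<Rightarrow> real \<times> real) \<Rightarrow> ('a \<Rightarrow> ereal) \<Rightarrow> 'a \<Rightarrow> real \<times> real" where
  "exit_pair X \<tau> \<omega> =
    (if \<tau> \<omega> \<noteq> \<infinity> \<and> snd (X (real_of_ereal (\<tau> \<omega>)) \<omega>) = 0
     then (real_of_ereal (\<tau> \<omega>), fst (X (real_of_ereal (\<tau> \<omega>)) \<omega>)) else (0, 0))"

lemma exit_value_eq_exit_pair:
  assumes "\<psi> (0, 0) = 0"
  shows "exit_value X \<tau> \<psi> \<omega> = \<psi> (exit_pair X \<tau> \<omega>)"
  using assms by (simp add: exit_value_def exit_pair_def)

lemma exit_pair_event:
  assumes "0 \<le> \<tau> \<omega>" and B: "B \<subseteq> {0<..} \<times> {0<..}"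
  shows "(\<exists>(t, r)\<in>B. \<tau> \<omega> = ereal t \<and> X t \<omega> = polar r 0) \<longleftrightarrow> exit_pair X \<tau> \<omega> \<in> B"
proof -
  have "(0, 0) \<notin> B" using B by auto
  with assms(1) show ?thesis
    by (cases "\<tau> \<omega>") (auto simp: exit_pair_def polar_def prod_eq_iff intro: bexI [rotated])
qed

context planar_brownian_motion begin

lemma measurable_exit_pair:
  assumes m: "1 \<le> m"
  shows "exit_pair W (hitting_time W (wedge_boundary 0 (pi / real m))) \<in> M \<rightarrow>\<^sub>M borel"
proof -
  let ?\<tau> = "hitting_time W (wedge_boundary 0 (pi / real m))"
  have \<tau> [measurable]: "?\<tau> \<in> borel_measurable M"
    by (rule measurable_hitting_time [where g = "wedge_margin m"])
       (auto intro!: continuous_intros simp: mem_wedge_boundary_iff [OF m])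
  have [measurable]: "(\<lambda>\<omega>. W (real_of_ereal (?\<tau> \<omega>)) \<omega>) \<in> M \<rightarrow>\<^sub>M borel"
    by (rule measurable_at_random_time) (simp_all add: real_of_ereal_pos hitting_time_nonneg)
  have "exit_pair W ?\<tau> \<in> M \<rightarrow>\<^sub>M borel \<Otimes>\<^sub>M borel"
    unfolding exit_pair_def by measurable
  then show ?thesis
    by (simp add: borel_prod)
qed

section \<open>Law of the exit time and place\<close>

definition exit_density :: "nat \<Rightarrow> real \<times> real \<Rightarrow> real" where
  "exit_density m p = (\<Sum>k<m. poisson_kernel (rotate (image_angle m k) x\<^sub>0) p)"

lemma integrable_exit_density: "integrable lborel (exit_density m)"
  unfolding exit_density_def by (intro Bochner_Integration.integrable_sum integrable_poisson_kernel)

lemma prob_exit_pair_open: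
  assumes m: "1 \<le> m" and x\<^sub>0: "0 < wedge_margin m x\<^sub>0" and U: "open U" "U \<subseteq> {0<..} \<times> {0<..}"
  defines "\<Phi> \<equiv> exit_pair W (hitting_time W (wedge_boundary 0 (pi / real m)))"
  shows "prob (\<Phi> -` U \<inter> space M) = (LINT p:U|lborel. exit_density m p)"
proof -
  have [measurable]: "\<Phi> \<in> M \<rightarrow>\<^sub>M borel"
    unfolding \<Phi>_def by (rule measurable_exit_pair [OF m])
  have [measurable]: "U \<in> sets borel" using U by simp
  \<comment> \<open>The factor \<open>cut n\<close> removes the times from \<open>real n\<close> on,
    because test data have to vanish after a finite time. The factor with \<open>infdist\<close>
    vanishes off \<open>U\<close> and tends to 1 on it.\<close>
  define cut where "cut n p = max 0 (min 1 (real n - fst p))" for n :: nat and p :: "real \<times> real"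
  define \<psi> where "\<psi> n p = min 1 (real n * infdist p (- U)) * cut n p" for n :: nat and p
  have cut_b: "0 \<le> cut n p" "cut n p \<le> 1" for n p by (simp_all add: cut_def)
  have \<psi>_b: "0 \<le> \<psi> n p" "\<psi> n p \<le> 1" for n p
    unfolding \<psi>_def by (simp_all add: cut_b infdist_nonneg mult_le_one)
  have \<psi>_out: "\<psi> n p = 0" if "p \<notin> U" for n p
    using that by (simp add: \<psi>_def)
  have \<psi>_lim: "(\<lambda>n. \<psi> n p) \<longlonglongrightarrow> indicator U p" for p
  proof (cases "p \<in> U")
    case True
    have "0 \<notin> U" using U(2) by (auto simp: zero_prod_def)
    then have "- U \<noteq> {}" by blast
    then have pos: "0 < infdist p (- U)"
      using U True in_closed_iff_infdist_zero [of "- U" p] infdist_nonneg [of p "- U"]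
      by (auto simp: less_le)
    obtain n1 where n1: "1 / infdist p (- U) < real n1"
      using reals_Archimedean2 by blast
    obtain n2 where n2: "fst p + 1 < real n2"
      using reals_Archimedean2 by blast
    have "\<psi> n p = 1" if "max n1 n2 \<le> n" for n
    proof -
      have "1 / infdist p (- U) < real n" "fst p + 1 < real n"
        using n1 n2 that by (auto intro: less_le_trans)
      then show ?thesis
        using pos by (simp add: \<psi>_def cut_def field_simps)
    qed
    then have "eventually (\<lambda>n. \<psi> n p = 1) sequentially"
      unfolding eventually_sequentially by blast
    with True show ?thesis
      by (simp add: tendsto_eventually)
  qed (simp add: \<psi>_out)
  have \<psi>_cont: "continuous_on UNIV (\<psi> n)" for n
    unfolding \<psi>_def cut_def by (intro continuous_intros continuous_on_min continuous_on_max)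
  have data: "continuous_data (\<psi> n) 1" for n
    using \<psi>_b \<psi>_cont by unfold_locales (auto intro: borel_measurable_continuous_onI)
  have [measurable]: "\<psi> n \<in> borel_measurable borel" for n
    using \<psi>_cont by (rule borel_measurable_continuous_onI)
  have main: "expectation (\<lambda>\<omega>. \<psi> n (\<Phi> \<omega>)) = (LINT p|lborel. \<psi> n p * exit_density m p)" for n
  proof -
    interpret \<psi>: continuous_data "\<psi> n" 1 by (rule data)
    have late: "\<psi> n (t, r) = 0" if "real n + 1 \<le> t" for t r
      using that by (simp add: \<psi>_def cut_def)
    have neg: "\<psi> n (t, r) = 0" if "r \<le> 0" for t r
      using U(2) that by (intro \<psi>_out) auto
    have neg': "\<psi> n (t, r) = 0" if "t \<le> 0" for t r
      using U(2) that by (intro \<psi>_out) auto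
    note E = expectation_exit_value [where T = "real n + 1", OF data m x\<^sub>0 late neg]
    have ev: "exit_value W (hitting_time W (wedge_boundary 0 (pi / real m))) (\<psi> n) \<omega> = \<psi> n (\<Phi> \<omega>)" for \<omega>
      unfolding \<Phi>_def by (rule exit_value_eq_exit_pair) (simp add: neg)
    have "expectation (\<lambda>\<omega>. \<psi> n (\<Phi> \<omega>)) = expectation (\<lambda>\<omega>. of_bool (W 0 \<omega> = x\<^sub>0) * \<psi> n (\<Phi> \<omega>))"
    proof (rule integral_cong_AE)
      show "(\<lambda>\<omega>. of_bool (W 0 \<omega> = x\<^sub>0) * \<psi> n (\<Phi> \<omega>)) \<in> borel_measurable M"
        using E(1) unfolding ev by simp
      show "AE \<omega> in M. \<psi> n (\<Phi> \<omega>) = of_bool (W 0 \<omega> = x\<^sub>0) * \<psi> n (\<Phi> \<omega>)"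
        using start by eventually_elim simp
    qed measurable
    also have "\<dots> = wedge_potential m (\<psi> n) 0 x\<^sub>0"
      using E(2) unfolding ev by simp
    also have "\<dots> = (\<Sum>k<m. LINT p|lborel. \<psi> n p * poisson_kernel (rotate (image_angle m k) x\<^sub>0) p)"
      by (simp add: wedge_potential_def layer_potential_def)
    also have "\<dots> = (LINT p|lborel. \<psi> n p * exit_density m p)"
      using \<psi>.integrable_layer [of 0]
      by (simp add: exit_density_def sum_distrib_left Bochner_Integration.integral_sum)
    finally show ?thesis .
  qed
  have "(\<lambda>n. expectation (\<lambda>\<omega>. \<psi> n (\<Phi> \<omega>))) \<longlonglongrightarrow> expectation (\<lambda>\<omega>. indicat_real U (\<Phi> \<omega>))"
    by (rule integral_dominated_convergence [where w = "\<lambda>_. 1"]) (use \<psi>_b \<psi>_lim in auto)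
  moreover have "(\<lambda>n. LINT p|lborel. \<psi> n p * exit_density m p) \<longlonglongrightarrow> (LINT p|lborel. indicator U p * exit_density m p)"
  proof (rule integral_dominated_convergence [where w = "\<lambda>p. \<bar>exit_density m p\<bar>"])
    have [measurable]: "exit_density m \<in> borel_measurable borel"
      using borel_measurable_integrable [OF integrable_exit_density] by simp
    show "(\<lambda>p. indicator U p * exit_density m p) \<in> borel_measurable lborel"
      "(\<lambda>p. \<psi> n p * exit_density m p) \<in> borel_measurable lborel" for n
      by measurable
    show "integrable lborel (\<lambda>p. \<bar>exit_density m p\<bar>)"
      using integrable_exit_density by simp
    show "AE p in lborel. (\<lambda>n. \<psi> n p * exit_density m p) \<longlonglongrightarrow> indicator U p * exit_density m p"
      by (intro AE_I2 tendsto_intros \<psi>_lim)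
    show "AE p in lborel. norm (\<psi> n p * exit_density m p) \<le> \<bar>exit_density m p\<bar>" for n
      using \<psi>_b by (intro AE_I2) (simp add: abs_mult mult_left_le_one_le)
  qed
  ultimately have "expectation (\<lambda>\<omega>. indicat_real U (\<Phi> \<omega>)) = (LINT p|lborel. indicator U p * exit_density m p)"
    unfolding main using LIMSEQ_unique by blast
  moreover have "expectation (\<lambda>\<omega>. indicat_real U (\<Phi> \<omega>)) = prob (\<Phi> -` U \<inter> space M)"
  proof -
    have "expectation (\<lambda>\<omega>. indicat_real U (\<Phi> \<omega>)) = expectation (indicat_real (\<Phi> -` U \<inter> space M))"
      by (intro Bochner_Integration.integral_cong) (auto simp: indicator_def)
    then show ?thesis by simp
  qed
  ultimately show ?thesis
    by (simp add: set_lebesgue_integral_def)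
qed

text \<open>Nonnegativity of the density is not established, so the right-hand side is treated as a
  signed set function: the identity is extended from the open sets, an intersection-stable
  generator, through complements and disjoint unions.\<close>

lemma prob_exit_pair:
  assumes m: "1 \<le> m" and x\<^sub>0: "0 < wedge_margin m x\<^sub>0" and A: "A \<in> sets borel"
  defines "\<Phi> \<equiv> exit_pair W (hitting_time W (wedge_boundary 0 (pi / real m)))"
    and "Q \<equiv> {0<..} \<times> {0<..}"
  shows "prob (\<Phi> -` (A \<inter> Q) \<inter> space M) = (LINT p:A \<inter> Q|lborel. exit_density m p)"
proof -
  have [measurable]: "\<Phi> \<in> M \<rightarrow>\<^sub>M borel"
    unfolding \<Phi>_def by (rule measurable_exit_pair [OF m])
  have Q_open: "open Q" unfolding Q_def by (intro open_Times) auto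
  then have [measurable]: "Q \<in> sets borel" by simp
  have set: "set_integrable lborel B (exit_density m)" if "B \<in> sets borel" for B
    using that integrable_exit_density unfolding set_integrable_def
    by (intro integrable_mult_indicator) simp_all
  have op: "prob (\<Phi> -` (U \<inter> Q) \<inter> space M) = (LINT p:U \<inter> Q|lborel. exit_density m p)" if "open U" for U
    unfolding \<Phi>_def by (rule prob_exit_pair_open [OF m x\<^sub>0]) (use that Q_open in \<open>auto simp: Q_def\<close>)
  have "Int_stable (Collect open :: (real \<times> real) set set)"
    by (auto simp: Int_stable_def)
  moreover have "(Collect open :: (real \<times> real) set set) \<subseteq> Pow UNIV" by simp
  moreover have "A \<in> sigma_sets UNIV (Collect open)"
    using A by (simp add: sets_borel)
  ultimately show ?thesis
  proof (induction A rule: sigma_sets_induct_disjoint)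
    case (basic U)
    then show ?case by (intro op) simp
  next
    case empty
    show ?case by (simp add: set_lebesgue_integral_def)
  next
    case (compl A)
    then have [measurable]: "A \<in> sets borel" by (simp add: sets_borel)
    have eq: "\<Phi> -` ((UNIV - A) \<inter> Q) \<inter> space M = (\<Phi> -` (UNIV \<inter> Q) \<inter> space M) - (\<Phi> -` (A \<inter> Q) \<inter> space M)"
      by auto
    have "prob (\<Phi> -` ((UNIV - A) \<inter> Q) \<inter> space M) = prob (\<Phi> -` (UNIV \<inter> Q) \<inter> space M) - prob (\<Phi> -` (A \<inter> Q) \<inter> space M)"
      unfolding eq by (rule finite_measure_Diff) auto
    also have "\<dots> = (LINT p:UNIV \<inter> Q|lborel. exit_density m p) - (LINT p:A \<inter> Q|lborel. exit_density m p)"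
      using op [OF open_UNIV] compl.IH by simp
    also have "(LINT p:UNIV \<inter> Q|lborel. exit_density m p) =
        (LINT p:(UNIV - A) \<inter> Q|lborel. exit_density m p) + (LINT p:A \<inter> Q|lborel. exit_density m p)"
    proof -
      have "UNIV \<inter> Q = (UNIV - A) \<inter> Q \<union> (A \<inter> Q)" by auto
      then show ?thesis
        by (simp only:) (rule set_integral_Un, auto intro!: set)
    qed
    finally show ?case by simp
  next
    case (union A)
    then have A_m [measurable]: "A i \<in> sets borel" for i by (simp add: sets_borel subset_eq image_iff)
    have "A i \<inter> A j = {}" if "i \<noteq> j" for i j
      using union(1) that by (auto simp: disjoint_family_on_def)
    then have disj: "disjoint_family (\<lambda>i. A i \<inter> Q)" "disjoint_family (\<lambda>i. \<Phi> -` (A i \<inter> Q) \<inter> space M)"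
      unfolding disjoint_family_on_def by blast+
    have "(\<lambda>i. prob (\<Phi> -` (A i \<inter> Q) \<inter> space M)) sums prob (\<Union>i. \<Phi> -` (A i \<inter> Q) \<inter> space M)"
      by (rule finite_measure_UNION) (use disj in auto)
    then have "prob (\<Union>i. \<Phi> -` (A i \<inter> Q) \<inter> space M) = (\<Sum>i. LINT p:A i \<inter> Q|lborel. exit_density m p)"
      unfolding union.IH by (rule sums_unique)
    also have "\<dots> = (LINT p:(\<Union>i. A i \<inter> Q)|lborel. exit_density m p)"
      by (rule lebesgue_integral_countable_add [symmetric]) (use disj in \<open>auto intro!: set simp: disjoint_family_on_def\<close>)
    also have "(\<Union>i. A i \<inter> Q) = \<Union> (range A) \<inter> Q" by auto
    also have "(\<Union>i. \<Phi> -` (A i \<inter> Q) \<inter> space M) = \<Phi> -` (\<Union> (range A) \<inter> Q) \<inter> space M" by auto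
    finally show ?case .
  qed
qed

theorem has_joint_density_interior:
  assumes m: "1 \<le> m" and x\<^sub>0: "0 < wedge_margin m x\<^sub>0"
  shows "has_joint_density_on_ray M W (hitting_time W (wedge_boundary 0 (pi / real m))) 0
    (\<lambda>t r. exit_density m (t, r))"
  unfolding has_joint_density_on_ray_def Let_def
proof (intro conjI ballI impI)
  have "({0<..} \<times> {0<..} :: (real \<times> real) set) \<in> sets borel"
    by (intro borel_open open_Times) auto
  then show "set_integrable lborel ({0<..} \<times> {0<..}) (\<lambda>(t, r). exit_density m (t, r))"
    using integrable_exit_density unfolding set_integrable_def
    by (intro integrable_mult_indicator) simp_all
  fix B :: "(real \<times> real) set"
  assume B [measurable]: "B \<in> sets borel" and BQ: "B \<subseteq> {0<..} \<times> {0<..}"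
  let ?\<tau> = "hitting_time W (wedge_boundary 0 (pi / real m))"
  have eq: "{\<omega> \<in> space M. \<exists>(t, r)\<in>B. ?\<tau> \<omega> = ereal t \<and> W t \<omega> = polar r 0} = exit_pair W ?\<tau> -` B \<inter> space M"
    using exit_pair_event [where \<tau> = ?\<tau> and X = W, OF hitting_time_nonneg BQ] by auto
  have BQ': "B \<inter> {0<..} \<times> {0<..} = B" using BQ by auto
  show "{\<omega> \<in> space M. \<exists>(t, r)\<in>B. ?\<tau> \<omega> = ereal t \<and> W t \<omega> = polar r 0} \<in> sets M"
    unfolding eq using measurable_exit_pair [OF m] by measurable
  show "prob {\<omega> \<in> space M. \<exists>(t, r)\<in>B. ?\<tau> \<omega> = ereal t \<and> W t \<omega> = polar r 0} =
      (LINT p:B|lborel. case p of (t, r) \<Rightarrow> exit_density m (t, r))"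
    unfolding eq using prob_exit_pair [OF m x\<^sub>0 B] by (simp add: BQ')
qed

end

subsection \<open>Starting points on the boundary\<close>

definition sup_box :: "real \<times> real \<Rightarrow> real \<Rightarrow> (real \<times> real) set" where
  "sup_box p e = {y. \<bar>fst y - fst p\<bar> < e \<and> \<bar>snd y - snd p\<bar> < e}"

lemma open_sup_box: "open (sup_box p e)"
  unfolding sup_box_def by (intro open_Collect_conj open_Collect_less continuous_intros)

lemma sup_box_subset_ball: "sup_box p (e / 2) \<subseteq> ball p e"
proof
  fix y assume "y \<in> sup_box p (e / 2)"
  then have "\<bar>fst p - fst y\<bar> < e / 2" "\<bar>snd p - snd y\<bar> < e / 2"
    by (simp_all add: sup_box_def abs_minus_commute)
  then have "\<bar>fst p - fst y\<bar> + \<bar>snd p - snd y\<bar> < e"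
    by linarith
  moreover have "dist p y \<le> \<bar>fst p - fst y\<bar> + \<bar>snd p - snd y\<bar>"
    unfolding dist_prod_def dist_real_def by (rule sqrt_sum_squares_le_sum_abs [THEN order_trans]) simp
  ultimately show "y \<in> ball p e" by simp
qed

abbreviation gaussian :: "(real \<times> real) measure" where
  "gaussian \<equiv> density lborel (\<lambda>y. ennreal (heat 1 y))"

text \<open>Brownian scaling at a single time: the substitution \<open>y = sqrt v * x\<close> has
  Jacobian \<open>v\<close> in the plane and turns \<open>heat v\<close> into
  \<open>heat 1\<close>.\<close>

lemma emeasure_heat_scale:
  assumes v: "0 < v" and [measurable]: "A \<in> sets borel"
  shows "emeasure (density lborel (\<lambda>y. ennreal (heat v y))) {y. (1 / sqrt v) *\<^sub>R y \<in> A} = emeasure gaussian A"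
proof -
  let ?f = "\<lambda>y. ennreal (heat v y) * indicator {y. (1 / sqrt v) *\<^sub>R y \<in> A} y"
  have [measurable]: "{y. (1 / sqrt v) *\<^sub>R y \<in> A} \<in> sets borel"
    by measurable
  have "emeasure (density lborel (\<lambda>y. ennreal (heat v y))) {y. (1 / sqrt v) *\<^sub>R y \<in> A} = (\<integral>\<^sup>+y. ?f y \<partial>lborel)"
    by (simp add: emeasure_density)
  also have "\<dots> = (\<integral>\<^sup>+y. ?f y \<partial>density (distr lborel borel (\<lambda>x. 0 + sqrt v *\<^sub>R x)) (\<lambda>_. \<bar>sqrt v\<bar> ^ DIM(real \<times> real)))"
    using v by (subst lborel_affine [of "sqrt v" 0]) simp_all
  also have "\<dots> = (\<integral>\<^sup>+y. ennreal v * ?f (sqrt v *\<^sub>R y) \<partial>lborel)"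
    using v by (simp add: nn_integral_density nn_integral_distr)
  also have "\<dots> = (\<integral>\<^sup>+y. ennreal (heat 1 y) * indicator A y \<partial>lborel)"
  proof (rule nn_integral_cong)
    fix y
    have "v * heat v (sqrt v *\<^sub>R y) = heat 1 y"
      using v by (simp add: heat_eq power_mult_distrib distrib_left [symmetric] del: minus_add_distrib)
    then have "ennreal v * ennreal (heat v (sqrt v *\<^sub>R y)) = ennreal (heat 1 y)"
      using v by (simp add: ennreal_mult [symmetric])
    then show "ennreal v * ?f (sqrt v *\<^sub>R y) = ennreal (heat 1 y) * indicator A y"
      using v by (simp add: mult.assoc [symmetric] indicator_def)
  qed
  finally show ?thesis
    by (simp add: emeasure_density)
qed

interpretation gaussian: prob_space gaussian
  by (rule prob_space_heat) simp

lemma gaussian_sup_box_pos: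
  assumes "0 < e"
  shows "0 < gaussian.prob (sup_box p e)"
proof (rule ccontr)
  assume "\<not> 0 < gaussian.prob (sup_box p e)"
  then have "gaussian.prob (sup_box p e) = 0"
    by (simp add: zero_less_measure_iff)
  then have "emeasure gaussian (sup_box p e) = 0"
    by (simp add: gaussian.emeasure_eq_measure)
  then have "(\<integral>\<^sup>+y. ennreal (heat 1 y) * indicator (sup_box p e) y \<partial>lborel) = 0"
    using open_sup_box [of p e] by (simp add: emeasure_density)
  then have "AE y in lborel. ennreal (heat 1 y) * indicator (sup_box p e) y = 0"
    using open_sup_box [of p e] by (subst (asm) nn_integral_0_iff_AE) simp_all
  then have "AE y in lborel. y \<notin> sup_box p e"
    by eventually_elim (auto simp: heat_eq indicator_def)
  then have "emeasure lborel (sup_box p e) = 0"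
    using open_sup_box [of p e] by (subst (asm) AE_iff_measurable [OF _ refl]) auto
  moreover have "sup_box p e = box (p - (e, e)) (p + (e, e))"
    by (auto simp: sup_box_def box_def Basis_prod_def inner_prod_def)
  ultimately show False
    using assms by (simp add: emeasure_lborel_box_eq Basis_prod_def inner_prod_def)
qed

lemma gaussian_tail:
  assumes "0 < e"
  shows "(\<lambda>n. gaussian.prob (- sup_box 0 (e * sqrt (real n)))) \<longlonglongrightarrow> 0"
proof -
  let ?A = "\<lambda>n. - sup_box 0 (e * sqrt (real n))"
  have sets: "?A n \<in> sets borel" for n
    using open_sup_box by simp
  have "(\<lambda>n. gaussian.prob (?A n)) \<longlonglongrightarrow> gaussian.prob (\<Inter>n. ?A n)"
  proof (rule gaussian.finite_Lim_measure_decseq)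
    show "decseq ?A"
    proof (rule decseq_SucI)
      fix n
      have "e * sqrt (real n) \<le> e * sqrt (real (Suc n))"
        using assms by (intro mult_left_mono) simp_all
      then show "?A (Suc n) \<subseteq> ?A n"
        by (auto simp: sup_box_def)
    qed
  qed (use sets in auto)
  moreover have "(\<Inter>n. ?A n) = {}"
  proof -
    have "\<exists>n. y \<in> sup_box 0 (e * sqrt (real n))" for y
    proof -
      obtain n where n: "((\<bar>fst y\<bar> + \<bar>snd y\<bar> + 1) / e)\<^sup>2 < real n"
        using reals_Archimedean2 by blast
      then have "(\<bar>fst y\<bar> + \<bar>snd y\<bar> + 1) / e < sqrt (real n)"
        by (rule real_less_rsqrt)
      then have "\<bar>fst y\<bar> + \<bar>snd y\<bar> + 1 < e * sqrt (real n)"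
        using assms by (simp add: field_simps)
      then have "\<bar>fst y\<bar> < e * sqrt (real n)" "\<bar>snd y\<bar> < e * sqrt (real n)"
        using abs_ge_zero [of "fst y"] abs_ge_zero [of "snd y"] by linarith+
      then show ?thesis
        by (intro exI [of _ n]) (simp add: sup_box_def)
    qed
    then show ?thesis by blast
  qed
  ultimately show ?thesis by simp
qed

context planar_brownian_motion begin

lemma prob_scaled_increment:
  assumes st: "0 \<le> s" "s < t" and A: "A \<in> sets borel"
  shows "prob {\<omega> \<in> space M. (1 / sqrt (t - s)) *\<^sub>R (W t \<omega> - W s \<omega>) \<in> A} = gaussian.prob A"
proof -
  have [measurable]: "(\<lambda>\<omega>. W t \<omega> - W s \<omega>) \<in> M \<rightarrow>\<^sub>M borel"
    using st random_variable_W by (intro borel_measurable_diff) auto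
  have [measurable]: "{y. (1 / sqrt (t - s)) *\<^sub>R y \<in> A} \<in> sets borel"
    using A by measurable
  have "emeasure M {\<omega> \<in> space M. (1 / sqrt (t - s)) *\<^sub>R (W t \<omega> - W s \<omega>) \<in> A} =
      emeasure (distr M borel (\<lambda>\<omega>. W t \<omega> - W s \<omega>)) {y. (1 / sqrt (t - s)) *\<^sub>R y \<in> A}"
    by (subst emeasure_distr) (auto intro!: arg_cong [where f = "emeasure M"])
  also have "\<dots> = emeasure gaussian A"
    unfolding increment_distr [OF st] using st A by (intro emeasure_heat_scale) auto
  finally show ?thesis
    by (simp add: measure_def)
qed

text \<open>Along geometric times with a large ratio each increment dominates all that came before.
  The rescaled increments are independent and fall near \<open>p\<close> with the same probability
  \<open>\<rho>\<close>, so all \<open>n\<close> of them miss with probability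
  \<open>(1 - \<rho>) ^ n\<close>. If one hits and the past is small on its scale, the path is in
  the cone. The ratio goes to infinity for fixed \<open>n\<close>, and then \<open>n\<close>
  does.\<close>

lemma visits_cone:
  assumes C: "open C" "p \<in> C" and cone: "\<And>c y. 0 < c \<Longrightarrow> y \<in> C \<Longrightarrow> c *\<^sub>R y \<in> C" and s: "0 < s"
  shows "AE \<omega> in M. \<exists>t. 0 < t \<and> t \<le> s \<and> W t \<omega> - W 0 \<omega> \<in> C"
proof -
  obtain e where e: "0 < e" "ball p e \<subseteq> C"
    using C openE by blast
  \<comment> \<open>\<open>sup_box p (e / 2)\<close> lies in the ball; half of \<open>e / 2\<close>
    is reserved for the increment and half for the past.\<close>
  define \<eta> where "\<eta> = e / 4"
  have \<eta>: "0 < \<eta>" using e by (simp add: \<eta>_def)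
  have box: "sup_box p (2 * \<eta>) \<subseteq> C"
    using sup_box_subset_ball [of p e] e(2) by (simp add: \<eta>_def)
  \<comment> \<open>The times increase with \<open>j\<close> and end at \<open>s\<close> for
    \<open>j = n\<close>. The ratio \<open>K + 2\<close> makes the variance of the next increment
    \<open>K + 1\<close> times the time already passed.\<close>
  define T where "T n K j = s * (1 / (real K + 2)) ^ (n - j)" for n K j :: nat
  have T_pos: "0 < T n K j" for n K j
    using s by (simp add: T_def)
  have T_le: "T n K j \<le> s" for n K j
    using s by (simp add: T_def power_le_one mult_left_le)
  have T_Suc: "T n K (Suc j) = T n K j * (real K + 2)" if "j < n" for n K j
  proof -
    have "n - j = Suc (n - Suc j)" using that by simp
    then show ?thesis by (simp add: T_def)
  qed
  define bad where "bad = {\<omega> \<in> space M. \<forall>n K j. j < n \<longrightarrow> W (T n K (Suc j)) \<omega> - W 0 \<omega> \<notin> C}"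
  have W_m [measurable]: "W (T n K j) \<in> M \<rightarrow>\<^sub>M borel" for n K j
    by (rule random_variable_W) (rule less_imp_le [OF T_pos])
  have W0_m [measurable]: "W 0 \<in> M \<rightarrow>\<^sub>M borel"
    by (rule random_variable_W) simp
  have [measurable]: "C \<in> sets borel" using C(1) by simp
  have bad_m [measurable]: "bad \<in> sets M"
    unfolding bad_def by measurable
  define \<rho> where "\<rho> = gaussian.prob (sup_box p \<eta>)"
  have \<rho>: "0 < \<rho>" "\<rho> \<le> 1"
    using gaussian_sup_box_pos [OF \<eta>] by (simp_all add: \<rho>_def)
  have bound: "prob bad \<le> (1 - \<rho>) ^ n + real n * gaussian.prob (- sup_box 0 (\<eta> * sqrt (real (Suc K))))"
    if n: "0 < n" for n K
  proof -
    let ?T = "T n K"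
    let ?v = "\<lambda>j. ?T (Suc j) - ?T j"
    \<comment> \<open>On \<open>X\<close> no rescaled increment falls near \<open>p\<close>. On
      \<open>Y j\<close> the past before step \<open>j\<close> is too large:
      \<open>sqrt (Suc K)\<close> is the ratio between the scale of the increment and that of the
      past.\<close>
    define X where "X = {\<omega> \<in> space M. \<forall>j<n. (1 / sqrt (?v j)) *\<^sub>R (W (?T (Suc j)) \<omega> - W (?T j) \<omega>) \<in> - sup_box p \<eta>}"
    define Y where "Y j = {\<omega> \<in> space M. (1 / sqrt (?T j - 0)) *\<^sub>R (W (?T j) \<omega> - W 0 \<omega>) \<in> - sup_box 0 (\<eta> * sqrt (real (Suc K)))}" for j
    have box_m [measurable]: "sup_box q r \<in> sets borel" for q r
      using open_sup_box by simp
    have v: "?v j = ?T j * real (Suc K)" "0 < ?v j" if "j < n" for j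
      using T_Suc [OF that, of K] T_pos [of n K j] by (simp_all add: algebra_simps add_pos_nonneg)
    have X_m [measurable]: "X \<in> sets M"
      unfolding X_def by measurable
    have Y_m [measurable]: "Y j \<in> sets M" for j
      unfolding Y_def by measurable
    have "bad \<subseteq> X \<union> (\<Union>j<n. Y j)"
    proof
      fix \<omega> assume \<omega>: "\<omega> \<in> bad"
      show "\<omega> \<in> X \<union> (\<Union>j<n. Y j)"
      proof (rule ccontr)
        assume not: "\<omega> \<notin> X \<union> (\<Union>j<n. Y j)"
        have sp: "\<omega> \<in> space M" using \<omega> by (simp add: bad_def)
        with not obtain j where j: "j < n"
          and a: "(1 / sqrt (?v j)) *\<^sub>R (W (?T (Suc j)) \<omega> - W (?T j) \<omega>) \<in> sup_box p \<eta>"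
          by (auto simp: X_def)
        from not sp j have b: "(1 / sqrt (?T j)) *\<^sub>R (W (?T j) \<omega> - W 0 \<omega>) \<in> sup_box 0 (\<eta> * sqrt (real (Suc K)))"
          by (auto simp: Y_def)
        let ?k = "sqrt (real (Suc K))"
        have k: "0 < ?k" by simp
        have sv: "sqrt (?v j) = sqrt (?T j) * ?k"
          unfolding v(1) [OF j] by (simp only: real_sqrt_mult)
        have small: "(1 / sqrt (?v j)) *\<^sub>R (W (?T j) \<omega> - W 0 \<omega>) \<in> sup_box 0 \<eta>"
        proof -
          let ?z = "(1 / sqrt (?T j)) *\<^sub>R (W (?T j) \<omega> - W 0 \<omega>)"
          have "(1 / sqrt (?v j)) *\<^sub>R (W (?T j) \<omega> - W 0 \<omega>) = (1 / ?k) *\<^sub>R ?z"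
            unfolding sv by simp
          moreover have "\<bar>fst ?z\<bar> < \<eta> * ?k" "\<bar>snd ?z\<bar> < \<eta> * ?k"
            using b by (simp_all only: sup_box_def mem_Collect_eq fst_zero snd_zero diff_zero)
          then have "(1 / ?k) *\<^sub>R ?z \<in> sup_box 0 \<eta>"
            using k by (simp only: sup_box_def mem_Collect_eq fst_zero snd_zero diff_zero fst_scaleR snd_scaleR real_scaleR_def
                abs_mult abs_divide abs_one abs_of_pos) (simp only: pos_divide_less_eq times_divide_eq_left mult_1)
          ultimately show ?thesis by (simp only:)
        qed
        have sum: "(1 / sqrt (?v j)) *\<^sub>R (W (?T (Suc j)) \<omega> - W 0 \<omega>) =
            (1 / sqrt (?v j)) *\<^sub>R (W (?T (Suc j)) \<omega> - W (?T j) \<omega>) + (1 / sqrt (?v j)) *\<^sub>R (W (?T j) \<omega> - W 0 \<omega>)"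
          by (simp add: scaleR_right_distrib [symmetric])
        have add_box: "y + z \<in> sup_box p (2 * \<eta>)" if "y \<in> sup_box p \<eta>" "z \<in> sup_box 0 \<eta>" for y z
          using that by (auto simp: sup_box_def)
        have "(1 / sqrt (?v j)) *\<^sub>R (W (?T (Suc j)) \<omega> - W 0 \<omega>) \<in> C"
          unfolding sum using add_box [OF a small] box by blast
        from cone [OF _ this, of "sqrt (?v j)"] v(2) [OF j]
        have "W (?T (Suc j)) \<omega> - W 0 \<omega> \<in> C" by simp
        with \<omega> j show False by (auto simp: bad_def)
      qed
    qed
    then have "prob bad \<le> prob (X \<union> (\<Union>j<n. Y j))"
      by (rule finite_measure_mono) measurable
    also have "\<dots> \<le> prob X + prob (\<Union>j<n. Y j)"
      by (rule measure_Un_le) measurable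
    also have "prob (\<Union>j<n. Y j) \<le> (\<Sum>j<n. prob (Y j))"
      by (rule measure_UNION_le) auto
    also have "\<dots> = real n * gaussian.prob (- sup_box 0 (\<eta> * sqrt (real (Suc K))))"
      unfolding Y_def using T_pos by (subst prob_scaled_increment) (auto simp: T_pos)
    also have "prob X = (1 - \<rho>) ^ n"
    proof -
      define \<xi> where "\<xi> j \<omega> = W (?T (Suc j)) \<omega> - W (?T j) \<omega>" for j \<omega>
      define A where "A j = {y. (1 / sqrt (?v j)) *\<^sub>R y \<in> - sup_box p \<eta>}" for j
      have A_m: "A j \<in> sets borel" for j
        unfolding A_def by measurable
      have ind: "indep_vars (\<lambda>_. borel) \<xi> {..<n}"
        unfolding \<xi>_def by (rule independent_increments) (use T_pos [of n K] v(2) in \<open>auto intro: less_imp_le\<close>)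
      have "X = (\<Inter>j\<in>{..<n}. \<xi> j -` A j \<inter> space M)"
        using n by (auto simp: X_def \<xi>_def A_def)
      also have "prob \<dots> = (\<Prod>j\<in>{..<n}. prob (\<xi> j -` A j \<inter> space M))"
        by (rule indep_varsD [OF ind]) (use n A_m in auto)
      also have "\<dots> = (\<Prod>j\<in>{..<n}. 1 - \<rho>)"
      proof (rule prod.cong [OF refl])
        fix j assume "j \<in> {..<n}"
        then have j: "j < n" by simp
        have "\<xi> j -` A j \<inter> space M = {\<omega> \<in> space M. (1 / sqrt (?v j)) *\<^sub>R (W (?T (Suc j)) \<omega> - W (?T j) \<omega>) \<in> - sup_box p \<eta>}"
          by (auto simp: \<xi>_def A_def)
        also have "prob \<dots> = gaussian.prob (- sup_box p \<eta>)"
          using v(2) [OF j] T_pos [of n K j] by (intro prob_scaled_increment) auto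
        also have "\<dots> = 1 - \<rho>"
          unfolding \<rho>_def by (subst gaussian.prob_compl [symmetric]) (auto simp: Compl_eq_Diff_UNIV)
        finally show "prob (\<xi> j -` A j \<inter> space M) = 1 - \<rho>" .
      qed
      finally show ?thesis by simp
    qed
    finally show ?thesis by simp
  qed
  have "prob bad \<le> (1 - \<rho>) ^ n" if n: "0 < n" for n
  proof -
    have "(\<lambda>K. (1 - \<rho>) ^ n + real n * gaussian.prob (- sup_box 0 (\<eta> * sqrt (real (Suc K))))) \<longlonglongrightarrow> (1 - \<rho>) ^ n + real n * 0"
      by (intro tendsto_intros LIMSEQ_Suc [OF gaussian_tail [OF \<eta>]])
    then show ?thesis
      using LIMSEQ_le_const [of _ "(1 - \<rho>) ^ n + real n * 0" "prob bad"] bound [OF n] by auto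
  qed
  then have "prob bad \<le> (1 - \<rho>) ^ Suc n" for n by blast
  moreover have "(\<lambda>n. (1 - \<rho>) ^ Suc n) \<longlonglongrightarrow> 0"
    using \<rho> by (intro LIMSEQ_Suc LIMSEQ_realpow_zero) auto
  ultimately have "prob bad \<le> 0"
    by (intro LIMSEQ_le_const) auto
  then have "prob bad = 0"
    using measure_nonneg [of M bad] by linarith
  then have "bad \<in> null_sets M"
    by (simp add: null_sets_def emeasure_eq_measure)
  then show ?thesis
  proof (rule AE_I')
    show "{\<omega> \<in> space M. \<not> (\<exists>t. 0 < t \<and> t \<le> s \<and> W t \<omega> - W 0 \<omega> \<in> C)} \<subseteq> bad"
      using T_pos T_le by (auto simp: bad_def)
  qed
qed

end

lemma wedge_margin_scaleR: "0 < c \<Longrightarrow> wedge_margin m (c *\<^sub>R x) = c * wedge_margin m x"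
  by (simp add: wedge_margin_def min_mult_distrib_left algebra_simps)

context planar_brownian_motion begin

text \<open>Superadditivity of the margin turns a displacement into the cone into an interior
  position, and a linear form turns one into a half-plane into an exterior position. The
  intermediate value theorem gives a zero of the margin between the two visits, which can be
  arbitrarily early.\<close>

lemma immediate_exit:
  assumes m: "1 \<le> m" and x\<^sub>0: "wedge_margin m x\<^sub>0 = 0"
  shows "AE \<omega> in M. hitting_time W (wedge_boundary 0 (pi / real m)) \<omega> = 0"
proof -
  define p where "p = polar 1 (pi / (2 * real m))"
  have p_angle: "0 < pi / (2 * real m)" "pi / (2 * real m) < pi / real m"
    using m by (simp_all add: field_simps)
  have p_in: "0 < wedge_margin m p"
    unfolding p_def using m p_angle by (intro wedge_margin_pos) auto
  \<comment> \<open>\<open>L\<close> is the linear form of a bounding line through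
    \<open>x\<^sub>0\<close>. It dominates the margin, so \<open>L < 0\<close> means outside, and it
    vanishes at \<open>x\<^sub>0\<close>, so only the displacement matters.\<close>
  have "\<exists>L. (\<forall>x y. L (x + y) = L x + (L y :: real)) \<and> (\<forall>c y. L (c *\<^sub>R y) = c * L y) \<and>
      continuous_on UNIV L \<and> (\<forall>x. wedge_margin m x \<le> L x) \<and> L x\<^sub>0 = 0"
  proof (cases "snd x\<^sub>0 = 0")
    case True
    then show ?thesis
      by (intro exI [of _ snd]) (auto simp: wedge_margin_def intro!: continuous_intros)
  next
    case False
    then have "fst x\<^sub>0 * sin (pi / real m) - snd x\<^sub>0 * cos (pi / real m) = 0"
      using x\<^sub>0 by (auto simp: wedge_margin_def min_def split: if_splits)
    then show ?thesis
      by (intro exI [of _ "\<lambda>x. fst x * sin (pi / real m) - snd x * cos (pi / real m)"])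
         (auto simp: wedge_margin_def algebra_simps intro!: continuous_intros)
  qed
  then obtain L where L: "\<And>x y. L (x + y) = L x + (L y :: real)" "\<And>c y. L (c *\<^sub>R y) = c * L y"
      "continuous_on UNIV L" "\<And>x. wedge_margin m x \<le> L x" "L x\<^sub>0 = 0"
    by blast
  have L_p: "L (- p) < 0"
    using L(2) [of "- 1" p] L(4) [of p] p_in by simp
  have inside: "AE \<omega> in M. \<exists>t. 0 < t \<and> t \<le> 1 / real (Suc n) \<and> W t \<omega> - W 0 \<omega> \<in> {x. 0 < wedge_margin m x}" for n
  proof (rule visits_cone [of _ p])
    show "open {x. 0 < wedge_margin m x}"
      by (intro open_Collect_less continuous_intros)
  qed (use p_in in \<open>auto simp: wedge_margin_scaleR\<close>)
  have outside: "AE \<omega> in M. \<exists>t. 0 < t \<and> t \<le> 1 / real (Suc n) \<and> W t \<omega> - W 0 \<omega> \<in> {x. L x < 0}" for n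
  proof (rule visits_cone [of _ "- p"])
    show "open {x. L x < 0}"
      by (intro open_Collect_less continuous_intros L(3))
  qed (use L_p in \<open>auto simp: L(2) mult_pos_neg\<close>)
  have "AE \<omega> in M. \<forall>n. (\<exists>t. 0 < t \<and> t \<le> 1 / real (Suc n) \<and> W t \<omega> - W 0 \<omega> \<in> {x. 0 < wedge_margin m x})"
    unfolding AE_all_countable using inside by blast
  moreover have "AE \<omega> in M. \<forall>n. (\<exists>t. 0 < t \<and> t \<le> 1 / real (Suc n) \<and> W t \<omega> - W 0 \<omega> \<in> {x. L x < 0})"
    unfolding AE_all_countable using outside by blast
  ultimately show ?thesis
    using start AE_space
  proof eventually_elim
    case (elim \<omega>)
    let ?\<tau> = "hitting_time W (wedge_boundary 0 (pi / real m)) \<omega>"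
    have le: "?\<tau> \<le> ereal (1 / real (Suc n))" for n
    proof -
      obtain t where t: "0 < t" "t \<le> 1 / real (Suc n)" "0 < wedge_margin m (W t \<omega> - W 0 \<omega>)"
        using elim(1) by blast
      obtain u where u: "0 < u" "u \<le> 1 / real (Suc n)" "L (W u \<omega> - W 0 \<omega>) < 0"
        using elim(2) by blast
      have "0 < wedge_margin m (W t \<omega>)"
        using t(3) wedge_margin_add [of m x\<^sub>0 "W t \<omega> - W 0 \<omega>"] x\<^sub>0 elim(3) by simp
      moreover have "wedge_margin m (W u \<omega>) < 0"
        using u(3) L(4) [of "W u \<omega>"] L(1) [of x\<^sub>0 "W u \<omega> - W 0 \<omega>"] L(5) elim(3) by simp
      moreover have cont: "continuous_on {0..} (\<lambda>t. wedge_margin m (W t \<omega>))"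
        by (intro continuous_intros continuous_paths elim)
      ultimately obtain z where z: "min t u \<le> z" "z \<le> max t u" "wedge_margin m (W z \<omega>) = 0"
      proof (cases "t \<le> u")
        case True
        then have "continuous_on {t..u} (\<lambda>t. wedge_margin m (W t \<omega>))"
          using t by (intro continuous_on_subset [OF cont]) auto
        with True \<open>0 < wedge_margin m (W t \<omega>)\<close> \<open>wedge_margin m (W u \<omega>) < 0\<close> that show ?thesis
          using IVT2' [of "\<lambda>t. wedge_margin m (W t \<omega>)" u 0 t] by (auto simp: min_def max_def)
      next
        case False
        then have "continuous_on {u..t} (\<lambda>t. wedge_margin m (W t \<omega>))"
          using u by (intro continuous_on_subset [OF cont]) auto
        with False \<open>0 < wedge_margin m (W t \<omega>)\<close> \<open>wedge_margin m (W u \<omega>) < 0\<close> that show ?thesis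
          using IVT' [of "\<lambda>t. wedge_margin m (W t \<omega>)" u 0 t] by (auto simp: min_def max_def)
      qed
      have "?\<tau> \<le> ereal z"
        unfolding hitting_time_def using z t u by (intro INF_lower) (auto simp: mem_wedge_boundary_iff [OF m])
      also have "ereal z \<le> ereal (1 / real (Suc n))"
        using z t u by simp
      finally show ?thesis .
    qed
    have lim: "(\<lambda>n. ereal (1 / real (Suc n))) \<longlonglongrightarrow> ereal 0"
      by (intro tendsto_ereal LIMSEQ_Suc [OF lim_1_over_n])
    have "?\<tau> \<le> ereal 0"
      by (rule LIMSEQ_le_const [OF lim]) (use le in blast)
    then show ?case
      using hitting_time_nonneg [of W "wedge_boundary 0 (pi / real m)" \<omega>] by (simp add: zero_ereal_def)
  qed
qed

lemma exit_density_zero: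
  assumes m: "1 \<le> m" and x\<^sub>0: "wedge_margin m x\<^sub>0 = 0"
  shows "exit_density m p = 0"
proof -
  have refl: "poisson_kernel (polar r (2 * pi - \<theta>)) p = - poisson_kernel (polar r \<theta>) p" for r \<theta>
    by (simp add: polar_def cos_reflect_2pi sin_reflect_2pi poisson_kernel_uminus)
  from m x\<^sub>0 show ?thesis
  proof (cases rule: wedge_margin_zeroE)
    case (1 r)
    have "exit_density m p = (\<Sum>k<m. poisson_kernel (polar r (image_angle m k)) p)"
      unfolding exit_density_def by (simp add: 1 rotate_polar)
    also have "\<dots> = poisson_kernel (polar r (image_angle m 0)) p"
      by (rule sum_reflect_zero [OF _ m]) (simp add: image_angle_reflect refl)
    also have "\<dots> = 0"
      by (simp add: image_angle_def polar_def poisson_kernel_def hit_density_def)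
    finally show ?thesis .
  next
    case (2 r)
    have "exit_density m p = (\<Sum>k<m. poisson_kernel (polar r (pi / real m + image_angle m k)) p)"
      unfolding exit_density_def by (simp add: 2 rotate_polar)
    also have "\<dots> = 0"
      by (rule sum_reflect_zero') (simp add: image_angle_reflect' refl)
    finally show ?thesis .
  qed
qed

theorem has_joint_density_boundary:
  assumes m: "1 \<le> m" and x\<^sub>0: "wedge_margin m x\<^sub>0 = 0"
  shows "has_joint_density_on_ray M W (hitting_time W (wedge_boundary 0 (pi / real m))) 0
    (\<lambda>t r. exit_density m (t, r))"
  unfolding has_joint_density_on_ray_def Let_def exit_density_zero [OF assms]
proof (intro conjI ballI impI)
  show "set_integrable lborel ({0<..} \<times> {0<..}) (\<lambda>(t :: real, r :: real). 0 :: real)"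
    by (simp add: set_integrable_def case_prod_beta')
  fix B :: "(real \<times> real) set"
  assume B [measurable]: "B \<in> sets borel" and BQ: "B \<subseteq> {0<..} \<times> {0<..}"
  let ?\<tau> = "hitting_time W (wedge_boundary 0 (pi / real m))"
  let ?E = "{\<omega> \<in> space M. \<exists>(t, r)\<in>B. ?\<tau> \<omega> = ereal t \<and> W t \<omega> = polar r 0}"
  have eq: "?E = exit_pair W ?\<tau> -` B \<inter> space M"
    using exit_pair_event [where \<tau> = ?\<tau> and X = W, OF hitting_time_nonneg BQ] by auto
  show E_m: "?E \<in> sets M"
    unfolding eq using measurable_exit_pair [OF m] by measurable
  have "AE \<omega> in M. \<omega> \<notin> ?E"
    using immediate_exit [OF assms] by eventually_elim (use BQ in \<open>auto simp: zero_ereal_def\<close>)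
  then have "prob ?E = 0"
    using prob_eq_0 [OF E_m] by simp
  then show "prob ?E = (LINT p:B|lborel. case p of (t, r) \<Rightarrow> 0)"
    by (simp add: set_lebesgue_integral_def case_prod_beta')
qed

end

subsection \<open>Rotating and reflecting the wedge\<close>

lemma has_joint_density_on_ray_cong:
  assumes "has_joint_density_on_ray M W T a f"
    and eq: "\<And>t r. 0 < t \<Longrightarrow> 0 < r \<Longrightarrow> f t r = g t r"
  shows "has_joint_density_on_ray M W T a g"
proof -
  have eq': "(case p of (t, r) \<Rightarrow> f t r) = (case p of (t, r) \<Rightarrow> g t r)" if "p \<in> {0<..} \<times> {0<..}" for p
    using that eq by auto
  have "set_integrable lborel ({0<..} \<times> {0<..}) (\<lambda>(t, r). g t r)"
    using assms(1) unfolding has_joint_density_on_ray_def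
    by (subst set_integrable_cong [OF refl refl eq' [symmetric]]) simp_all
  moreover have "(LINT p:B|lborel. case p of (t, r) \<Rightarrow> f t r) = (LINT p:B|lborel. case p of (t, r) \<Rightarrow> g t r)"
    if "B \<in> sets borel" "B \<subseteq> {0<..} \<times> {0<..}" for B
    using that eq' by (intro set_lebesgue_integral_cong) auto
  ultimately show ?thesis
    using assms(1) unfolding has_joint_density_on_ray_def Let_def by simp
qed

context planar_brownian_motion begin

theorem has_joint_density_normalized:
  assumes "1 \<le> m" "0 \<le> r" "0 \<le> \<delta>" "\<delta> \<le> pi / real m" "x\<^sub>0 = polar r \<delta>"
  shows "has_joint_density_on_ray M W (hitting_time W (wedge_boundary 0 (pi / real m))) 0
    (\<lambda>t r. exit_density m (t, r))"
  using wedge_margin_polar_nonneg [OF assms(1-4)] has_joint_density_interior [OF assms(1)]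
    has_joint_density_boundary [OF assms(1)] assms(5)
  by (cases "wedge_margin m x\<^sub>0 = 0") auto

lemma orthogonal_image:
  fixes p q u w :: real
  defines "R \<equiv> \<lambda>x. (p * fst x + q * snd x, u * fst x + w * snd x)"
  assumes det: "\<bar>p * w - q * u\<bar> = 1"
    and orth: "\<And>a b. (p * a + q * b)\<^sup>2 + (u * a + w * b)\<^sup>2 = a\<^sup>2 + b\<^sup>2"
  shows "planar_brownian_motion M (\<lambda>t \<omega>. R (W t \<omega>)) (R x\<^sub>0)"
proof -
  have [measurable]: "R \<in> borel \<rightarrow>\<^sub>M borel"
    unfolding R_def by (simp add: borel_prod [symmetric])
  have diff: "R x - R y = R (x - y)" for x y
    by (simp add: R_def algebra_simps)
  show ?thesis
  proof unfold_locales
    show "random_variable borel (\<lambda>\<omega>. R (W t \<omega>))" if "0 \<le> t" for t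
      using random_variable_W [OF that] by measurable
    show "AE \<omega> in M. R (W 0 \<omega>) = R x\<^sub>0"
      using start by eventually_elim simp
    show "indep_vars (\<lambda>_. borel) (\<lambda>i \<omega>. R (W (t (Suc i)) \<omega>) - R (W (t i) \<omega>)) {..<n}"
      if "0 \<le> t 0" "\<And>i. i < n \<Longrightarrow> t i < t (Suc i)" for t :: "nat \<Rightarrow> real" and n
      unfolding diff using independent_increments [OF that]
      by (rule indep_vars_compose2 [where Y = "\<lambda>_. R"]) simp_all
    show "distributed M lborel (\<lambda>\<omega>. R (W t \<omega>) - R (W s \<omega>))
        (\<lambda>x. ennreal (\<Prod>b\<in>Basis. normal_density 0 (sqrt (t - s)) (x \<bullet> b)))" if st: "0 \<le> s" "s < t" for s t
      unfolding diff prod_Basis_heat distributed_def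
    proof (intro conjI)
      let ?\<xi> = "\<lambda>\<omega>. W t \<omega> - W s \<omega>"
      have \<xi> [measurable]: "?\<xi> \<in> M \<rightarrow>\<^sub>M borel"
        using st random_variable_W by (intro borel_measurable_diff) auto
      have heat_R: "heat (t - s) (R y) = heat (t - s) y" for y
        using st orth by (simp add: heat_eq R_def)
      have "distr M lborel (\<lambda>\<omega>. R (?\<xi> \<omega>)) = distr (distr M borel ?\<xi>) borel R"
        by (subst distr_distr) (simp_all add: o_def cong: distr_cong)
      also have "\<dots> = distr (density lborel (\<lambda>y. ennreal (heat (t - s) (R y)))) borel R"
        unfolding increment_distr [OF st] heat_R ..
      also have "\<dots> = density (distr lborel borel R) (\<lambda>y. ennreal (heat (t - s) y))"
        by (subst density_distr) simp_all
      also have "distr lborel borel R = lborel"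
        unfolding R_def by (rule lborel_distr_linear_pair [OF det])
      finally show "distr M lborel (\<lambda>\<omega>. R (?\<xi> \<omega>)) = density lborel (\<lambda>y. ennreal (heat (t - s) y))" .
    qed (use st random_variable_W in \<open>simp_all\<close>)
    show "continuous_on {0..} (\<lambda>t. R (W t \<omega>))" if "\<omega> \<in> space M" for \<omega>
      unfolding R_def by (intro continuous_intros continuous_paths that)
  qed
qed

end

text \<open>The law of cosines expands the squared distance in the heat kernel. With an image angle
  for \<open>\<gamma>\<close> this is one summand of the claimed density.\<close>

lemma poisson_kernel_polar:
  assumes "0 < t"
  shows "poisson_kernel (polar \<rho> \<gamma>) (t, r) =
    \<rho> / (2 * pi * t\<^sup>2) * exp (- (r\<^sup>2 + \<rho>\<^sup>2) / (2 * t)) * (sin \<gamma> * exp (r * \<rho> / t * cos \<gamma>))"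
proof -
  have "(\<rho> * cos \<gamma> - r)\<^sup>2 + (\<rho> * sin \<gamma>)\<^sup>2 = r\<^sup>2 + \<rho>\<^sup>2 * ((cos \<gamma>)\<^sup>2 + (sin \<gamma>)\<^sup>2) - 2 * (r * \<rho> * cos \<gamma>)"
    by algebra
  then have "(\<rho> * cos \<gamma> - r)\<^sup>2 + (\<rho> * sin \<gamma>)\<^sup>2 = r\<^sup>2 + \<rho>\<^sup>2 - 2 * (r * \<rho> * cos \<gamma>)"
    by simp
  then have e: "exp (- ((\<rho> * cos \<gamma> - r)\<^sup>2 + (\<rho> * sin \<gamma>)\<^sup>2) / (2 * t)) =
      exp (- (r\<^sup>2 + \<rho>\<^sup>2) / (2 * t)) * exp (r * \<rho> / t * cos \<gamma>)"
    using assms by (simp add: exp_add [symmetric] field_simps)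
  have "poisson_kernel (polar \<rho> \<gamma>) (t, r) = \<rho> * sin \<gamma> / t * heat t (\<rho> * cos \<gamma> - r, \<rho> * sin \<gamma>)"
    using assms by (simp add: poisson_kernel_def polar_def hit_density_def heat_def)
  moreover have "heat t (\<rho> * cos \<gamma> - r, \<rho> * sin \<gamma>) =
      1 / (2 * pi * t) * (exp (- (r\<^sup>2 + \<rho>\<^sup>2) / (2 * t)) * exp (r * \<rho> / t * cos \<gamma>))"
    by (simp only: heat_eq [OF assms] fst_conv snd_conv e)
  ultimately show ?thesis
    using assms by (simp add: power2_eq_square [of t] mult_ac)
qed

text \<open>Modulo \<open>2 * pi\<close> the image angles are closed under negation, with
  \<open>k\<close> corresponding to \<open>m - k\<close>. The formula for the lower ray subtracts
  them and is brought to the normal form in this way.\<close>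

lemma sum_image_angle_uminus:
  fixes g :: "real \<Rightarrow> real"
  assumes m: "1 \<le> m" and periodic: "\<And>x. g (x + 2 * pi) = g x"
  shows "(\<Sum>k<m. g (\<delta> - image_angle m k)) = (\<Sum>k<m. g (\<delta> + image_angle m k))"
proof -
  have "(\<Sum>k<m. g (\<delta> - image_angle m k) - g (\<delta> + image_angle m k)) =
      g (\<delta> - image_angle m 0) - g (\<delta> + image_angle m 0)"
  proof (rule sum_reflect_zero [OF _ m])
    fix k assume "0 < k" "k < m"
    then have a: "image_angle m (m - k) = 2 * pi - image_angle m k"
      by (intro image_angle_reflect) auto
    show "g (\<delta> - image_angle m (m - k)) - g (\<delta> + image_angle m (m - k)) =
        - (g (\<delta> - image_angle m k) - g (\<delta> + image_angle m k))"
      using periodic [of "\<delta> - 2 * pi + image_angle m k"] periodic [of "\<delta> - image_angle m k"]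
      unfolding a by (simp add: algebra_simps)
  qed
  then show ?thesis
    by (simp add: image_angle_def sum_subtractf)
qed

text \<open>\<open>R\<close> carries ray \<open>a\<close> to angle 0 and ray \<open>b\<close> to
  angle \<open>pi / m\<close>, so the hitting time is unchanged, and injectivity translates exit
  points back. The function \<open>g\<close> is the image sum for a start at angle
  \<open>\<delta>\<close> in the normal position.\<close>

lemma has_joint_density_on_ray_isometry:
  assumes W: "planar_brownian_motion M (\<lambda>t \<omega>. R (W t \<omega>)) (R x\<^sub>0)"
    and inj: "\<And>x y. R x = R y \<Longrightarrow> x = y" and a: "\<And>r. R (polar r a) = polar r 0"
    and b: "\<And>r. R (polar r b) = polar r (pi / real m)"
    and F: "F = ray a \<union> ray b" and x\<^sub>0: "R x\<^sub>0 = polar r\<^sub>0 \<delta>"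
    and m: "1 \<le> m" and r\<^sub>0: "0 \<le> r\<^sub>0" and \<delta>: "0 \<le> \<delta>" "\<delta> \<le> pi / real m"
    and g: "\<And>t r. g t r = r\<^sub>0 / (2 * pi * t\<^sup>2) * exp (- (r\<^sup>2 + r\<^sub>0\<^sup>2) / (2 * t)) *
      (\<Sum>k<m. sin (\<delta> + image_angle m k) * exp (r * r\<^sub>0 / t * cos (\<delta> + image_angle m k)))"
  shows "has_joint_density_on_ray M W (hitting_time W F) a g"
proof -
  interpret W: planar_brownian_motion M "\<lambda>t \<omega>. R (W t \<omega>)" "R x\<^sub>0" by (rule W)
  have polar_iff: "R x = polar r 0 \<longleftrightarrow> x = polar r a" "R x = polar r (pi / real m) \<longleftrightarrow> x = polar r b" for x r
    unfolding a [symmetric] b [symmetric] by (metis inj)+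
  have "W t \<omega> \<in> F \<longleftrightarrow> R (W t \<omega>) \<in> wedge_boundary 0 (pi / real m)" for t \<omega>
    by (auto simp: F wedge_boundary_def ray_def polar_iff)
  then have hit: "hitting_time W F = hitting_time (\<lambda>t \<omega>. R (W t \<omega>)) (wedge_boundary 0 (pi / real m))"
    by (simp add: hitting_time_def fun_eq_iff)
  have "has_joint_density_on_ray M (\<lambda>t \<omega>. R (W t \<omega>)) (hitting_time W F) 0 (\<lambda>t r. W.exit_density m (t, r))"
    unfolding hit by (rule W.has_joint_density_normalized [OF m r\<^sub>0 \<delta> x\<^sub>0])
  then have "has_joint_density_on_ray M W (hitting_time W F) a (\<lambda>t r. W.exit_density m (t, r))"
    by (simp add: has_joint_density_on_ray_def polar_iff)
  then show ?thesis
  proof (rule has_joint_density_on_ray_cong)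
    fix t r :: real assume "0 < t"
    then show "W.exit_density m (t, r) = g t r"
      unfolding W.exit_density_def g by (simp add: x\<^sub>0 rotate_polar poisson_kernel_polar sum_distrib_left)
  qed
qed

theorem theorem4:
  fixes M :: "'a measure" and W :: "real \<Rightarrow> 'a \<Rightarrow> real \<times> real"
    and \<alpha>m \<alpha>p \<theta>\<^sub>0 r\<^sub>0 :: real and x\<^sub>0 :: "real \<times> real" and m :: nat
    and \<tau> :: "'a \<Rightarrow> ereal" and \<gamma>p \<gamma>m :: "nat \<Rightarrow> real"
  assumes "0 \<le> \<alpha>m" and "\<alpha>m < \<alpha>p" and "\<alpha>p < 2 * pi"
    and "1 \<le> m" and "\<alpha>p - \<alpha>m = pi / real m"
    and "0 \<le> r\<^sub>0" and "\<theta>\<^sub>0 \<in> {\<alpha>m..\<alpha>p}"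
    and "x\<^sub>0 = polar r\<^sub>0 \<theta>\<^sub>0" and "x\<^sub>0 \<in> wedge \<alpha>m \<alpha>p"
    and "brownian_motion M W x\<^sub>0"
  defines "\<tau> \<equiv> hitting_time W (wedge_boundary \<alpha>m \<alpha>p)"
    and "\<gamma>p \<equiv> (\<lambda>k. \<alpha>p + 2 * real k * pi / real m - \<theta>\<^sub>0)"
    and "\<gamma>m \<equiv> (\<lambda>k. - \<alpha>m - 2 * real k * pi / real m + \<theta>\<^sub>0)"
  shows "has_joint_density_on_ray M W \<tau> \<alpha>p
           (\<lambda>t r. r\<^sub>0 / (2 * pi * t\<^sup>2) * exp (- (r\<^sup>2 + r\<^sub>0\<^sup>2) / (2 * t)) *
              (\<Sum>k<m. sin (\<gamma>p k) * exp (r * r\<^sub>0 / t * cos (\<gamma>p k))))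
       \<and> has_joint_density_on_ray M W \<tau> \<alpha>m
           (\<lambda>t r. r\<^sub>0 / (2 * pi * t\<^sup>2) * exp (- (r\<^sup>2 + r\<^sub>0\<^sup>2) / (2 * t)) *
              (\<Sum>k<m. sin (\<gamma>m k) * exp (r * r\<^sub>0 / t * cos (\<gamma>m k))))"
proof
  note m = \<open>1 \<le> m\<close> and r\<^sub>0 = \<open>0 \<le> r\<^sub>0\<close> and angle = \<open>\<alpha>p - \<alpha>m = pi / real m\<close> and \<theta>\<^sub>0 = \<open>\<theta>\<^sub>0 \<in> {\<alpha>m..\<alpha>p}\<close>
    and x\<^sub>0 = \<open>x\<^sub>0 = polar r\<^sub>0 \<theta>\<^sub>0\<close>
  interpret planar_brownian_motion M W x\<^sub>0
    using \<open>brownian_motion M W x\<^sub>0\<close> by (simp add: planar_brownian_motion_def)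
  show "has_joint_density_on_ray M W \<tau> \<alpha>p
      (\<lambda>t r. r\<^sub>0 / (2 * pi * t\<^sup>2) * exp (- (r\<^sup>2 + r\<^sub>0\<^sup>2) / (2 * t)) *
        (\<Sum>k<m. sin (\<gamma>p k) * exp (r * r\<^sub>0 / t * cos (\<gamma>p k))))"
  proof -
    \<comment> \<open>The reflection \<open>\<theta> \<mapsto> \<alpha>p - \<theta>\<close>. It
      brings the upper ray to angle 0 with the wedge above it, whereas a rotation would leave the
      wedge below.\<close>
    define R where "R = (\<lambda>x. (cos \<alpha>p * fst x + sin \<alpha>p * snd x, sin \<alpha>p * fst x + (- cos \<alpha>p) * snd x))"
    have R_polar: "R (polar r \<theta>) = polar r (\<alpha>p - \<theta>)" for r \<theta>
      by (simp add: R_def polar_def cos_diff sin_diff algebra_simps)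
    have inj: "x = y" if "R x = R y" for x y
    proof -
      have "R (R z) = z" for z
      proof -
        obtain r \<theta> where "z = polar r \<theta>" using polar_representation by blast
        then show ?thesis by (simp add: R_polar)
      qed
      with that show ?thesis by metis
    qed
    have bm: "planar_brownian_motion M (\<lambda>t \<omega>. R (W t \<omega>)) (R x\<^sub>0)"
      unfolding R_def
    proof (rule orthogonal_image)
      have "cos \<alpha>p * (- cos \<alpha>p) - sin \<alpha>p * sin \<alpha>p = - ((cos \<alpha>p)\<^sup>2 + (sin \<alpha>p)\<^sup>2)"
        by algebra
      then show "\<bar>cos \<alpha>p * (- cos \<alpha>p) - sin \<alpha>p * sin \<alpha>p\<bar> = 1" by simp
      fix a b
      have "(cos \<alpha>p * a + sin \<alpha>p * b)\<^sup>2 + (sin \<alpha>p * a + - cos \<alpha>p * b)\<^sup>2 = ((cos \<alpha>p)\<^sup>2 + (sin \<alpha>p)\<^sup>2) * (a\<^sup>2 + b\<^sup>2)"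
        by algebra
      then show "(cos \<alpha>p * a + sin \<alpha>p * b)\<^sup>2 + (sin \<alpha>p * a + - cos \<alpha>p * b)\<^sup>2 = a\<^sup>2 + b\<^sup>2" by simp
    qed
    show ?thesis
      unfolding \<tau>_def
    proof (rule has_joint_density_on_ray_isometry [where R = R and W = W and x\<^sub>0 = x\<^sub>0 and b = \<alpha>m
          and \<delta> = "\<alpha>p - \<theta>\<^sub>0" and m = m and r\<^sub>0 = r\<^sub>0, OF bm inj])
      show "wedge_boundary \<alpha>m \<alpha>p = ray \<alpha>p \<union> ray \<alpha>m" by (simp add: wedge_boundary_def)
    qed (use m r\<^sub>0 angle \<theta>\<^sub>0 in \<open>simp_all add: R_polar x\<^sub>0 \<gamma>p_def image_angle_def algebra_simps\<close>)
  qed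
  show "has_joint_density_on_ray M W \<tau> \<alpha>m
      (\<lambda>t r. r\<^sub>0 / (2 * pi * t\<^sup>2) * exp (- (r\<^sup>2 + r\<^sub>0\<^sup>2) / (2 * t)) *
        (\<Sum>k<m. sin (\<gamma>m k) * exp (r * r\<^sub>0 / t * cos (\<gamma>m k))))"
  proof -
    \<comment> \<open>For the lower ray the wedge is already on the side of increasing angles, so
      the rotation by \<open>- \<alpha>m\<close> is enough.\<close>
    define R where "R = (\<lambda>x. (cos \<alpha>m * fst x + sin \<alpha>m * snd x, (- sin \<alpha>m) * fst x + cos \<alpha>m * snd x))"
    have R_rotate: "R = rotate (- \<alpha>m)"
      by (simp add: R_def rotate_def fun_eq_iff)
    have R_polar: "R (polar r \<theta>) = polar r (\<theta> - \<alpha>m)" for r \<theta>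
      by (simp add: R_rotate rotate_polar)
    have inj: "x = y" if "R x = R y" for x y
    proof -
      have "rotate \<alpha>m (R z) = z" for z
      proof -
        obtain r \<theta> where "z = polar r \<theta>" using polar_representation by blast
        then show ?thesis by (simp add: R_polar rotate_polar)
      qed
      with that show ?thesis by metis
    qed
    have bm: "planar_brownian_motion M (\<lambda>t \<omega>. R (W t \<omega>)) (R x\<^sub>0)"
      unfolding R_def
    proof (rule orthogonal_image)
      have "cos \<alpha>m * cos \<alpha>m - sin \<alpha>m * (- sin \<alpha>m) = (cos \<alpha>m)\<^sup>2 + (sin \<alpha>m)\<^sup>2"
        by (simp add: power2_eq_square)
      then show "\<bar>cos \<alpha>m * cos \<alpha>m - sin \<alpha>m * (- sin \<alpha>m)\<bar> = 1" by simp
      fix a b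
      have "(cos \<alpha>m * a + sin \<alpha>m * b)\<^sup>2 + (- sin \<alpha>m * a + cos \<alpha>m * b)\<^sup>2 = ((cos \<alpha>m)\<^sup>2 + (sin \<alpha>m)\<^sup>2) * (a\<^sup>2 + b\<^sup>2)"
        by algebra
      then show "(cos \<alpha>m * a + sin \<alpha>m * b)\<^sup>2 + (- sin \<alpha>m * a + cos \<alpha>m * b)\<^sup>2 = a\<^sup>2 + b\<^sup>2" by simp
    qed
    have sum: "(\<Sum>k<m. sin (\<gamma>m k) * exp (c * cos (\<gamma>m k))) =
        (\<Sum>k<m. sin (\<theta>\<^sub>0 - \<alpha>m + image_angle m k) * exp (c * cos (\<theta>\<^sub>0 - \<alpha>m + image_angle m k)))" for c
    proof -
      have "(\<Sum>k<m. sin (\<gamma>m k) * exp (c * cos (\<gamma>m k))) =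
          (\<Sum>k<m. sin (\<theta>\<^sub>0 - \<alpha>m - image_angle m k) * exp (c * cos (\<theta>\<^sub>0 - \<alpha>m - image_angle m k)))"
        by (simp add: \<gamma>m_def image_angle_def algebra_simps)
      also have "\<dots> = (\<Sum>k<m. sin (\<theta>\<^sub>0 - \<alpha>m + image_angle m k) * exp (c * cos (\<theta>\<^sub>0 - \<alpha>m + image_angle m k)))"
        by (rule sum_image_angle_uminus [OF m, where g = "\<lambda>x. sin x * exp (c * cos x)"]) simp
      finally show ?thesis .
    qed
    show ?thesis
      unfolding \<tau>_def
    proof (rule has_joint_density_on_ray_isometry [where R = R and W = W and x\<^sub>0 = x\<^sub>0 and b = \<alpha>p
          and \<delta> = "\<theta>\<^sub>0 - \<alpha>m" and m = m and r\<^sub>0 = r\<^sub>0, OF bm inj])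
      show "wedge_boundary \<alpha>m \<alpha>p = ray \<alpha>m \<union> ray \<alpha>p" by (auto simp: wedge_boundary_def)
      show "r\<^sub>0 / (2 * pi * t\<^sup>2) * exp (- (r\<^sup>2 + r\<^sub>0\<^sup>2) / (2 * t)) * (\<Sum>k<m. sin (\<gamma>m k) * exp (r * r\<^sub>0 / t * cos (\<gamma>m k))) =
          r\<^sub>0 / (2 * pi * t\<^sup>2) * exp (- (r\<^sup>2 + r\<^sub>0\<^sup>2) / (2 * t)) *
          (\<Sum>k<m. sin (\<theta>\<^sub>0 - \<alpha>m + image_angle m k) * exp (r * r\<^sub>0 / t * cos (\<theta>\<^sub>0 - \<alpha>m + image_angle m k)))" for t r
        unfolding sum ..
    qed (use m r\<^sub>0 angle \<theta>\<^sub>0 in \<open>simp_all add: R_polar x\<^sub>0\<close>)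
  qed
qed

end
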